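(* Let $\gamma<0$ and assume (Increments), (Waiting times) and (Local uniform integrability) as described in the context. Then, for any $\pi\in\mathcal{S}$, $$\lim_{m\to\infty}\ \sup_{\mathbf\Pi\in\mathcal{A}_m(\pi)}J^\gamma_m(\mathbf\Pi,\pi)=\sup_{\mathbf\Pi\in\mathcal{A}(\pi)}J^\gamma(\mathbf\Pi,\pi),$$ where $J^\gamma$, $\mathcal{A}(\pi)$ refer to the problem with waiting times $(\eta_i)$ and $J^\gamma_m$, $\mathcal{A}_m(\pi)$ to the problem with the dyadic waiting times $(\eta_i^m)$, as defined in the context.
   Context: Notation. $d\ge1$; $\langle x,y\rangle$ is the scalar product, $x\cdot y$ the component-wise product on $\mathbb{R}^d$; $\mathbf{1}=(1,\dots,1)$. $\mathcal{S}=\{\pi\in\mathbb{R}^d:\pi_i\ge0,\ \langle\pi,\mathbf{1}\rangle=1\}$. $G(x,y):=\frac{x\cdot y}{\langle x,y\rangle}$. Transaction costs. $c_i,h_i\in[0,1)$, $i=1,\dots,d$; $p(x):=\sum_{i=1}^d\max(c_ix_i,-h_ix_i)$. For $\pi,\pi'\in\mathcal{S}$, $s(\pi,\pi')$ denotes the unique $w>0$ with $w+p(w\pi'-\pi)=1$ (ratio of wealth after to wealth before rebalancing from $\pi$ to $\pi'$ in a self-financing way). Market. $S(t)=(S_1(t),\dots,S_d(t))$, $t\ge0$, is a process of strictly positive prices, $R(t_1,t_2)=(S_i(t_2)/S_i(t_1))_{i}$, $R(t)=R(0,t)$, $r(t)=\ln R(t)$ (component-wise). $(\eta_i)_{i\ge1}$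 are i.i.d. $(0,\infty)$-valued random variables, independent of the price process. (Increments): $t\mapsto\ln S(t)$ is right-continuous and has stationary independent increments. (Waiting times): $\mathbb{P}[\eta_i>0]=1$ and $\mathbb{E}[\eta_i]<\infty$. (Local uniform integrability): for any $\gamma<0$ there exists $h>0$ such that $\mathbb{E}\big[e^{\gamma\min_{i}\inf_{t\in[0,h]}r_i(\eta_1+t)}\big]<\infty$ and $\mathbb{E}\big[\max_{i}\sup_{t\in[0,h]}r_i(\eta_1+t)\big]<\infty$. Dyadic waiting times. For $m\in\mathbb{N}$, $\eta_i^m:=\sum_{j=0}^\infty\frac{j+1}{2^m}1_{\{j2^{-m}<\eta_i\le(j+1)2^{-m}\}}$. Intervention times: $\tau_0=0$, $\tau_{n+1}=\tau_n+\eta_{n+1}$; $\tau_0^m=0$, $\tau_{n+1}^m=\tau_n^m+\eta_{n+1}^m$. Entropic utility ($\gamma<0$). $\mu^\gamma[Z]:=\frac1\gamma\ln\mathbb{E}[e^{\gamma Z}]$ (equal to $-\infty$ if the expectation is $+\infty$). Strategies and functionals. Let $(\zeta_i)$ be either $(\eta_i)$ or $(\eta_i^m)$ and $\sigma_n$ the corresponding times $\tau_n$ or $\tau_n^m$. The admissible set started at $\pi\in\mathcal{S}$ consists of $\mathcal{S}$-valued weight processes $\mathbf\Pi=(\pi(t))_{t\ge0}$ with $\pi(0-)=\pi$, rebalanced only at the times $\sigma_n$: at $\sigma_n$ new weights $\pi(\sigma_n)\in\mathcal{S}$ are chosen non-anticipatively, $\pi(t)=G(\pi(\sigma_n),R(\sigma_n,t))$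 for $t\in[\sigma_n,\sigma_{n+1})$, and the pre-rebalancing weights are $\pi(\sigma_{n+1}^-)=G(\pi(\sigma_n),R(\sigma_n,\sigma_{n+1}))$, $\pi(\sigma_0^-)=\pi$. Non-anticipative means: $\pi(\sigma_n)$ is measurable with respect to $\mathcal{G}_n$, where $(\mathcal{G}_n)_{n\ge0}$ is a given increasing sequence of $\sigma$-fields (information at $\sigma_n$) such that $\zeta_1,\dots,\zeta_n$ and the price path stopped at $\sigma_n$ are $\mathcal{G}_n$-measurable and $((\zeta_k)_{k>n},(R(\sigma_n,\sigma_n+t))_{t\ge0})$ is independent of $\mathcal{G}_n$. The admissible set is denoted $\mathcal{A}(\pi)$ for $(\eta_i)$ and $\mathcal{A}_m(\pi)$ for $(\eta_i^m)$. The functional $$\liminf_{n\to\infty}\frac1{\mathbb{E}[\sigma_n]}\mu^\gamma\Big[\sum_{i=0}^{n-1}\big(\ln s(\pi(\sigma_i^-),\pi(\sigma_i))+\ln\langle\pi(\sigma_i),R(\sigma_i,\sigma_{i+1})\rangle\big)\Big]$$ is denoted $J^\gamma(\mathbf\Pi,\pi)$ for $\sigma_n=\tau_n$ and $J^\gamma_m(\mathbf\Pi,\pi)$ for $\sigma_n=\tau_n^m$. (The $i$th summand equals $\ln\big(W(\sigma_{i+1}^-)/W(\sigma_i^-)\big)$, where $W$ is the portfolio wealth.) *)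

theory Defs
  imports "HOL-Probability.Probability"
begin

section \<open>Portfolio weights and proportional transaction costs\<close>

text \<open>Multiplication and \<open>1\<close> on \<^typ>\<open>real^'d\<close> are the component-wise library operations.\<close>

definition weight_simplex :: "(real^'d) set" where
  "weight_simplex = {\<pi>. (\<forall>i. 0 \<le> \<pi> $ i) \<and> \<pi> \<bullet> 1 = 1}"

definition drift :: "real^'d \<Rightarrow> real^'d \<Rightarrow> real^'d" where
  "drift x y = (x * y) /\<^sub>R (x \<bullet> y)"

definition cost :: "real^'d \<Rightarrow> real^'d \<Rightarrow> real^'d \<Rightarrow> real" where
  "cost c h x = (\<Sum>i\<in>UNIV. max (c $ i * x $ i) (- h $ i * x $ i))"

text \<open>The equation has exactly one positive solution when all cost rates lie in \<open>[0,1)\<close> and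
  both arguments are in \<^const>\<open>weight_simplex\<close>.\<close>

definition shrink :: "real^'d \<Rightarrow> real^'d \<Rightarrow> real^'d \<Rightarrow> real^'d \<Rightarrow> real" where
  "shrink c h \<pi> \<pi>' = (THE w. 0 < w \<and> w + cost c h (w *\<^sub>R \<pi>' - \<pi>) = 1)"


section \<open>Prices\<close>

definition returns :: "(real \<Rightarrow> 'w \<Rightarrow> real^'d) \<Rightarrow> real \<Rightarrow> real \<Rightarrow> 'w \<Rightarrow> real^'d" where
  "returns S t u \<omega> = (\<chi> i. S u \<omega> $ i / S t \<omega> $ i)"

definition log_return :: "(real \<Rightarrow> 'w \<Rightarrow> real^'d) \<Rightarrow> real \<Rightarrow> 'w \<Rightarrow> real^'d" where
  "log_return S t \<omega> = (\<chi> i. ln (returns S 0 t \<omega> $ i))"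

definition log_price :: "(real \<Rightarrow> 'w \<Rightarrow> real^'d) \<Rightarrow> real \<Rightarrow> 'w \<Rightarrow> real^'d" where
  "log_price S t \<omega> = (\<chi> i. ln (S t \<omega> $ i))"

text \<open>The time index set is \<open>[0,\<infinity>)\<close>; values of \<open>S\<close> at negative times are never used.\<close>

definition price_process :: "'w measure \<Rightarrow> (real \<Rightarrow> 'w \<Rightarrow> real^'d) \<Rightarrow> bool" where
  "price_process M S \<longleftrightarrow>
     (\<forall>t\<ge>0. S t \<in> borel_measurable M) \<and>
     (\<forall>t\<ge>0. \<forall>\<omega>\<in>space M. \<forall>i. 0 < S t \<omega> $ i)"

definition stationary_increments :: "'w measure \<Rightarrow> (real \<Rightarrow> 'w \<Rightarrow> real^'d) \<Rightarrow> bool" where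
  "stationary_increments M X \<longleftrightarrow>
     (\<forall>t\<ge>0. \<forall>u\<ge>0. distr M borel (\<lambda>\<omega>. X (t + u) \<omega> - X t \<omega>) = distr M borel (\<lambda>\<omega>. X u \<omega> - X 0 \<omega>))"

definition independent_increments :: "'w measure \<Rightarrow> (real \<Rightarrow> 'w \<Rightarrow> real^'d) \<Rightarrow> bool" where
  "independent_increments M X \<longleftrightarrow>
     (\<forall>n. \<forall>t :: nat \<Rightarrow> real. 0 \<le> t 0 \<and> strict_mono_on {..n} t \<longrightarrow>
        prob_space.indep_vars M (\<lambda>_. borel) (\<lambda>k \<omega>. X (t (Suc k)) \<omega> - X (t k) \<omega>) {..<n})"

definition increments_cond :: "'w measure \<Rightarrow> (real \<Rightarrow> 'w \<Rightarrow> real^'d) \<Rightarrow> bool" where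
  "increments_cond M S \<longleftrightarrow>
     (\<forall>\<omega>\<in>space M. \<forall>t\<ge>0. continuous (at_right t) (\<lambda>u. log_price S u \<omega>)) \<and>
     stationary_increments M (log_price S) \<and>
     independent_increments M (log_price S)"


section \<open>Waiting times and intervention times\<close>

text \<open>Waiting times are indexed by \<open>i \<ge> 1\<close>; the value at index \<open>0\<close> is never used.\<close>

definition waiting_times :: "'w measure \<Rightarrow> (nat \<Rightarrow> 'w \<Rightarrow> real) \<Rightarrow> bool" where
  "waiting_times M \<eta> \<longleftrightarrow>
     prob_space.indep_vars M (\<lambda>_. borel) \<eta> {1..} \<and>
     (\<forall>i\<ge>1. distr M borel (\<eta> i) = distr M borel (\<eta> 1)) \<and>
     (\<forall>i\<ge>1. \<forall>\<omega>\<in>space M. 0 < \<eta> i \<omega>)"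

definition indep_of_prices ::
    "'w measure \<Rightarrow> (nat \<Rightarrow> 'w \<Rightarrow> real) \<Rightarrow> (real \<Rightarrow> 'w \<Rightarrow> real^'d) \<Rightarrow> bool" where
  "indep_of_prices M \<eta> S \<longleftrightarrow>
     prob_space.indep_set M
       (sets (vimage_algebra (space M) (\<lambda>\<omega>. \<lambda>i\<in>{1..}. \<eta> i \<omega>) (\<Pi>\<^sub>M i\<in>{1..}. borel)))
       (sets (vimage_algebra (space M) (\<lambda>\<omega>. \<lambda>t\<in>{0..}. S t \<omega>) (\<Pi>\<^sub>M t\<in>{0..}. borel)))"

definition waiting_times_cond :: "'w measure \<Rightarrow> (nat \<Rightarrow> 'w \<Rightarrow> real) \<Rightarrow> bool" where
  "waiting_times_cond M \<eta> \<longleftrightarrow>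
     (\<forall>i\<ge>1. measure M {\<omega> \<in> space M. 0 < \<eta> i \<omega>} = 1 \<and> integrable M (\<eta> i))"

definition dyadic :: "nat \<Rightarrow> (nat \<Rightarrow> 'w \<Rightarrow> real) \<Rightarrow> nat \<Rightarrow> 'w \<Rightarrow> real" where
  "dyadic m \<eta> i \<omega> =
     (\<Sum>j. (real j + 1) / 2 ^ m * indicator {real j / 2 ^ m <.. (real j + 1) / 2 ^ m} (\<eta> i \<omega>))"

definition intervention_time :: "(nat \<Rightarrow> 'w \<Rightarrow> real) \<Rightarrow> nat \<Rightarrow> 'w \<Rightarrow> real" where
  "intervention_time \<zeta> n \<omega> = (\<Sum>i=1..n. \<zeta> i \<omega>)"


section \<open>Local uniform integrability\<close>

text \<open>Infima and suprema over \<open>[0,h]\<close> of a merely right-continuous path can be infinite, so they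
  are taken in \<^typ>\<open>ereal\<close>.\<close>

definition ereal_exp :: "ereal \<Rightarrow> ennreal" where
  "ereal_exp x = (case x of ereal r \<Rightarrow> ennreal (exp r) | PInfty \<Rightarrow> \<infinity> | MInfty \<Rightarrow> 0)"

text \<open>Expectation of an extended real variable as positive part minus negative part
  (\<^const>\<open>e2ennreal\<close> maps negative numbers to \<open>0\<close>). If both parts are infinite, the value is \<open>\<infinity>\<close>.\<close>

definition ereal_expectation :: "'w measure \<Rightarrow> ('w \<Rightarrow> ereal) \<Rightarrow> ereal" where
  "ereal_expectation M X =
     enn2ereal (\<integral>\<^sup>+\<omega>. e2ennreal (X \<omega>) \<partial>M) - enn2ereal (\<integral>\<^sup>+\<omega>. e2ennreal (- X \<omega>) \<partial>M)"

definition local_uniform_integrability ::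
    "'w measure \<Rightarrow> (real \<Rightarrow> 'w \<Rightarrow> real^'d) \<Rightarrow> (nat \<Rightarrow> 'w \<Rightarrow> real) \<Rightarrow> bool" where
  "local_uniform_integrability M S \<eta> \<longleftrightarrow>
     (\<forall>\<gamma><0. \<exists>h>0.
        (\<integral>\<^sup>+\<omega>. ereal_exp (ereal \<gamma> *
            (MIN i. INF t\<in>{0..h}. ereal (log_return S (\<eta> 1 \<omega> + t) \<omega> $ i))) \<partial>M) < \<infinity> \<and>
        ereal_expectation M
            (\<lambda>\<omega>. MAX i. SUP t\<in>{0..h}. ereal (log_return S (\<eta> 1 \<omega> + t) \<omega> $ i)) < \<infinity>)"


section \<open>Strategies and the entropic growth functional\<close>

definition information ::
    "'w measure \<Rightarrow> (real \<Rightarrow> 'w \<Rightarrow> real^'d) \<Rightarrow> (nat \<Rightarrow> 'w \<Rightarrow> real) \<Rightarrow> (nat \<Rightarrow> 'w measure) \<Rightarrow> bool" where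
  "information M S \<zeta> G \<longleftrightarrow>
     (\<forall>n. subalgebra M (G n)) \<and>
     (\<forall>n. sets (G n) \<subseteq> sets (G (Suc n))) \<and>
     (\<forall>n. \<forall>k\<in>{1..n}. \<zeta> k \<in> borel_measurable (G n)) \<and>
     (\<forall>n. \<forall>t\<ge>0. (\<lambda>\<omega>. S (min t (intervention_time \<zeta> n \<omega>)) \<omega>) \<in> borel_measurable (G n)) \<and>
     (\<forall>n. prob_space.indep_set M (sets (G n))
        (sets (vimage_algebra (space M)
           (\<lambda>\<omega>. (\<lambda>k\<in>{n<..}. \<zeta> k \<omega>,
                 \<lambda>t\<in>{0..}. returns S (intervention_time \<zeta> n \<omega>) (intervention_time \<zeta> n \<omega> + t) \<omega>))
           ((\<Pi>\<^sub>M k\<in>{n<..}. borel) \<Otimes>\<^sub>M (\<Pi>\<^sub>M t\<in>{0..}. borel)))))"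

text \<open>The condition \<open>\<pi>(0-) = \<pi>\<close> is expressed by extending the weight process to negative times by
  the constant \<open>\<pi>\<close>.\<close>

definition admissible ::
    "'w measure \<Rightarrow> (real \<Rightarrow> 'w \<Rightarrow> real^'d) \<Rightarrow> (nat \<Rightarrow> 'w \<Rightarrow> real) \<Rightarrow> (nat \<Rightarrow> 'w measure) \<Rightarrow> real^'d \<Rightarrow>
     (real \<Rightarrow> 'w \<Rightarrow> real^'d) set" where
  "admissible M S \<zeta> G \<pi> = {P.
     (\<forall>\<omega>\<in>space M. \<forall>t<0. P t \<omega> = \<pi>) \<and>
     (\<forall>\<omega>\<in>space M. \<forall>t\<ge>0. P t \<omega> \<in> weight_simplex) \<and>
     (\<forall>n. (\<lambda>\<omega>. P (intervention_time \<zeta> n \<omega>) \<omega>) \<in> borel_measurable (G n)) \<and>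
     (\<forall>n. \<forall>\<omega>\<in>space M. \<forall>t\<in>{intervention_time \<zeta> n \<omega>..<intervention_time \<zeta> (Suc n) \<omega>}.
        P t \<omega> = drift (P (intervention_time \<zeta> n \<omega>) \<omega>) (returns S (intervention_time \<zeta> n \<omega>) t \<omega>))}"

text \<open>Weights immediately before the rebalancing at the \<open>n\<close>-th intervention time. They are given by
  the formula and not as a left limit, since prices need not have left limits.\<close>

fun pre_weights ::
    "(real \<Rightarrow> 'w \<Rightarrow> real^'d) \<Rightarrow> (nat \<Rightarrow> 'w \<Rightarrow> real) \<Rightarrow> (real \<Rightarrow> 'w \<Rightarrow> real^'d) \<Rightarrow> real^'d \<Rightarrow>
     nat \<Rightarrow> 'w \<Rightarrow> real^'d" where
  "pre_weights S \<zeta> P \<pi> 0 \<omega> = \<pi>"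
| "pre_weights S \<zeta> P \<pi> (Suc n) \<omega> =
     drift (P (intervention_time \<zeta> n \<omega>) \<omega>)
       (returns S (intervention_time \<zeta> n \<omega>) (intervention_time \<zeta> (Suc n) \<omega>) \<omega>)"

definition log_growth ::
    "real^'d \<Rightarrow> real^'d \<Rightarrow> (real \<Rightarrow> 'w \<Rightarrow> real^'d) \<Rightarrow> (nat \<Rightarrow> 'w \<Rightarrow> real) \<Rightarrow>
     (real \<Rightarrow> 'w \<Rightarrow> real^'d) \<Rightarrow> real^'d \<Rightarrow> nat \<Rightarrow> 'w \<Rightarrow> real" where
  "log_growth c h S \<zeta> P \<pi> i \<omega> =
     ln (shrink c h (pre_weights S \<zeta> P \<pi> i \<omega>) (P (intervention_time \<zeta> i \<omega>) \<omega>)) +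
     ln (P (intervention_time \<zeta> i \<omega>) \<omega> \<bullet>
         returns S (intervention_time \<zeta> i \<omega>) (intervention_time \<zeta> (Suc i) \<omega>) \<omega>)"

definition entropic_utility :: "'w measure \<Rightarrow> real \<Rightarrow> ('w \<Rightarrow> real) \<Rightarrow> ereal" where
  "entropic_utility M \<gamma> Z =
     (let e = (\<integral>\<^sup>+\<omega>. ennreal (exp (\<gamma> * Z \<omega>)) \<partial>M)
      in if e = \<infinity> then -\<infinity> else ereal (1 / \<gamma> * ln (enn2real e)))"

definition growth_functional ::
    "'w measure \<Rightarrow> real \<Rightarrow> real^'d \<Rightarrow> real^'d \<Rightarrow> (real \<Rightarrow> 'w \<Rightarrow> real^'d) \<Rightarrow> (nat \<Rightarrow> 'w \<Rightarrow> real) \<Rightarrow>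
     (real \<Rightarrow> 'w \<Rightarrow> real^'d) \<Rightarrow> real^'d \<Rightarrow> ereal" where
  "growth_functional M \<gamma> c h S \<zeta> P \<pi> =
     liminf (\<lambda>n. ereal (1 / integral\<^sup>L M (intervention_time \<zeta> n)) *
       entropic_utility M \<gamma> (\<lambda>\<omega>. \<Sum>i<n. log_growth c h S \<zeta> P \<pi> i \<omega>))"

end

theory Submission
  imports Defs
begin

text \<open>
  A strategy is followed through its positions in units of money. Rebalancing a position \<open>x\<close> to the
  weights \<open>p\<close> leaves the wealth \<open>rebalanced_wealth c h x p\<close>, which is homogeneous and increasing in
  \<open>x\<close> and lies between a fixed fraction of the wealth of \<open>x\<close> and this wealth. Since \<open>\<gamma> < 0\<close>, maximal
  entropic utility means minimal expectation of the power \<open>W powr \<gamma>\<close> of the terminal wealth. Its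
  infimum over \<open>n\<close> periods is the \<open>n\<close>-th iterate \<open>u\<^sub>n\<close> (\<open>optimal_moment\<close>) of the one-period operator
  \<open>bellman\<close>, applied to this power.

  Two properties of the iterates replace compactness, continuity and the Bellman equation of the
  ergodic problem. They are antitone and homogeneous of degree \<open>\<gamma>\<close> (\<open>cone_decreasing\<close>), hence
  their logarithms are Lipschitz continuous in logarithmic coordinates. And up to one constant for all \<open>n\<close> they are
  multiples of \<open>W powr \<gamma>\<close> (\<open>power_comparable\<close>), because any two positions of the same wealth can be
  moved to the same weights at a bounded relative cost.

  For fixed waiting times the value is \<open>liminf (- ln u\<^sub>n / n)\<close> divided by \<open>- \<gamma>\<close> times the mean waiting
  time (\<open>optimal_growth\<close>). No strategy does better, since the returns of successive periods are
  independent of the past and identically distributed (\<open>optimal_moment_le_strategy\<close>,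
  \<open>nn_integral_period_return\<close>). Conversely, if \<open>u\<^sub>N\<close> lies far enough below \<open>exp (- v N)\<close> for one
  \<open>N\<close>, then the discounted minimum of \<open>u\<^sub>0, \<dots>, u\<^sub>N\<^sub>-\<^sub>1\<close> is a supersolution: the operator contracts it by
  the factor \<open>exp (- v)\<close> (\<open>supersolution\<close>), and nearly optimal weights for it, applied in every period,
  give a strategy whose moments decay at the rate \<open>v\<close> (\<open>stationary_policy\<close>,
  \<open>near_optimal_strategy\<close>).

  The waiting times thus enter the value through their mean and through the law of the returns over
  one period. The dyadic waiting times decrease to the original ones, so the means converge, and so do
  the returns, by right-continuity. Local uniform integrability dominates their negative powers.
  Therefore the one-period operators are close in relative terms, uniformly on functions with the two
  properties above: within a factor \<open>1 + \<epsilon>\<close> for fine dyadic grids. Hence \<open>u\<^sub>n\<close> changes at most by the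
  factor \<open>(1 + \<epsilon>) ^ n\<close>, for every \<open>n\<close> at once (\<open>eventually_optimal_moment_close\<close>), and the decay rate
  at most by \<open>ln (1 + \<epsilon>)\<close>.
\<close>

section \<open>Rebalancing a dollar position\<close>

definition position_cone :: "(real^'d) set" where
  "position_cone = {x. (\<forall>i. 0 \<le> x $ i) \<and> 0 < x \<bullet> 1}"

lemma inner_one_eq_sum: "(x::real^'d) \<bullet> 1 = (\<Sum>i\<in>UNIV. x $ i)"
  by (simp add: inner_vec_def)

lemma simplex_subset_cone: "weight_simplex \<subseteq> position_cone"
  by (auto simp: weight_simplex_def position_cone_def)

lemma position_cone_scale: "x \<in> position_cone \<Longrightarrow> 0 < t \<Longrightarrow> t *\<^sub>R x \<in> position_cone"
  by (auto simp: position_cone_def)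

lemma position_cone_mult:
  fixes x r :: "real^'d"
  assumes "x \<in> position_cone" "\<And>i. 0 < r $ i"
  shows "x * r \<in> position_cone"
proof -
  from assms(1) have nn: "\<And>i. 0 \<le> x $ i" and "0 < (\<Sum>i\<in>UNIV. x $ i)"
    by (auto simp: position_cone_def inner_one_eq_sum)
  then obtain j where "0 < x $ j"
    by (metis not_less sum_nonpos)
  then have "0 < (\<Sum>i\<in>UNIV. x $ i * r $ i)"
    using nn assms(2) by (intro sum_pos2[of _ j]) (simp_all add: less_imp_le)
  then show ?thesis
    using nn assms(2) by (auto simp: position_cone_def inner_one_eq_sum less_imp_le)
qed

lemma cost_scale: "0 \<le> t \<Longrightarrow> cost c h (t *\<^sub>R x) = t * cost c h x"
  unfolding cost_def sum_distrib_left
  by (intro sum.cong) (auto simp: max_mult_distrib_left mult_ac)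

lemma cost_add_le: "cost c h (x + y) \<le> cost c h x + cost c h y"
  unfolding cost_def sum.distrib[symmetric]
  by (intro sum_mono) (auto simp: max_def algebra_simps)

lemma continuous_on_cost [continuous_intros]:
  "continuous_on A f \<Longrightarrow> continuous_on A (\<lambda>x. cost c h (f x))"
  unfolding cost_def by (intro continuous_intros)

text \<open>The wealth that is needed to leave \<open>w\<close> in the weights \<open>p\<close> when starting from the position \<open>x\<close>,
  minus the wealth that is available: a rebalancing is self-financing if the surplus is \<open>0\<close>.\<close>

definition surplus :: "real^'d \<Rightarrow> real^'d \<Rightarrow> real^'d \<Rightarrow> real^'d \<Rightarrow> real \<Rightarrow> real" where
  "surplus c h x p w = w + cost c h (w *\<^sub>R p - x) - x \<bullet> 1"

text \<open>Wealth after rebalancing from the position \<open>x\<close>, in units of money, to the weights \<open>p\<close>. On the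
  simplex this is \<^const>\<open>shrink\<close>; the point of the extension to the cone is that it is homogeneous
  and monotone in \<open>x\<close>, which replaces every continuity estimate below.\<close>

definition rebalanced_wealth :: "real^'d \<Rightarrow> real^'d \<Rightarrow> real^'d \<Rightarrow> real^'d \<Rightarrow> real" where
  "rebalanced_wealth c h x p = (THE w. 0 < w \<and> w + cost c h (w *\<^sub>R p - x) = x \<bullet> 1)"

lemma shrink_eq_rebalanced_wealth:
  "x \<in> weight_simplex \<Longrightarrow> shrink c h x p = rebalanced_wealth c h x p"
  by (simp add: shrink_def rebalanced_wealth_def weight_simplex_def)

locale proportional_costs =
  fixes c h :: "real^'d"
  assumes c_range: "\<And>i. c $ i \<in> {0..<1}" and h_range: "\<And>i. h $ i \<in> {0..<1}"
begin

definition max_sell_cost :: real where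
  "max_sell_cost = Max (range (\<lambda>i. h $ i))"

lemma max_sell_cost: "h $ i \<le> max_sell_cost" "0 \<le> max_sell_cost" "max_sell_cost < 1"
proof -
  show *: "h $ i \<le> max_sell_cost" for i
    by (simp add: max_sell_cost_def)
  show "0 \<le> max_sell_cost" using *[of undefined] h_range[of undefined] by auto
  show "max_sell_cost < 1" using h_range by (auto simp: max_sell_cost_def)
qed

text \<open>A lower bound for the fraction of wealth that survives one rebalancing: selling everything leaves
  at least the fraction \<open>1 - max_sell_cost\<close>, and the cost of buying is at most the value bought.\<close>

definition min_shrink :: real where
  "min_shrink = (1 - max_sell_cost) / 2"

lemma min_shrink_pos: "0 < min_shrink"
  using max_sell_cost by (simp add: min_shrink_def)

lemma cost_nonneg: "0 \<le> cost c h x"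
proof -
  have "0 \<le> max (c $ i * x $ i) (- h $ i * x $ i)" for i
  proof (cases "0 \<le> x $ i")
    case True
    then have "0 \<le> c $ i * x $ i" using c_range[of i] by simp
    then show ?thesis by (simp add: le_max_iff_disj)
  next
    case False
    then have "h $ i * x $ i \<le> 0" using h_range[of i] by (simp add: mult_nonneg_nonpos)
    then show ?thesis by (simp add: le_max_iff_disj)
  qed
  then show ?thesis unfolding cost_def by (intro sum_nonneg) auto
qed

lemma cost_buy_le:
  assumes "\<And>i. 0 \<le> x $ i" shows "cost c h x \<le> x \<bullet> 1"
  unfolding cost_def inner_one_eq_sum
proof (rule sum_mono)
  fix i
  have "c $ i * x $ i \<le> 1 * x $ i" using c_range[of i] assms by (intro mult_right_mono) auto
  moreover have "- (h $ i * x $ i) \<le> 0" using h_range[of i] assms[of i] by simp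
  ultimately show "max (c $ i * x $ i) (- h $ i * x $ i) \<le> x $ i" using assms[of i] by simp
qed

lemma cost_sell_le:
  assumes "\<And>i. 0 \<le> x $ i" shows "cost c h (- x) \<le> max_sell_cost * (x \<bullet> 1)"
  unfolding cost_def inner_one_eq_sum sum_distrib_left
proof (rule sum_mono)
  fix i
  have "h $ i * x $ i \<le> max_sell_cost * x $ i" using max_sell_cost assms by (intro mult_right_mono) auto
  moreover have "0 \<le> c $ i * x $ i" "0 \<le> h $ i * x $ i"
    using c_range[of i] h_range[of i] assms[of i] by auto
  ultimately show "max (c $ i * (- x) $ i) (- h $ i * (- x) $ i) \<le> max_sell_cost * x $ i"
    by simp
qed

text \<open>Lowering \<open>w\<close> by one unit amounts to selling one unit of the portfolio \<open>p\<close>, which costs less than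
  one unit. Hence the gain in \<open>w\<close> is never eaten up by costs.\<close>

lemma surplus_strict_mono:
  assumes p: "p \<in> weight_simplex" and "v < w"
  shows "surplus c h x p v < surplus c h x p w"
proof -
  have "cost c h (v *\<^sub>R p - x) = cost c h ((w *\<^sub>R p - x) + (w - v) *\<^sub>R (- p))"
    by (simp add: algebra_simps)
  also have "\<dots> \<le> cost c h (w *\<^sub>R p - x) + (w - v) * cost c h (- p)"
    using cost_add_le[of c h "w *\<^sub>R p - x" "(w - v) *\<^sub>R (- p)"] cost_scale[of "w - v" c h "- p"] \<open>v < w\<close>
    by linarith
  also have "cost c h (- p) \<le> max_sell_cost"
    using cost_sell_le[of p] p by (simp add: weight_simplex_def)
  then have "(w - v) * cost c h (- p) \<le> (w - v) * max_sell_cost"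
    using \<open>v < w\<close> by (intro mult_left_mono) auto
  also have "\<dots> < (w - v) * 1"
    using \<open>v < w\<close> max_sell_cost by (intro mult_strict_left_mono) auto
  finally show ?thesis by (simp add: surplus_def)
qed

lemma surplus_le_iff:
  assumes "p \<in> weight_simplex"
  shows "surplus c h x p v \<le> surplus c h x p w \<longleftrightarrow> v \<le> w"
  using surplus_strict_mono[OF assms, of v w x] surplus_strict_mono[OF assms, of w v x]
  by (metis linorder_le_less_linear order_le_less leD)

text \<open>Another unit of an asset adds \<open>1\<close> to the available wealth and less than \<open>1\<close> to the cost.\<close>

lemma surplus_antimono:
  assumes "x \<le> y"
  shows "surplus c h y p w \<le> surplus c h x p w"
proof -
  have "max (c $ i * (w * p $ i - y $ i)) (- h $ i * (w * p $ i - y $ i)) - y $ i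
      \<le> max (c $ i * (w * p $ i - x $ i)) (- h $ i * (w * p $ i - x $ i)) - x $ i" for i
  proof -
    have xy: "x $ i \<le> y $ i" using assms by (simp add: less_eq_vec_def)
    have "c $ i * x $ i \<le> c $ i * y $ i" using c_range[of i] xy by (intro mult_left_mono) auto
    moreover have "(1 - h $ i) * x $ i \<le> (1 - h $ i) * y $ i"
      using h_range[of i] xy by (intro mult_left_mono) auto
    ultimately show ?thesis
      using xy by (simp add: max_def algebra_simps)
  qed
  then show ?thesis
    unfolding surplus_def cost_def inner_one_eq_sum
    by (simp add: sum_subtractf[symmetric] sum_mono flip: add_diff_eq)
qed

lemma surplus_scale:
  assumes "0 \<le> t" shows "surplus c h (t *\<^sub>R x) p (t * w) = t * surplus c h x p w"
  using cost_scale[OF assms, of c h "w *\<^sub>R p - x"]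
  by (simp add: surplus_def algebra_simps)

lemma continuous_on_surplus: "continuous_on A (surplus c h x p)"
  unfolding surplus_def by (intro continuous_intros)

lemma rebalanced_wealth_exists:
  assumes x: "x \<in> position_cone" and p: "p \<in> weight_simplex"
  shows "\<exists>w>0. surplus c h x p w = 0"
proof -
  have x0: "0 < x \<bullet> 1" and xn: "\<And>i. 0 \<le> x $ i" using x by (auto simp: position_cone_def)
  have "cost c h (- x) \<le> max_sell_cost * (x \<bullet> 1)" by (rule cost_sell_le[OF xn])
  also have "\<dots> < 1 * (x \<bullet> 1)" using x0 max_sell_cost by (intro mult_strict_right_mono) auto
  finally have neg: "surplus c h x p 0 < 0" by (simp add: surplus_def)
  have "0 \<le> surplus c h x p (x \<bullet> 1)" by (simp add: surplus_def cost_nonneg)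
  then obtain w where "0 \<le> w" "surplus c h x p w = 0"
    using IVT'[of "surplus c h x p" 0 0 "x \<bullet> 1"] neg x0 continuous_on_surplus by auto
  with neg show ?thesis by (intro exI[of _ w]) (auto simp: order_le_less)
qed

lemma
  assumes x: "x \<in> position_cone" and p: "p \<in> weight_simplex"
  shows rebalanced_wealth_pos: "0 < rebalanced_wealth c h x p"
    and surplus_rebalanced_wealth: "surplus c h x p (rebalanced_wealth c h x p) = 0"
proof -
  obtain w where w: "0 < w" "surplus c h x p w = 0" using rebalanced_wealth_exists[OF x p] by auto
  have "rebalanced_wealth c h x p = w"
    unfolding rebalanced_wealth_def
  proof (rule the_equality)
    show "0 < w \<and> w + cost c h (w *\<^sub>R p - x) = x \<bullet> 1" using w by (simp add: surplus_def)
    fix v assume "0 < v \<and> v + cost c h (v *\<^sub>R p - x) = x \<bullet> 1"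
    then have "surplus c h x p v = surplus c h x p w" using w by (simp add: surplus_def)
    then show "v = w" using surplus_le_iff[OF p, of x v w] surplus_le_iff[OF p, of x w v] by auto
  qed
  with w show "0 < rebalanced_wealth c h x p" "surplus c h x p (rebalanced_wealth c h x p) = 0" by auto
qed

lemma rebalanced_wealth_le_iff:
  assumes x: "x \<in> position_cone" and p: "p \<in> weight_simplex"
  shows "rebalanced_wealth c h x p \<le> a \<longleftrightarrow> 0 \<le> surplus c h x p a"
  using surplus_le_iff[OF p, of x "rebalanced_wealth c h x p" a] surplus_rebalanced_wealth[OF x p]
  by simp

lemma rebalanced_wealth_mono:
  assumes x: "x \<in> position_cone" and y: "y \<in> position_cone" and p: "p \<in> weight_simplex"
    and t: "0 < t" and le: "t *\<^sub>R x \<le> y"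
  shows "t * rebalanced_wealth c h x p \<le> rebalanced_wealth c h y p"
proof -
  let ?V = "rebalanced_wealth c h y p"
  have "0 = surplus c h y p ?V" using surplus_rebalanced_wealth[OF y p] by simp
  also have "\<dots> \<le> surplus c h (t *\<^sub>R x) p (t * (?V / t))"
    using surplus_antimono[OF le] t by simp
  also have "\<dots> = t * surplus c h x p (?V / t)" using t by (intro surplus_scale) auto
  finally have "0 \<le> surplus c h x p (?V / t)" using t by (simp add: zero_le_mult_iff)
  then show ?thesis
    using t rebalanced_wealth_le_iff[OF x p, of "?V / t"] by (simp add: field_simps)
qed

lemma rebalanced_wealth_scale:
  assumes x: "x \<in> position_cone" and p: "p \<in> weight_simplex" and t: "0 < t"
  shows "rebalanced_wealth c h (t *\<^sub>R x) p = t * rebalanced_wealth c h x p"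
proof (rule antisym)
  have tx: "t *\<^sub>R x \<in> position_cone" by (rule position_cone_scale[OF x t])
  show "t * rebalanced_wealth c h x p \<le> rebalanced_wealth c h (t *\<^sub>R x) p"
    by (rule rebalanced_wealth_mono[OF x tx p t]) (simp add: less_eq_vec_def)
  have "(1 / t) * rebalanced_wealth c h (t *\<^sub>R x) p \<le> rebalanced_wealth c h x p"
    using t by (intro rebalanced_wealth_mono[OF tx x p]) (auto simp: less_eq_vec_def)
  then show "rebalanced_wealth c h (t *\<^sub>R x) p \<le> t * rebalanced_wealth c h x p"
    using t by (simp add: field_simps)
qed

lemma rebalanced_wealth_le:
  assumes x: "x \<in> position_cone" and p: "p \<in> weight_simplex"
  shows "rebalanced_wealth c h x p \<le> x \<bullet> 1"
  using rebalanced_wealth_le_iff[OF x p] by (simp add: surplus_def cost_nonneg)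

lemma rebalanced_wealth_ge:
  assumes x: "x \<in> position_cone" and p: "p \<in> weight_simplex"
  shows "min_shrink * (x \<bullet> 1) \<le> rebalanced_wealth c h x p"
proof -
  let ?W = "rebalanced_wealth c h x p"
  have W0: "0 < ?W" by (rule rebalanced_wealth_pos[OF x p])
  have "cost c h (?W *\<^sub>R p - x) \<le> cost c h (?W *\<^sub>R p) + cost c h (- x)"
    using cost_add_le[of c h "?W *\<^sub>R p" "- x"] by simp
  also have "\<dots> \<le> ?W + max_sell_cost * (x \<bullet> 1)"
    using cost_sell_le[of x] cost_buy_le[of "?W *\<^sub>R p"] x p W0
    by (auto simp: position_cone_def weight_simplex_def intro!: add_mono)
  finally have "x \<bullet> 1 \<le> 2 * ?W + max_sell_cost * (x \<bullet> 1)"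
    using surplus_rebalanced_wealth[OF x p] by (simp add: surplus_def)
  then show ?thesis by (simp add: min_shrink_def algebra_simps)
qed

text \<open>The solution of the self-financing equation is below \<open>a\<close> iff the surplus at \<open>a\<close> is nonnegative, and
  the surplus is jointly continuous.\<close>

lemma borel_measurable_rebalanced_wealth:
  assumes X: "X \<in> borel_measurable N" and P: "P \<in> borel_measurable N"
    and cone: "\<And>\<omega>. \<omega> \<in> space N \<Longrightarrow> X \<omega> \<in> position_cone"
    and simplex: "\<And>\<omega>. \<omega> \<in> space N \<Longrightarrow> P \<omega> \<in> weight_simplex"
  shows "(\<lambda>\<omega>. rebalanced_wealth c h (X \<omega>) (P \<omega>)) \<in> borel_measurable N"
proof (rule borel_measurableI_le)
  fix a
  have "continuous_on UNIV (\<lambda>(x, p). surplus c h x p a)"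
    unfolding surplus_def case_prod_beta by (intro continuous_intros)
  then have surplus: "(\<lambda>(x, p). surplus c h x p a) \<in> borel_measurable (borel :: ((real^'d) \<times> (real^'d)) measure)"
    by (rule borel_measurable_continuous_onI)
  have "(\<lambda>\<omega>. (\<lambda>(x, p). surplus c h x p a) (X \<omega>, P \<omega>)) \<in> borel_measurable N"
    by (rule measurable_compose[OF borel_measurable_Pair[OF X P] surplus])
  then have [measurable]: "(\<lambda>\<omega>. surplus c h (X \<omega>) (P \<omega>) a) \<in> borel_measurable N"
    by simp
  have "{\<omega> \<in> space N. 0 \<le> surplus c h (X \<omega>) (P \<omega>) a} \<in> sets N" by measurable
  then show "{\<omega> \<in> space N. rebalanced_wealth c h (X \<omega>) (P \<omega>) \<le> a} \<in> sets N"
    using cone simplex by (simp add: rebalanced_wealth_le_iff cong: conj_cong)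
qed

end

section \<open>Functions of the position that scale like a negative power of wealth\<close>

lemma ennreal_mult_le_iff_le_mult:
  assumes "0 < s"
  shows "ennreal s * a \<le> b \<longleftrightarrow> a \<le> ennreal (1 / s) * b"
proof -
  have 1: "ennreal s * ennreal (1 / s) = 1" "ennreal (1 / s) * ennreal s = 1"
    using assms ennreal_mult'[of s "1 / s"] ennreal_mult'[of "1 / s" s] by simp_all
  show ?thesis
  proof
    assume "ennreal s * a \<le> b"
    then have "ennreal (1 / s) * (ennreal s * a) \<le> ennreal (1 / s) * b" by (intro mult_left_mono) auto
    then show "a \<le> ennreal (1 / s) * b" by (simp add: mult.assoc[symmetric] 1)
  next
    assume "a \<le> ennreal (1 / s) * b"
    then have "ennreal s * a \<le> ennreal s * (ennreal (1 / s) * b)" by (intro mult_left_mono) auto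
    then show "ennreal s * a \<le> b" by (simp add: mult.assoc[symmetric] 1)
  qed
qed

lemma ennreal_le_mult_INF:
  assumes "0 < s" "\<And>i. i \<in> I \<Longrightarrow> a \<le> ennreal s * b i"
  shows "a \<le> ennreal s * (INF i\<in>I. b i)"
proof -
  have "ennreal (1 / s) * a \<le> (INF i\<in>I. b i)"
    using assms by (intro INF_greatest) (simp add: ennreal_mult_le_iff_le_mult)
  then show ?thesis using assms(1) by (simp add: ennreal_mult_le_iff_le_mult)
qed

text \<open>Antitone and homogeneous of degree \<open>\<gamma>\<close> in one condition. It also is a modulus of continuity
  in the metric \<open>max\<^sub>i \<bar>ln x\<^sub>i - ln y\<^sub>i\<bar>\<close>.\<close>

definition cone_decreasing :: "real \<Rightarrow> (real^'d \<Rightarrow> ennreal) \<Rightarrow> bool" where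
  "cone_decreasing \<gamma> f \<longleftrightarrow>
     (\<forall>x\<in>position_cone. \<forall>y\<in>position_cone. \<forall>t>0. t *\<^sub>R x \<le> y \<longrightarrow> f y \<le> ennreal (t powr \<gamma>) * f x)"

lemma cone_decreasingD:
  "cone_decreasing \<gamma> f \<Longrightarrow> x \<in> position_cone \<Longrightarrow> y \<in> position_cone \<Longrightarrow> 0 < t \<Longrightarrow> t *\<^sub>R x \<le> y \<Longrightarrow>
    f y \<le> ennreal (t powr \<gamma>) * f x"
  by (auto simp: cone_decreasing_def)

lemma cone_decreasing_antimono:
  "cone_decreasing \<gamma> f \<Longrightarrow> x \<in> position_cone \<Longrightarrow> y \<in> position_cone \<Longrightarrow> x \<le> y \<Longrightarrow> f y \<le> f x"
  using cone_decreasingD[of \<gamma> f x y 1] by simp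

lemma cone_decreasing_scale:
  assumes f: "cone_decreasing \<gamma> f" and x: "x \<in> position_cone" and t: "0 < t"
  shows "f (t *\<^sub>R x) = ennreal (t powr \<gamma>) * f x"
proof (rule antisym)
  have tx: "t *\<^sub>R x \<in> position_cone" by (rule position_cone_scale[OF x t])
  show "f (t *\<^sub>R x) \<le> ennreal (t powr \<gamma>) * f x" by (rule cone_decreasingD[OF f x tx t]) simp
  have "f x \<le> ennreal ((1 / t) powr \<gamma>) * f (t *\<^sub>R x)"
    using t by (intro cone_decreasingD[OF f tx x]) auto
  also have "(1 / t) powr \<gamma> = 1 / t powr \<gamma>" using t by (simp add: powr_divide)
  finally show "ennreal (t powr \<gamma>) * f x \<le> f (t *\<^sub>R x)"
    using t by (simp add: ennreal_mult_le_iff_le_mult)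
qed

text \<open>The constant \<open>K\<close> is a parameter because it is the same for all iterates of the Bellman operator,
  whereas the multiple \<open>a\<close> depends on the function.\<close>

definition power_comparable :: "real \<Rightarrow> real \<Rightarrow> (real^'d \<Rightarrow> ennreal) \<Rightarrow> bool" where
  "power_comparable \<gamma> K f \<longleftrightarrow> (\<exists>a>0. \<forall>x\<in>position_cone.
     ennreal (a * (x \<bullet> 1) powr \<gamma>) \<le> f x \<and> f x \<le> ennreal (K * a * (x \<bullet> 1) powr \<gamma>))"

lemma inner_one_mono: "x \<le> y \<Longrightarrow> x \<bullet> 1 \<le> y \<bullet> (1::real^'d)"
  by (simp add: inner_one_eq_sum less_eq_vec_def sum_mono)

lemma cone_decreasing_powr:
  assumes "\<gamma> \<le> 0"
  shows "cone_decreasing \<gamma> (\<lambda>x::real^'d. ennreal ((x \<bullet> 1) powr \<gamma>))"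
  unfolding cone_decreasing_def
proof (intro ballI allI impI)
  fix x y :: "real^'d" and t :: real
  assume *: "x \<in> position_cone" "y \<in> position_cone" "0 < t" "t *\<^sub>R x \<le> y"
  have x0: "0 < x \<bullet> 1" using *(1) by (simp add: position_cone_def)
  have "t * (x \<bullet> 1) \<le> y \<bullet> 1" using inner_one_mono[OF *(4)] by simp
  then have "(y \<bullet> 1) powr \<gamma> \<le> (t * (x \<bullet> 1)) powr \<gamma>"
    using assms x0 *(3) by (intro powr_mono2') auto
  also have "\<dots> = t powr \<gamma> * (x \<bullet> 1) powr \<gamma>" by (simp add: powr_mult)
  finally show "ennreal ((y \<bullet> 1) powr \<gamma>) \<le> ennreal (t powr \<gamma>) * ennreal ((x \<bullet> 1) powr \<gamma>)"
    by (simp flip: ennreal_mult')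
qed

lemma cone_decreasing_cmult:
  "cone_decreasing \<gamma> f \<Longrightarrow> cone_decreasing \<gamma> (\<lambda>x. a * f x)"
  unfolding cone_decreasing_def by (auto simp: mult.left_commute[of _ a] intro!: mult_left_mono)

lemma cone_decreasing_INF:
  fixes f :: "'i \<Rightarrow> real^'d \<Rightarrow> ennreal"
  assumes "\<And>i. i \<in> I \<Longrightarrow> cone_decreasing \<gamma> (f i)"
  shows "cone_decreasing \<gamma> (\<lambda>x. INF i\<in>I. f i x)"
  unfolding cone_decreasing_def
proof (intro ballI allI impI)
  fix x y :: "real^'d" and t :: real
  assume *: "x \<in> position_cone" "y \<in> position_cone" "0 < t" "t *\<^sub>R x \<le> y"
  show "(INF i\<in>I. f i y) \<le> ennreal (t powr \<gamma>) * (INF i\<in>I. f i x)"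
  proof (rule ennreal_le_mult_INF)
    fix i assume "i \<in> I"
    then have "(INF i\<in>I. f i y) \<le> f i y" by (rule INF_lower)
    also have "\<dots> \<le> ennreal (t powr \<gamma>) * f i x"
      using cone_decreasingD[OF assms[OF \<open>i \<in> I\<close>] *] .
    finally show "(INF i\<in>I. f i y) \<le> ennreal (t powr \<gamma>) * f i x" .
  qed (use * in simp)
qed

text \<open>Rounding every positive coordinate down to a power of \<open>exp \<delta>\<close>. The map has countable range,
  so that an arbitrary function of the rounded position is measurable; this replaces a measurable
  selection theorem.\<close>

definition log_cell :: "real \<Rightarrow> real^'d \<Rightarrow> (int option)^'d" where
  "log_cell \<delta> x = (\<chi> i. if 0 < x $ i then Some \<lfloor>ln (x $ i) / \<delta>\<rfloor> else None)"

definition cell_corner :: "real \<Rightarrow> (int option)^'d \<Rightarrow> real^'d" where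
  "cell_corner \<delta> k = (\<chi> i. case k $ i of None \<Rightarrow> 0 | Some j \<Rightarrow> exp (\<delta> * of_int j))"

definition log_grid :: "real \<Rightarrow> real^'d \<Rightarrow> real^'d" where
  "log_grid \<delta> x = cell_corner \<delta> (log_cell \<delta> x)"

lemma log_grid_nth:
  "log_grid \<delta> x $ i = (if 0 < x $ i then exp (\<delta> * \<lfloor>ln (x $ i) / \<delta>\<rfloor>) else 0)"
  by (simp add: log_grid_def cell_corner_def log_cell_def)

lemma log_grid_bounds:
  assumes x: "x \<in> position_cone" and \<delta>: "0 < \<delta>"
  shows log_grid_le: "log_grid \<delta> x \<le> x"
    and log_grid_ge: "exp (- \<delta>) *\<^sub>R x \<le> log_grid \<delta> x"
    and log_grid_cone: "log_grid \<delta> x \<in> position_cone"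
proof -
  have nn: "0 \<le> x $ i" for i using x by (simp add: position_cone_def)
  have "log_grid \<delta> x $ i \<le> x $ i \<and> exp (- \<delta>) * x $ i \<le> log_grid \<delta> x $ i" for i
  proof (cases "0 < x $ i")
    case True
    define k where "k = real_of_int \<lfloor>ln (x $ i) / \<delta>\<rfloor>"
    have "k \<le> ln (x $ i) / \<delta>" "ln (x $ i) / \<delta> - 1 \<le> k" unfolding k_def by linarith+
    then have "\<delta> * k \<le> ln (x $ i)" "- \<delta> + ln (x $ i) \<le> \<delta> * k"
      using \<delta> by (simp_all add: field_simps)
    then have "exp (\<delta> * k) \<le> exp (ln (x $ i))" "exp (- \<delta> + ln (x $ i)) \<le> exp (\<delta> * k)" by simp_all
    then have "exp (\<delta> * k) \<le> x $ i" "exp (- \<delta>) * x $ i \<le> exp (\<delta> * k)"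
      using True by (simp_all only: exp_add exp_ln)
    then show ?thesis using True by (simp add: log_grid_nth k_def)
  next
    case False
    with nn[of i] have "x $ i = 0" by simp
    then show ?thesis by (simp add: log_grid_nth)
  qed
  then show le: "log_grid \<delta> x \<le> x" and ge: "exp (- \<delta>) *\<^sub>R x \<le> log_grid \<delta> x"
    by (simp_all add: less_eq_vec_def)
  have "0 < exp (- \<delta>) * (x \<bullet> 1)" using x by (simp add: position_cone_def)
  also have "\<dots> \<le> log_grid \<delta> x \<bullet> 1" using inner_one_mono[OF ge] by simp
  finally show "log_grid \<delta> x \<in> position_cone"
    by (auto simp: position_cone_def log_grid_nth)
qed

lemma measurable_log_cell: "log_cell \<delta> \<in> borel \<rightarrow>\<^sub>M count_space UNIV"
  unfolding measurable_count_space_eq2_countable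
proof (intro conjI ballI)
  fix k :: "(int option)^'d"
  have "log_cell \<delta> -` {k} \<inter> space borel =
      {x. \<forall>i. (if 0 < x $ i then Some \<lfloor>ln (x $ i) / \<delta>\<rfloor> else None) = k $ i}"
    by (auto simp: log_cell_def vec_eq_iff)
  also have "\<dots> = (\<Inter>i. {x. (if 0 < x $ i then Some \<lfloor>ln (x $ i) / \<delta>\<rfloor> else None) = k $ i})"
    by auto
  also have "\<dots> \<in> sets borel"
  proof (intro sets.finite_INT)
    fix i
    have "{x. (if 0 < x $ i then Some \<lfloor>ln (x $ i) / \<delta>\<rfloor> else None) = k $ i} =
       (case k $ i of None \<Rightarrow> {x. \<not> 0 < x $ i} | Some j \<Rightarrow> {x. 0 < x $ i \<and> \<lfloor>ln (x $ i) / \<delta>\<rfloor> = j})"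
      by (auto split: option.split)
    also have "\<dots> \<in> sets borel"
      by (cases "k $ i") auto
    finally show "{x. (if 0 < x $ i then Some \<lfloor>ln (x $ i) / \<delta>\<rfloor> else None) = k $ i} \<in> sets borel" .
  qed auto
  finally show "log_cell \<delta> -` {k} \<inter> space borel \<in> sets borel" .
qed auto

lemma measurable_log_grid: "(\<lambda>x. \<psi> (log_grid \<delta> x)) \<in> borel \<rightarrow>\<^sub>M borel"
  unfolding log_grid_def by (rule measurable_compose[OF measurable_log_cell]) simp

text \<open>The values at the rounded positions are measurable, and by the scaling bound they squeeze \<open>f\<close> as the
  grid becomes fine.\<close>

lemma borel_measurable_cone_decreasing:
  assumes f: "cone_decreasing \<gamma> f" and X: "X \<in> borel_measurable N"
    and cone: "\<And>\<omega>. \<omega> \<in> space N \<Longrightarrow> X \<omega> \<in> position_cone"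
  shows "(\<lambda>\<omega>. f (X \<omega>)) \<in> borel_measurable N"
proof (rule borel_measurable_LIMSEQ_order)
  show "(\<lambda>\<omega>. f (log_grid (1 / Suc k) (X \<omega>))) \<in> borel_measurable N" for k
    by (rule measurable_compose[OF X measurable_log_grid])
  fix \<omega> assume "\<omega> \<in> space N"
  then have x: "X \<omega> \<in> position_cone" by (rule cone)
  note grid = log_grid_bounds[OF x, of "1 / Suc k" for k]
  show "(\<lambda>k. f (log_grid (1 / Suc k) (X \<omega>))) \<longlonglongrightarrow> f (X \<omega>)"
  proof (rule tendsto_sandwich)
    show "\<forall>\<^sub>F k in sequentially. f (X \<omega>) \<le> f (log_grid (1 / Suc k) (X \<omega>))"
      using grid by (intro always_eventually allI cone_decreasing_antimono[OF f _ x]) auto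
    show "\<forall>\<^sub>F k in sequentially. f (log_grid (1 / Suc k) (X \<omega>)) \<le>
        ennreal (exp (- (1 / Suc k)) powr \<gamma>) * f (X \<omega>)"
      using grid by (intro always_eventually allI cone_decreasingD[OF f x]) auto
    have "(\<lambda>k. exp (- (1 / real (Suc k))) powr \<gamma>) \<longlonglongrightarrow> exp (- 0) powr \<gamma>"
      by (intro tendsto_intros LIMSEQ_Suc[OF lim_1_over_n]) auto
    then have "(\<lambda>k. ennreal (exp (- (1 / real (Suc k))) powr \<gamma>)) \<longlonglongrightarrow> ennreal (exp (- 0) powr \<gamma>)"
      by (rule tendsto_ennrealI)
    then have "(\<lambda>k. ennreal (exp (- (1 / real (Suc k))) powr \<gamma>) * f (X \<omega>)) \<longlonglongrightarrow> ennreal (exp (- 0) powr \<gamma>) * f (X \<omega>)"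
      by (rule tendsto_mult_ennreal[OF _ tendsto_const]) simp
    then show "(\<lambda>k. ennreal (exp (- (1 / real (Suc k))) powr \<gamma>) * f (X \<omega>)) \<longlonglongrightarrow> f (X \<omega>)"
      by simp
  qed simp
qed

section \<open>The one-period Bellman operator\<close>

definition bellman ::
    "'w measure \<Rightarrow> real^'d \<Rightarrow> real^'d \<Rightarrow> ('w \<Rightarrow> real^'d) \<Rightarrow> (real^'d \<Rightarrow> ennreal) \<Rightarrow> real^'d \<Rightarrow> ennreal" where
  "bellman M c h R f x =
     (INF p\<in>weight_simplex. \<integral>\<^sup>+\<omega>. f (rebalanced_wealth c h x p *\<^sub>R (p * R \<omega>)) \<partial>M)"

definition worst_return :: "real^'d \<Rightarrow> real" where
  "worst_return r = Min (range (\<lambda>i. r $ i))"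

definition best_return :: "real^'d \<Rightarrow> real" where
  "best_return r = Max (range (\<lambda>i. r $ i))"

lemma worst_return_le: "worst_return r \<le> r $ i" and best_return_ge: "r $ i \<le> best_return r"
  by (simp_all add: worst_return_def best_return_def)

lemma worst_return_pos: "(\<And>i. 0 < r $ i) \<Longrightarrow> 0 < worst_return r"
  by (auto simp: worst_return_def)

lemma best_return_pos: "(\<And>i. 0 < r $ i) \<Longrightarrow> 0 < best_return r"
  using best_return_ge[of r undefined] by (meson less_le_trans)

lemma worst_le_best: "worst_return r \<le> best_return r"
  using worst_return_le[of r undefined] best_return_ge[of r undefined] by simp

lemma simplex_return_bounds:
  assumes p: "p \<in> weight_simplex"
  shows "worst_return r \<le> (p * r) \<bullet> 1" "(p * r) \<bullet> 1 \<le> best_return r"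
proof -
  have p1: "(\<Sum>i\<in>UNIV. p $ i) = 1" and pn: "\<And>i. 0 \<le> p $ i"
    using p by (auto simp: weight_simplex_def inner_one_eq_sum)
  have "worst_return r = (\<Sum>i\<in>UNIV. p $ i * worst_return r)" by (simp add: p1 flip: sum_distrib_right)
  also have "\<dots> \<le> (\<Sum>i\<in>UNIV. p $ i * r $ i)"
    by (intro sum_mono mult_left_mono worst_return_le pn)
  finally show "worst_return r \<le> (p * r) \<bullet> 1" by (simp add: inner_one_eq_sum)
  have "(\<Sum>i\<in>UNIV. p $ i * r $ i) \<le> (\<Sum>i\<in>UNIV. p $ i * best_return r)"
    by (intro sum_mono mult_left_mono best_return_ge pn)
  also have "\<dots> = best_return r" by (simp add: p1 flip: sum_distrib_right)
  finally show "(p * r) \<bullet> 1 \<le> best_return r" by (simp add: inner_one_eq_sum)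
qed

lemma simplex_nonempty: "(weight_simplex :: (real^'d) set) \<noteq> {}"
proof -
  have "axis undefined 1 \<in> (weight_simplex :: (real^'d) set)"
    by (simp add: weight_simplex_def inner_axis') (simp add: axis_def)
  then show ?thesis by blast
qed

lemma borel_measurable_vec_iff:
  fixes X :: "'w \<Rightarrow> real^'d"
  shows "X \<in> borel_measurable N \<longleftrightarrow> (\<forall>i. (\<lambda>\<omega>. X \<omega> $ i) \<in> borel_measurable N)"
proof
  assume X: "X \<in> borel_measurable N"
  show "\<forall>i. (\<lambda>\<omega>. X \<omega> $ i) \<in> borel_measurable N"
    by (rule allI, rule measurable_compose[OF X borel_measurable_nth])
next
  assume *: "\<forall>i. (\<lambda>\<omega>. X \<omega> $ i) \<in> borel_measurable N"
  show "X \<in> borel_measurable N"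
  proof (rule iffD2[OF borel_measurable_euclidean_space], rule ballI)
    fix e :: "real^'d" assume "e \<in> Basis"
    then obtain i where "e = axis i 1" by (auto simp: Basis_vec_def)
    then have "(\<lambda>\<omega>. X \<omega> \<bullet> e) = (\<lambda>\<omega>. X \<omega> $ i)" by (simp add: inner_axis)
    with * show "(\<lambda>\<omega>. X \<omega> \<bullet> e) \<in> borel_measurable N" by (simp only:)
  qed
qed

lemma borel_measurable_vec_mult [measurable (raw)]:
  fixes X Y :: "'w \<Rightarrow> real^'d"
  assumes "X \<in> borel_measurable N" "Y \<in> borel_measurable N"
  shows "(\<lambda>\<omega>. X \<omega> * Y \<omega>) \<in> borel_measurable N"
  using assms by (auto simp: borel_measurable_vec_iff intro!: borel_measurable_times)

lemma borel_measurable_worst_return [measurable]: "worst_return \<in> borel_measurable borel"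
  and borel_measurable_best_return [measurable]: "best_return \<in> borel_measurable borel"
  unfolding worst_return_def[abs_def] best_return_def[abs_def]
  by (rule borel_measurable_Min borel_measurable_Max; simp add: borel_measurable_nth)+

lemma borel_measurable_worst_return_powr:
  "(\<lambda>r. ennreal (worst_return r powr \<gamma>)) \<in> borel_measurable borel"
  by measurable

text \<open>The infimum of the expectation of \<open>W powr \<gamma>\<close> over all strategies that start from the given position,
  where \<open>W\<close> is the wealth after \<open>n\<close> periods: with \<open>\<gamma> < 0\<close> a small expectation is good.\<close>

definition optimal_moment ::
    "'w measure \<Rightarrow> real^'d \<Rightarrow> real^'d \<Rightarrow> real \<Rightarrow> ('w \<Rightarrow> real^'d) \<Rightarrow> nat \<Rightarrow> real^'d \<Rightarrow> ennreal" where
  "optimal_moment M c h \<gamma> R n = (bellman M c h R ^^ n) (\<lambda>x. ennreal ((x \<bullet> 1) powr \<gamma>))"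

locale one_period_market = proportional_costs c h + prob_space M
  for M :: "'w measure" and c h :: "real^'d" +
  fixes \<gamma> :: real and R :: "'w \<Rightarrow> real^'d"
  assumes \<gamma>_neg: "\<gamma> < 0"
    and R_measurable [measurable]: "R \<in> borel_measurable M"
    and R_pos: "\<And>\<omega> i. \<omega> \<in> space M \<Longrightarrow> 0 < R \<omega> $ i"
    and worst_integrable: "(\<integral>\<^sup>+\<omega>. ennreal (worst_return (R \<omega>) powr \<gamma>) \<partial>M) < \<infinity>"
begin

abbreviation \<B> :: "(real^'d \<Rightarrow> ennreal) \<Rightarrow> real^'d \<Rightarrow> ennreal" where
  "\<B> \<equiv> bellman M c h R"

abbreviation \<U> :: "nat \<Rightarrow> real^'d \<Rightarrow> ennreal" where
  "\<U> \<equiv> optimal_moment M c h \<gamma> R"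

abbreviation wealth_after :: "real^'d \<Rightarrow> real^'d \<Rightarrow> real" where
  "wealth_after \<equiv> rebalanced_wealth c h"

abbreviation period_moment :: "(real^'d \<Rightarrow> ennreal) \<Rightarrow> real^'d \<Rightarrow> real^'d \<Rightarrow> ennreal" where
  "period_moment f x p \<equiv> \<integral>\<^sup>+\<omega>. f (wealth_after x p *\<^sub>R (p * R \<omega>)) \<partial>M"

abbreviation unit_moment :: "(real^'d \<Rightarrow> ennreal) \<Rightarrow> real^'d \<Rightarrow> ennreal" where
  "unit_moment f p \<equiv> \<integral>\<^sup>+\<omega>. f (p * R \<omega>) \<partial>M"

definition cost_ratio :: real where "cost_ratio = min_shrink powr \<gamma>"

lemma cost_ratio_ge_1: "1 \<le> cost_ratio"
proof -
  have "min_shrink \<le> 1" using max_sell_cost by (simp add: min_shrink_def)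
  then have "1 powr \<gamma> \<le> cost_ratio"
    unfolding cost_ratio_def using min_shrink_pos \<gamma>_neg by (intro powr_mono2') auto
  then show ?thesis by simp
qed

lemma return_cone: "p \<in> position_cone \<Longrightarrow> \<omega> \<in> space M \<Longrightarrow> p * R \<omega> \<in> position_cone"
  by (rule position_cone_mult) (auto simp: R_pos)

lemma return_cone_simplex: "p \<in> weight_simplex \<Longrightarrow> \<omega> \<in> space M \<Longrightarrow> p * R \<omega> \<in> position_cone"
  using return_cone simplex_subset_cone by blast

lemma next_position_cone:
  assumes "x \<in> position_cone" "p \<in> weight_simplex" "\<omega> \<in> space M"
  shows "wealth_after x p *\<^sub>R (p * R \<omega>) \<in> position_cone"
  using assms by (intro position_cone_scale return_cone_simplex rebalanced_wealth_pos)

lemma measurable_after_return: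
  assumes f: "cone_decreasing \<gamma> f" and "p \<in> weight_simplex"
  shows "(\<lambda>\<omega>. f (p * R \<omega>)) \<in> borel_measurable M"
  using assms by (intro borel_measurable_cone_decreasing[OF f]) (auto intro: return_cone_simplex)

lemma measurable_after_period:
  assumes f: "cone_decreasing \<gamma> f" and "x \<in> position_cone" "p \<in> weight_simplex"
  shows "(\<lambda>\<omega>. f (wealth_after x p *\<^sub>R (p * R \<omega>))) \<in> borel_measurable M"
  using assms by (intro borel_measurable_cone_decreasing[OF f]) (auto intro: next_position_cone)

lemma bellman_le:
  "p \<in> weight_simplex \<Longrightarrow> \<B> f x \<le> period_moment f x p"
  unfolding bellman_def by (rule INF_lower)

lemma bellman_mono:
  assumes "\<And>y. y \<in> position_cone \<Longrightarrow> f y \<le> g y" and x: "x \<in> position_cone"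
  shows "\<B> f x \<le> \<B> g x"
  unfolding bellman_def
proof (rule INF_mono)
  fix p :: "real^'d" assume p: "p \<in> weight_simplex"
  then show "\<exists>q\<in>weight_simplex. period_moment f x q
      \<le> period_moment g x p"
    using x by (intro bexI[of _ p] nn_integral_mono assms(1) next_position_cone)
qed

text \<open>For fixed weights a larger initial position leads to a larger position in every scenario, by the
  monotonicity of the rebalanced wealth.\<close>

lemma period_decreasing:
  assumes f: "cone_decreasing \<gamma> f" and p: "p \<in> weight_simplex"
  shows "cone_decreasing \<gamma> (\<lambda>x. \<integral>\<^sup>+\<omega>. f (wealth_after x p *\<^sub>R (p * R \<omega>)) \<partial>M)"
  unfolding cone_decreasing_def
proof (intro ballI allI impI)
  fix x y :: "real^'d" and t :: real
  assume *: "x \<in> position_cone" "y \<in> position_cone" "0 < t" "t *\<^sub>R x \<le> y"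
  have "period_moment f y p
      \<le> (\<integral>\<^sup>+\<omega>. ennreal (t powr \<gamma>) * f (wealth_after x p *\<^sub>R (p * R \<omega>)) \<partial>M)"
  proof (rule nn_integral_mono)
    fix \<omega> assume \<omega>: "\<omega> \<in> space M"
    have "t * wealth_after x p \<le> wealth_after y p"
      using * p by (intro rebalanced_wealth_mono)
    moreover have "0 \<le> (p * R \<omega>) $ i" for i
      using return_cone_simplex[OF p \<omega>] by (simp add: position_cone_def)
    ultimately have "t *\<^sub>R (wealth_after x p *\<^sub>R (p * R \<omega>)) \<le> wealth_after y p *\<^sub>R (p * R \<omega>)"
      unfolding less_eq_vec_def scaleR_scaleR vector_scaleR_component real_scaleR_def by (blast intro: mult_right_mono)
    then show "f (wealth_after y p *\<^sub>R (p * R \<omega>)) \<le> ennreal (t powr \<gamma>) * f (wealth_after x p *\<^sub>R (p * R \<omega>))"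
      using * p \<omega> by (intro cone_decreasingD[OF f] next_position_cone)
  qed
  also have "\<dots> = ennreal (t powr \<gamma>) * period_moment f x p"
    using * p f by (intro nn_integral_cmult measurable_after_period)
  finally show "period_moment f y p
      \<le> ennreal (t powr \<gamma>) * period_moment f x p" .
qed

lemma bellman_decreasing: "cone_decreasing \<gamma> f \<Longrightarrow> cone_decreasing \<gamma> (\<B> f)"
  using cone_decreasing_INF[of weight_simplex \<gamma>
      "\<lambda>p x. \<integral>\<^sup>+\<omega>. f (wealth_after x p *\<^sub>R (p * R \<omega>)) \<partial>M"] period_decreasing[of f]
  by (simp add: bellman_def[abs_def])

lemma bellman_cmult_le:
  assumes f: "cone_decreasing \<gamma> f" and x: "x \<in> position_cone" and a: "0 < a"
  shows "\<B> (\<lambda>x. ennreal a * f x) x \<le> ennreal a * \<B> f x"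
  unfolding bellman_def
proof (rule ennreal_le_mult_INF)
  fix p :: "real^'d" assume p: "p \<in> weight_simplex"
  have "(INF p\<in>weight_simplex. \<integral>\<^sup>+\<omega>. ennreal a * f (wealth_after x p *\<^sub>R (p * R \<omega>)) \<partial>M)
      \<le> (\<integral>\<^sup>+\<omega>. ennreal a * f (wealth_after x p *\<^sub>R (p * R \<omega>)) \<partial>M)"
    using p by (rule INF_lower)
  also have "\<dots> = ennreal a * period_moment f x p"
    using p f x by (intro nn_integral_cmult measurable_after_period)
  finally show "(INF p\<in>weight_simplex. \<integral>\<^sup>+\<omega>. ennreal a * f (wealth_after x p *\<^sub>R (p * R \<omega>)) \<partial>M)
      \<le> ennreal a * period_moment f x p" .
qed (use a in auto)

definition best_moment :: ennreal where
  "best_moment = (\<integral>\<^sup>+\<omega>. ennreal (best_return (R \<omega>) powr \<gamma>) \<partial>M)"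

definition worst_moment :: ennreal where
  "worst_moment = (\<integral>\<^sup>+\<omega>. ennreal (worst_return (R \<omega>) powr \<gamma>) \<partial>M)"

lemma worst_moment_finite: "worst_moment < \<infinity>"
  using worst_integrable by (simp add: worst_moment_def)

lemma best_moment_pos: "0 < best_moment"
proof -
  have "best_moment \<noteq> 0"
  proof
    assume "best_moment = 0"
    then have "AE \<omega> in M. ennreal (best_return (R \<omega>) powr \<gamma>) = 0"
      unfolding best_moment_def by (subst (asm) nn_integral_0_iff_AE) auto
    moreover have "AE \<omega> in M. ennreal (best_return (R \<omega>) powr \<gamma>) \<noteq> 0"
      using best_return_pos R_pos by (intro AE_I2) (fastforce simp: less_le)
    ultimately have "AE \<omega> in M. False" by eventually_elim simp
    then show False by (simp add: AE_False)
  qed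
  then show ?thesis by (simp add: zero_less_iff_neq_zero)
qed

lemma one_period_bounds:
  assumes f: "cone_decreasing \<gamma> f" and p: "p \<in> weight_simplex"
    and lower: "\<And>x. x \<in> position_cone \<Longrightarrow> ennreal (a * (x \<bullet> 1) powr \<gamma>) \<le> f x"
    and upper: "\<And>x. x \<in> position_cone \<Longrightarrow> f x \<le> ennreal (b * (x \<bullet> 1) powr \<gamma>)"
    and ab: "0 \<le> a" "0 \<le> b"
  shows "ennreal a * best_moment \<le> unit_moment f p"
    and "unit_moment f p \<le> ennreal b * worst_moment"
proof -
  have "ennreal a * best_moment = (\<integral>\<^sup>+\<omega>. ennreal a * ennreal (best_return (R \<omega>) powr \<gamma>) \<partial>M)"
    unfolding best_moment_def by (rule nn_integral_cmult[symmetric]) auto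
  also have "\<dots> \<le> unit_moment f p"
  proof (rule nn_integral_mono)
    fix \<omega> assume \<omega>: "\<omega> \<in> space M"
    have x: "p * R \<omega> \<in> position_cone" by (rule return_cone_simplex[OF p \<omega>])
    have "best_return (R \<omega>) powr \<gamma> \<le> ((p * R \<omega>) \<bullet> 1) powr \<gamma>"
      using simplex_return_bounds[OF p, of "R \<omega>"] x \<gamma>_neg
      by (intro powr_mono2') (auto simp: position_cone_def)
    then have "ennreal (a * best_return (R \<omega>) powr \<gamma>) \<le> ennreal (a * ((p * R \<omega>) \<bullet> 1) powr \<gamma>)"
      using ab by (intro ennreal_leI mult_left_mono)
    also have "\<dots> \<le> f (p * R \<omega>)" by (rule lower[OF x])
    finally show "ennreal a * ennreal (best_return (R \<omega>) powr \<gamma>) \<le> f (p * R \<omega>)"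
      using ab by (simp add: ennreal_mult')
  qed
  finally show "ennreal a * best_moment \<le> unit_moment f p" .
  have "unit_moment f p \<le> (\<integral>\<^sup>+\<omega>. ennreal b * ennreal (worst_return (R \<omega>) powr \<gamma>) \<partial>M)"
  proof (rule nn_integral_mono)
    fix \<omega> assume \<omega>: "\<omega> \<in> space M"
    have x: "p * R \<omega> \<in> position_cone" by (rule return_cone_simplex[OF p \<omega>])
    have "((p * R \<omega>) \<bullet> 1) powr \<gamma> \<le> worst_return (R \<omega>) powr \<gamma>"
      using simplex_return_bounds[OF p, of "R \<omega>"] worst_return_pos[of "R \<omega>"] R_pos[OF \<omega>] \<gamma>_neg
      by (intro powr_mono2') auto
    then have "ennreal (b * ((p * R \<omega>) \<bullet> 1) powr \<gamma>) \<le> ennreal (b * worst_return (R \<omega>) powr \<gamma>)"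
      using ab by (intro ennreal_leI mult_left_mono)
    with upper[OF x] show "f (p * R \<omega>) \<le> ennreal b * ennreal (worst_return (R \<omega>) powr \<gamma>)"
      using ab by (simp add: ennreal_mult')
  qed
  also have "\<dots> = ennreal b * worst_moment"
    unfolding worst_moment_def by (rule nn_integral_cmult) auto
  finally show "unit_moment f p \<le> ennreal b * worst_moment" .
qed

lemma period_from_cone:
  assumes f: "cone_decreasing \<gamma> f" and x: "x \<in> position_cone" and p: "p \<in> weight_simplex"
  shows "period_moment f x p =
    ennreal (wealth_after x p powr \<gamma>) * unit_moment f p"
proof -
  have "period_moment f x p =
      (\<integral>\<^sup>+\<omega>. ennreal (wealth_after x p powr \<gamma>) * f (p * R \<omega>) \<partial>M)"
    using p x by (intro nn_integral_cong cone_decreasing_scale[OF f] return_cone_simplex rebalanced_wealth_pos)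
  also have "\<dots> = ennreal (wealth_after x p powr \<gamma>) * unit_moment f p"
    using f p by (intro nn_integral_cmult measurable_after_return)
  finally show ?thesis .
qed

text \<open>After one step the constant of comparison depends on the cost rates only: any two positions of
  equal wealth can be rebalanced to the same weights and this leaves at least the fraction \<^term>\<open>min_shrink\<close> of the wealth.\<close>

lemma bellman_comparable:
  assumes f: "cone_decreasing \<gamma> f"
    and lower: "\<And>x. x \<in> position_cone \<Longrightarrow> ennreal (a * (x \<bullet> 1) powr \<gamma>) \<le> f x"
    and upper: "\<And>x. x \<in> position_cone \<Longrightarrow> f x \<le> ennreal (b * (x \<bullet> 1) powr \<gamma>)"
    and ab: "0 < a" "0 \<le> b"
  shows "power_comparable \<gamma> cost_ratio (\<B> f)"
proof -
  define e where "e = (INF p\<in>weight_simplex. \<integral>\<^sup>+\<omega>. f (p * R \<omega>) \<partial>M)"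
  note bounds = one_period_bounds[OF f _ lower upper less_imp_le[OF ab(1)] ab(2)]
  have "0 < ennreal a * best_moment" using ab best_moment_pos by (simp add: ennreal_zero_less_mult_iff)
  also have "\<dots> \<le> e" unfolding e_def by (intro INF_greatest bounds)
  finally have e0: "0 < e" .
  obtain p0 :: "real^'d" where p0: "p0 \<in> weight_simplex" using simplex_nonempty by blast
  have "e \<le> (\<integral>\<^sup>+\<omega>. f (p0 * R \<omega>) \<partial>M)" unfolding e_def using p0 by (rule INF_lower)
  also have "\<dots> \<le> ennreal b * worst_moment" by (rule bounds[OF p0])
  also have "\<dots> < \<infinity>" using worst_moment_finite by (simp add: ennreal_mult_less_top)
  finally have "e < \<infinity>" .
  then obtain a' where a': "e = ennreal a'" "0 < a'"
    using e0 by (cases e) (auto simp: ennreal_less_zero_iff)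
  show ?thesis
    unfolding power_comparable_def
  proof (intro exI[of _ a'] conjI ballI a')
    fix x :: "real^'d" assume x: "x \<in> position_cone"
    then have x0: "0 < x \<bullet> 1" by (simp add: position_cone_def)
    have W: "0 < wealth_after x p" "wealth_after x p \<le> x \<bullet> 1" "min_shrink * (x \<bullet> 1) \<le> wealth_after x p"
      if "p \<in> weight_simplex" for p
      using rebalanced_wealth_pos rebalanced_wealth_le rebalanced_wealth_ge x that by auto
    note eq = period_from_cone[OF f x]
    show "ennreal (a' * (x \<bullet> 1) powr \<gamma>) \<le> \<B> f x"
      unfolding bellman_def
    proof (rule INF_greatest)
      fix p :: "real^'d" assume p: "p \<in> weight_simplex"
      have "(x \<bullet> 1) powr \<gamma> \<le> wealth_after x p powr \<gamma>"
        using W[OF p] \<gamma>_neg by (intro powr_mono2') auto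
      then have "ennreal ((x \<bullet> 1) powr \<gamma>) * e \<le> ennreal (wealth_after x p powr \<gamma>) * unit_moment f p"
        unfolding e_def using p by (intro mult_mono ennreal_leI INF_lower) auto
      then show "ennreal (a' * (x \<bullet> 1) powr \<gamma>) \<le> period_moment f x p"
        using a' eq[OF p] by (simp add: ennreal_mult' mult.commute)
    qed
    have "\<B> f x \<le> ennreal (cost_ratio * (x \<bullet> 1) powr \<gamma>) * e"
      unfolding e_def
    proof (rule ennreal_le_mult_INF)
      show "0 < cost_ratio * (x \<bullet> 1) powr \<gamma>" using cost_ratio_ge_1 x0 by simp
      fix p :: "real^'d" assume p: "p \<in> weight_simplex"
      have "wealth_after x p powr \<gamma> \<le> (min_shrink * (x \<bullet> 1)) powr \<gamma>"
        using W[OF p] x0 min_shrink_pos \<gamma>_neg by (intro powr_mono2') auto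
      then have "ennreal (wealth_after x p powr \<gamma>) \<le> ennreal (cost_ratio * (x \<bullet> 1) powr \<gamma>)"
        by (intro ennreal_leI) (simp add: powr_mult cost_ratio_def)
      then have "ennreal (wealth_after x p powr \<gamma>) * unit_moment f p
          \<le> ennreal (cost_ratio * (x \<bullet> 1) powr \<gamma>) * unit_moment f p"
        by (rule mult_right_mono) simp
      with bellman_le[OF p, of f x]
      show "\<B> f x \<le> ennreal (cost_ratio * (x \<bullet> 1) powr \<gamma>) * unit_moment f p"
        unfolding eq[OF p] by (rule order_trans)
    qed
    then show "\<B> f x \<le> ennreal (cost_ratio * a' * (x \<bullet> 1) powr \<gamma>)"
      using a' by (simp add: mult_ac flip: ennreal_mult')
  qed
qed

lemma power_comparable_bellman:
  assumes f: "cone_decreasing \<gamma> f" "power_comparable \<gamma> K f"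
  shows "power_comparable \<gamma> cost_ratio (\<B> f)"
proof -
  obtain a where a: "0 < a" and b: "\<And>x. x \<in> position_cone \<Longrightarrow>
     ennreal (a * (x \<bullet> 1) powr \<gamma>) \<le> f x \<and> f x \<le> ennreal (K * a * (x \<bullet> 1) powr \<gamma>)"
    using f(2) by (auto simp: power_comparable_def)
  have "f x \<le> ennreal ((max 0 K * a) * (x \<bullet> 1) powr \<gamma>)" if x: "x \<in> position_cone" for x
  proof -
    have "K * a * (x \<bullet> 1) powr \<gamma> \<le> (max 0 K * a) * (x \<bullet> 1) powr \<gamma>"
      using a by (intro mult_right_mono) auto
    then show ?thesis using b[OF x] by (meson ennreal_leI order_trans)
  qed
  then show ?thesis using a b by (intro bellman_comparable[OF f(1), of a "max 0 K * a"]) auto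
qed

lemma optimal_moment_0: "\<U> 0 x = ennreal ((x \<bullet> 1) powr \<gamma>)"
  and optimal_moment_Suc: "\<U> (Suc n) = \<B> (\<U> n)"
  by (simp_all add: optimal_moment_def)

lemma optimal_moment_class:
  "cone_decreasing \<gamma> (\<U> n) \<and> power_comparable \<gamma> cost_ratio (\<U> n)"
proof (induction n)
  case 0
  have "power_comparable \<gamma> cost_ratio (\<U> 0)"
    unfolding power_comparable_def optimal_moment_0
    using cost_ratio_ge_1 by (intro exI[of _ 1]) (auto intro!: ennreal_leI simp: mult_le_cancel_right1)
  then show ?case
    using cone_decreasing_powr[of \<gamma>] \<gamma>_neg by (simp add: optimal_moment_def)
next
  case (Suc n)
  then show ?case using bellman_decreasing power_comparable_bellman unfolding optimal_moment_Suc by blast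
qed

lemmas optimal_moment_decreasing = optimal_moment_class[THEN conjunct1]
  and optimal_moment_comparable = optimal_moment_class[THEN conjunct2]

lemma optimal_moment_finite_pos:
  assumes "x \<in> position_cone" shows "0 < \<U> n x" "\<U> n x < \<infinity>"
proof -
  obtain a where "0 < a" "ennreal (a * (x \<bullet> 1) powr \<gamma>) \<le> \<U> n x"
    "\<U> n x \<le> ennreal (cost_ratio * a * (x \<bullet> 1) powr \<gamma>)"
    using optimal_moment_comparable[of n] assms by (auto simp: power_comparable_def)
  moreover have "0 < (x \<bullet> 1) powr \<gamma>" using assms by (simp add: position_cone_def)
  ultimately show "0 < \<U> n x" "\<U> n x < \<infinity>"
    by (auto intro: less_le_trans[rotated] le_less_trans simp: ennreal_zero_less_mult_iff)
qed

end

section \<open>Stationary policies\<close>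

context one_period_market
begin

lemma optimal_moment_le_power:
  assumes \<pi>: "\<pi> \<in> weight_simplex" and x: "x \<in> position_cone"
  shows "\<U> n x \<le> ennreal (cost_ratio * (x \<bullet> 1) powr \<gamma>) * \<U> n \<pi>"
proof -
  obtain a where a: "0 < a" and bound: "\<And>y. y \<in> position_cone \<Longrightarrow>
      ennreal (a * (y \<bullet> 1) powr \<gamma>) \<le> \<U> n y \<and> \<U> n y \<le> ennreal (cost_ratio * a * (y \<bullet> 1) powr \<gamma>)"
    using optimal_moment_comparable[of n] by (auto simp: power_comparable_def)
  have "\<pi> \<bullet> 1 = 1" "\<pi> \<in> position_cone" using \<pi> simplex_subset_cone by (auto simp: weight_simplex_def)
  then have "ennreal a \<le> \<U> n \<pi>" using bound[of \<pi>] by simp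
  then have "ennreal (cost_ratio * (x \<bullet> 1) powr \<gamma>) * ennreal a \<le> ennreal (cost_ratio * (x \<bullet> 1) powr \<gamma>) * \<U> n \<pi>"
    by (intro mult_left_mono) auto
  moreover have "\<U> n x \<le> ennreal (cost_ratio * (x \<bullet> 1) powr \<gamma>) * ennreal a"
    using bound[OF x] a by (simp add: mult_ac flip: ennreal_mult')
  ultimately show ?thesis by order
qed

text \<open>Weights that depend only on the cell of the position and are nearly optimal at its lower corner
  are nearly optimal in the whole cell, since a larger position can only lower the moment, and the
  optimal moment varies little within a cell.\<close>

lemma near_optimal_weights:
  assumes f: "cone_decreasing \<gamma> f"
    and lower: "\<And>x. x \<in> position_cone \<Longrightarrow> ennreal (a * (x \<bullet> 1) powr \<gamma>) \<le> f x"
    and upper: "\<And>x. x \<in> position_cone \<Longrightarrow> f x \<le> ennreal (b * (x \<bullet> 1) powr \<gamma>)"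
    and ab: "0 < a" "0 \<le> b" and \<epsilon>: "0 < \<epsilon>"
  obtains \<phi> where "\<phi> \<in> borel \<rightarrow>\<^sub>M borel" "\<And>x. \<phi> x \<in> weight_simplex"
    "\<And>x. x \<in> position_cone \<Longrightarrow>
       period_moment f x (\<phi> x) \<le> ennreal (exp \<epsilon>) * \<B> f x"
proof -
  define V where "V y p = period_moment f y p" for y p
  \<comment> \<open>half of \<open>\<epsilon>\<close> is spent on the choice at the corner, the other half on the passage from the corner to \<open>x\<close>\<close>
  define \<delta> where "\<delta> = \<epsilon> / (2 * - \<gamma>)"
  have \<delta>: "0 < \<delta>" "- \<delta> * \<gamma> = \<epsilon> / 2" using \<epsilon> \<gamma>_neg by (simp_all add: \<delta>_def field_simps)
  have "\<exists>p. p \<in> weight_simplex \<and> (y \<in> position_cone \<longrightarrow> V y p \<le> ennreal (exp (\<epsilon> / 2)) * \<B> f y)" for y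
  proof (cases "y \<in> position_cone")
    case True
    obtain a' where "0 < a'" "ennreal (a' * (y \<bullet> 1) powr \<gamma>) \<le> \<B> f y"
      "\<B> f y \<le> ennreal (cost_ratio * a' * (y \<bullet> 1) powr \<gamma>)"
      using bellman_comparable[OF f lower upper ab] True by (auto simp: power_comparable_def)
    moreover have "0 < (y \<bullet> 1) powr \<gamma>" using True by (simp add: position_cone_def)
    ultimately have "0 < \<B> f y" "\<B> f y < \<infinity>"
      by (auto intro: less_le_trans[rotated] le_less_trans simp: ennreal_zero_less_mult_iff)
    then obtain v where v: "\<B> f y = ennreal v" "0 < v"
      by (cases "\<B> f y") (auto simp: ennreal_less_zero_iff)
    have "\<B> f y < ennreal (exp (\<epsilon> / 2)) * \<B> f y"
      using v \<epsilon> by (simp add: ennreal_less_iff flip: ennreal_mult')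
    then show ?thesis
      by (subst (asm) (1) bellman_def) (auto simp: INF_less_iff V_def intro: less_imp_le)
  next
    case False
    then show ?thesis using simplex_nonempty by blast
  qed
  then obtain \<psi> where \<psi>: "\<And>y. \<psi> y \<in> weight_simplex"
      "\<And>y. y \<in> position_cone \<Longrightarrow> V y (\<psi> y) \<le> ennreal (exp (\<epsilon> / 2)) * \<B> f y"
    by metis
  define \<phi> where "\<phi> x = \<psi> (log_grid \<delta> x)" for x
  show thesis
  proof
    show "\<phi> \<in> borel \<rightarrow>\<^sub>M borel" unfolding \<phi>_def[abs_def] by (rule measurable_log_grid)
    show "\<phi> x \<in> weight_simplex" for x by (simp add: \<phi>_def \<psi>)
    fix x :: "real^'d" assume x: "x \<in> position_cone"
    note grid = log_grid_bounds[OF x \<delta>(1)]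
    have "V x (\<phi> x) \<le> V (log_grid \<delta> x) (\<phi> x)"
      using cone_decreasing_antimono[OF period_decreasing[OF f], of "\<phi> x" "log_grid \<delta> x" x] grid x
      by (simp add: V_def \<phi>_def \<psi>)
    also have "\<dots> \<le> ennreal (exp (\<epsilon> / 2)) * \<B> f (log_grid \<delta> x)"
      unfolding \<phi>_def using grid by (intro \<psi>)
    also have "\<B> f (log_grid \<delta> x) \<le> ennreal (exp (- \<delta>) powr \<gamma>) * \<B> f x"
      using grid x by (intro cone_decreasingD[OF bellman_decreasing[OF f]]) auto
    also have "exp (- \<delta>) powr \<gamma> = exp (\<epsilon> / 2)" using \<delta>(2) by (simp add: exp_powr_real)
    also have "ennreal (exp (\<epsilon> / 2)) * (ennreal (exp (\<epsilon> / 2)) * \<B> f x) = ennreal (exp \<epsilon>) * \<B> f x"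
      by (simp flip: mult.assoc ennreal_mult' exp_add)
    finally show "period_moment f x (\<phi> x) \<le> ennreal (exp \<epsilon>) * \<B> f x"
      by (auto simp: V_def mult_left_mono)
  qed
qed

text \<open>If the optimal moments decay at rate \<open>\<rho>\<close> over \<open>N\<close> periods, then their discounted minimum over
  fewer than \<open>N\<close> periods is a supersolution with rate \<open>\<rho>\<close>: the operator shifts every entry of the
  minimum to its successor, and the last one to something below the first.\<close>

lemma supersolution:
  assumes N: "1 \<le> N"
    and decay: "\<And>x. x \<in> position_cone \<Longrightarrow> \<U> N x \<le> ennreal (exp (\<rho> * N) * (x \<bullet> 1) powr \<gamma>)"
  obtains f a where "cone_decreasing \<gamma> f" "0 < a"
    "\<And>x. x \<in> position_cone \<Longrightarrow> ennreal (a * (x \<bullet> 1) powr \<gamma>) \<le> f x"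
    "\<And>x. x \<in> position_cone \<Longrightarrow> f x \<le> ennreal ((x \<bullet> 1) powr \<gamma>)"
    "\<And>x. x \<in> position_cone \<Longrightarrow> \<B> f x \<le> ennreal (exp \<rho>) * f x"
proof -
  define g where "g j x = ennreal (exp (- \<rho> * real j)) * \<U> j x" for j and x :: "real^'d"
  define f where "f x = (INF j\<in>{..<N}. g j x)" for x
  have g: "cone_decreasing \<gamma> (g j)" for j
    unfolding g_def[abs_def] by (intro cone_decreasing_cmult optimal_moment_decreasing)
  have f_le: "f x \<le> g j x" if "j < N" for j x unfolding f_def using that by (intro INF_lower) auto
  have "\<exists>a>0. \<forall>x\<in>position_cone. ennreal (a * (x \<bullet> 1) powr \<gamma>) \<le> \<U> j x" for j
    using optimal_moment_comparable[of j] by (auto simp: power_comparable_def)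
  then obtain a where a: "\<And>j. 0 < a j"
      "\<And>j x. x \<in> position_cone \<Longrightarrow> ennreal (a j * (x \<bullet> 1) powr \<gamma>) \<le> \<U> j x"
    by metis
  define b where "b = Min ((\<lambda>j. exp (- \<rho> * real j) * a j) ` {..<N})"
  have b: "b \<le> exp (- \<rho> * real j) * a j" if "j < N" for j
    unfolding b_def using that by (intro Min_le) auto
  show thesis
  proof
    show "cone_decreasing \<gamma> f" unfolding f_def[abs_def] using g by (rule cone_decreasing_INF)
    show "0 < b" unfolding b_def using N a by (subst Min_gr_iff) (auto simp: lessThan_empty_iff)
    fix x :: "real^'d" assume x: "x \<in> position_cone"
    show "ennreal (b * (x \<bullet> 1) powr \<gamma>) \<le> f x"
      unfolding f_def
    proof (rule INF_greatest)
      fix j assume "j \<in> {..<N}"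
      then have "ennreal (b * (x \<bullet> 1) powr \<gamma>) \<le> ennreal (exp (- \<rho> * real j) * (a j * (x \<bullet> 1) powr \<gamma>))"
        unfolding mult.assoc[symmetric] by (intro ennreal_leI mult_right_mono b) auto
      also have "\<dots> \<le> g j x"
        unfolding g_def using a(2)[OF x, of j] by (simp add: ennreal_mult' mult_left_mono)
      finally show "ennreal (b * (x \<bullet> 1) powr \<gamma>) \<le> g j x" .
    qed
    show "f x \<le> ennreal ((x \<bullet> 1) powr \<gamma>)" using f_le[of 0 x] N by (simp add: g_def optimal_moment_0)
    have step: "\<B> f x \<le> ennreal (exp (- \<rho> * real j)) * \<U> (Suc j) x" if "j < N" for j
    proof -
      have "\<B> f x \<le> \<B> (g j) x" using f_le[OF that] x by (rule bellman_mono)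
      also have "\<dots> \<le> ennreal (exp (- \<rho> * real j)) * \<B> (\<U> j) x"
        unfolding g_def using x by (intro bellman_cmult_le optimal_moment_decreasing) auto
      finally show ?thesis by (simp add: optimal_moment_Suc)
    qed
    show "\<B> f x \<le> ennreal (exp \<rho>) * f x"
      unfolding f_def[of x]
    proof (rule ennreal_le_mult_INF)
      fix k assume "k \<in> {..<N}"
      then have k: "k < N" by simp
      show "\<B> f x \<le> ennreal (exp \<rho>) * g k x"
      proof (cases k)
        case (Suc j)
        have "ennreal (exp \<rho>) * g k x = ennreal (exp (- \<rho> * real j)) * \<U> (Suc j) x"
          unfolding g_def Suc mult.assoc[symmetric] ennreal_mult'[OF exp_ge_zero, symmetric] exp_add[symmetric]
          by (simp add: algebra_simps)
        with step[of j] k Suc show ?thesis by simp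
      next
        case 0
        have "\<B> f x \<le> ennreal (exp (- \<rho> * real (N - 1))) * \<U> N x" using step[of "N - 1"] N by simp
        also have "\<dots> \<le> ennreal (exp (- \<rho> * real (N - 1))) * ennreal (exp (\<rho> * N) * (x \<bullet> 1) powr \<gamma>)"
          by (intro mult_left_mono decay x) auto
        also have "\<dots> = ennreal (exp (- \<rho> * real (N - 1) + \<rho> * N) * (x \<bullet> 1) powr \<gamma>)"
          by (subst ennreal_mult'[symmetric]) (simp_all only: exp_ge_zero exp_add mult.assoc)
        also have "- \<rho> * real (N - 1) + \<rho> * N = \<rho>" using N by (simp add: of_nat_diff algebra_simps)
        finally show ?thesis by (simp add: 0 g_def optimal_moment_0 ennreal_mult')
      qed
    qed simp
  qed
qed

text \<open>The choice is made at the weights, and homogeneity carries the inequality over to every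
  position with these weights.\<close>

lemma stationary_policy:
  assumes N: "1 \<le> N" and \<rho>: "\<rho>' < \<rho>"
    and decay: "\<And>x. x \<in> position_cone \<Longrightarrow> \<U> N x \<le> ennreal (exp (\<rho>' * N) * (x \<bullet> 1) powr \<gamma>)"
  obtains f a \<phi> where "cone_decreasing \<gamma> f" "0 < a"
    "\<And>x. x \<in> position_cone \<Longrightarrow> ennreal (a * (x \<bullet> 1) powr \<gamma>) \<le> f x"
    "\<And>x. x \<in> position_cone \<Longrightarrow> f x \<le> ennreal ((x \<bullet> 1) powr \<gamma>)"
    "\<phi> \<in> borel \<rightarrow>\<^sub>M borel" "\<And>x. \<phi> x \<in> weight_simplex"
    "\<And>x t. x \<in> weight_simplex \<Longrightarrow> 0 < t \<Longrightarrow>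
       period_moment f (t *\<^sub>R x) (\<phi> x) \<le> ennreal (exp \<rho>) * f (t *\<^sub>R x)"
proof -
  obtain f a where f: "cone_decreasing \<gamma> f" "0 < a"
    and f_lower: "\<And>x. x \<in> position_cone \<Longrightarrow> ennreal (a * (x \<bullet> 1) powr \<gamma>) \<le> f x"
    and f_upper: "\<And>x. x \<in> position_cone \<Longrightarrow> f x \<le> ennreal ((x \<bullet> 1) powr \<gamma>)"
    and super: "\<And>x. x \<in> position_cone \<Longrightarrow> \<B> f x \<le> ennreal (exp \<rho>') * f x"
    using supersolution[OF N decay] by blast
  obtain \<phi> where \<phi>: "\<phi> \<in> borel \<rightarrow>\<^sub>M borel" "\<And>x. \<phi> x \<in> weight_simplex"
    "\<And>x. x \<in> position_cone \<Longrightarrow>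
       period_moment f x (\<phi> x) \<le> ennreal (exp (\<rho> - \<rho>')) * \<B> f x"
    by (rule near_optimal_weights[OF f(1) f_lower _ f(2), of 1 "\<rho> - \<rho>'"]) (use f_upper \<rho> in auto)
  show thesis
  proof (rule that[OF f f_lower f_upper \<phi>(1,2)])
    fix x :: "real^'d" and t :: real assume x: "x \<in> weight_simplex" and t: "0 < t"
    then have xc: "x \<in> position_cone" using simplex_subset_cone by blast
    have "period_moment f (t *\<^sub>R x) (\<phi> x) =
        ennreal (t powr \<gamma>) * period_moment f x (\<phi> x)"
      by (rule cone_decreasing_scale[OF period_decreasing[OF f(1) \<phi>(2)] xc t])
    also have "\<dots> \<le> ennreal (t powr \<gamma>) * (ennreal (exp (\<rho> - \<rho>')) * (ennreal (exp \<rho>') * f x))"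
      using order_trans[OF \<phi>(3)[OF xc] mult_left_mono[OF super[OF xc]]] by (intro mult_left_mono) auto
    also have "\<dots> = ennreal (exp \<rho>) * (ennreal (t powr \<gamma>) * f x)"
      by (simp add: mult_ac exp_diff flip: mult.assoc ennreal_mult')
    also have "\<dots> = ennreal (exp \<rho>) * f (t *\<^sub>R x)"
      using cone_decreasing_scale[OF f(1) xc t] by simp
    finally show "period_moment f (t *\<^sub>R x) (\<phi> x) \<le> ennreal (exp \<rho>) * f (t *\<^sub>R x)" .
  qed
qed

end

section \<open>Stability of the optimal moments under perturbation of the returns\<close>

definition log_distance :: "real^'d \<Rightarrow> real^'d \<Rightarrow> real" where
  "log_distance r r' = (\<Sum>i\<in>UNIV. \<bar>ln (r $ i) - ln (r' $ i)\<bar>)"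

lemma log_distance_nonneg: "0 \<le> log_distance r r'"
  by (simp add: log_distance_def sum_nonneg)

lemma log_distance_commute: "log_distance r r' = log_distance r' r"
  by (simp add: log_distance_def abs_minus_commute)

lemma log_distance_scale_le:
  assumes "\<And>i. 0 < r $ i" "\<And>i. 0 < r' $ i"
  shows "exp (- log_distance r r') * r $ i \<le> r' $ i"
proof -
  have "\<bar>ln (r $ i) - ln (r' $ i)\<bar> \<le> log_distance r r'"
    unfolding log_distance_def by (rule member_le_sum) auto
  then have "exp (- log_distance r r' + ln (r $ i)) \<le> exp (ln (r' $ i))" by simp
  then show ?thesis using assms by (simp only: exp_add exp_ln)
qed

lemma borel_measurable_log_distance [measurable]:
  assumes "X \<in> borel_measurable N" "Y \<in> borel_measurable N"
  shows "(\<lambda>\<omega>. log_distance (X \<omega>) (Y \<omega>)) \<in> borel_measurable N"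
proof -
  have [measurable]: "(\<lambda>\<omega>. X \<omega> $ i) \<in> borel_measurable N" "(\<lambda>\<omega>. Y \<omega> $ i) \<in> borel_measurable N" for i
    using assms by (simp_all add: borel_measurable_vec_iff)
  show ?thesis unfolding log_distance_def by measurable
qed

text \<open>If \<open>r'\<close> lies within the logarithmic distance \<open>Z\<close> of \<open>r\<close>, then a function of the class changes at
  most by the factor \<open>exp (- \<gamma> Z)\<close>, and both of its values are dominated by a negative power of the
  worst return. This bounds the error of the one-period moments, symmetrically in \<open>R\<close> and \<open>R'\<close>.\<close>

definition moment_error ::
    "'w measure \<Rightarrow> real \<Rightarrow> ('w \<Rightarrow> real^'d) \<Rightarrow> ('w \<Rightarrow> real^'d) \<Rightarrow> ennreal" where
  "moment_error M \<gamma> R R' = (\<integral>\<^sup>+\<omega>. (ennreal (worst_return (R \<omega>) powr \<gamma>) + ennreal (worst_return (R' \<omega>) powr \<gamma>)) *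
     ennreal (1 - exp (\<gamma> * log_distance (R \<omega>) (R' \<omega>))) \<partial>M)"

lemma moment_error_commute: "moment_error M \<gamma> R R' = moment_error M \<gamma> R' R"
  by (simp add: moment_error_def log_distance_commute add.commute)

context one_period_market
begin

text \<open>An absolute error becomes a relative one, since for every choice of weights the moment itself is at
  least a multiple of \<open>best_moment\<close>.\<close>

lemma perturbed_bellman_le:
  assumes R': "one_period_market M c h \<gamma> R'"
    and f: "cone_decreasing \<gamma> f" "power_comparable \<gamma> K f" "0 \<le> K"
    and err: "ennreal K * moment_error M \<gamma> R R' \<le> ennreal \<epsilon> * best_moment" and \<epsilon>: "0 \<le> \<epsilon>"
    and x: "x \<in> position_cone"
  shows "bellman M c h R' f x \<le> ennreal (1 + \<epsilon>) * \<B> f x"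
proof -
  interpret P: one_period_market M c h \<gamma> R' by fact
  obtain a where a: "0 < a" and bound: "\<And>y. y \<in> position_cone \<Longrightarrow>
      ennreal (a * (y \<bullet> 1) powr \<gamma>) \<le> f y \<and> f y \<le> ennreal (K * a * (y \<bullet> 1) powr \<gamma>)"
    using f(2) by (auto simp: power_comparable_def)
  have unit: "(\<integral>\<^sup>+\<omega>. f (p * R' \<omega>) \<partial>M) \<le> ennreal (1 + \<epsilon>) * unit_moment f p"
    if p: "p \<in> weight_simplex" for p
  proof -
    define loss where "loss \<omega> = 1 - exp (\<gamma> * log_distance (R \<omega>) (R' \<omega>))" for \<omega>
    have loss: "0 \<le> loss \<omega>" for \<omega>
      using \<gamma>_neg log_distance_nonneg[of "R \<omega>" "R' \<omega>"] by (simp add: loss_def mult_nonpos_nonneg)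
    have [measurable]: "(\<lambda>\<omega>. f (p * R \<omega>)) \<in> borel_measurable M"
      using measurable_after_return[OF f(1) p] .
    have "(\<integral>\<^sup>+\<omega>. f (p * R' \<omega>) \<partial>M) \<le> (\<integral>\<^sup>+\<omega>. f (p * R \<omega>) +
        ennreal (K * a) * ((ennreal (worst_return (R \<omega>) powr \<gamma>) + ennreal (worst_return (R' \<omega>) powr \<gamma>)) * ennreal (loss \<omega>)) \<partial>M)"
    proof (rule nn_integral_mono)
      fix \<omega> assume \<omega>: "\<omega> \<in> space M"
      let ?A = "f (p * R' \<omega>)" and ?B = "f (p * R \<omega>)" and ?Z = "log_distance (R \<omega>) (R' \<omega>)"
      have cone: "p * R \<omega> \<in> position_cone" "p * R' \<omega> \<in> position_cone"
        using return_cone_simplex[OF p \<omega>] P.return_cone_simplex[OF p \<omega>] by auto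
      have "exp (- ?Z) * (p $ i * R \<omega> $ i) \<le> p $ i * R' \<omega> $ i" for i
        using mult_left_mono[OF log_distance_scale_le[of "R \<omega>" "R' \<omega>" i], of "p $ i"]
          R_pos[OF \<omega>] P.R_pos[OF \<omega>] p by (simp add: weight_simplex_def mult_ac)
      then have "?A \<le> ennreal (exp (- ?Z) powr \<gamma>) * ?B"
        using cone by (intro cone_decreasingD[OF f(1)]) (auto simp: less_eq_vec_def)
      also have "exp (- ?Z) powr \<gamma> = 1 / exp (\<gamma> * ?Z)" 
        unfolding exp_powr_real by (simp add: exp_minus inverse_eq_divide mult.commute)
      \<comment> \<open>the fraction \<open>exp (\<gamma> * Z)\<close> of \<open>?A\<close> is covered by \<open>?B\<close>, and only the rest needs domination\<close>
      finally have AB: "ennreal (exp (\<gamma> * ?Z)) * ?A \<le> ?B"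
        by (simp add: ennreal_mult_le_iff_le_mult)
      have "((p * R' \<omega>) \<bullet> 1) powr \<gamma> \<le> worst_return (R' \<omega>) powr \<gamma>"
        using simplex_return_bounds[OF p, of "R' \<omega>"] worst_return_pos[of "R' \<omega>"] P.R_pos[OF \<omega>] \<gamma>_neg
        by (intro powr_mono2') auto
      then have "ennreal (K * a * ((p * R' \<omega>) \<bullet> 1) powr \<gamma>) \<le> ennreal (K * a) * ennreal (worst_return (R' \<omega>) powr \<gamma>)"
        using a f(3) by (subst ennreal_mult'[symmetric]) (auto intro!: ennreal_leI mult_left_mono)
      with bound[OF cone(2)] have A: "?A \<le> ennreal (K * a) * ennreal (worst_return (R' \<omega>) powr \<gamma>)"
        by (auto intro: order_trans)
      have "?A = (ennreal (exp (\<gamma> * ?Z)) + ennreal (loss \<omega>)) * ?A"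
        using loss[of \<omega>] by (simp add: loss_def flip: ennreal_plus)
      also have "\<dots> = ennreal (exp (\<gamma> * ?Z)) * ?A + ennreal (loss \<omega>) * ?A" by (rule distrib_right)
      also have "\<dots> \<le> ?B + ennreal (loss \<omega>) * (ennreal (K * a) * ennreal (worst_return (R' \<omega>) powr \<gamma>))"
        by (intro add_mono AB mult_left_mono A) auto
      also have "\<dots> \<le> ?B + ennreal (K * a) *
          ((ennreal (worst_return (R \<omega>) powr \<gamma>) + ennreal (worst_return (R' \<omega>) powr \<gamma>)) * ennreal (loss \<omega>))"
        by (simp add: mult_ac distrib_left)
      finally show "?A \<le> ?B + ennreal (K * a) *
          ((ennreal (worst_return (R \<omega>) powr \<gamma>) + ennreal (worst_return (R' \<omega>) powr \<gamma>)) * ennreal (loss \<omega>))" .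
    qed
    also have "\<dots> = unit_moment f p + ennreal (K * a) * moment_error M \<gamma> R R'"
      unfolding moment_error_def loss_def
      by (subst nn_integral_add) (simp_all add: nn_integral_cmult)
    also have "ennreal (K * a) * moment_error M \<gamma> R R' = ennreal a * (ennreal K * moment_error M \<gamma> R R')"
      using f(3) by (simp add: ennreal_mult' mult_ac)
    also have "\<dots> \<le> ennreal a * (ennreal \<epsilon> * best_moment)" by (intro mult_left_mono err) auto
    also have "\<dots> = ennreal \<epsilon> * (ennreal a * best_moment)" by (simp add: mult_ac)
    also have "ennreal a * best_moment \<le> unit_moment f p"
      by (rule one_period_bounds(1)[OF f(1) p, where b = "K * a"]) (use bound a f(3) in auto)
    finally show ?thesis
      using \<epsilon> by (simp add: distrib_right mult_left_mono add_left_mono)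
  qed
  show ?thesis
    unfolding bellman_def[of _ _ _ R]
  proof (rule ennreal_le_mult_INF)
    fix p :: "real^'d" assume p: "p \<in> weight_simplex"
    have "bellman M c h R' f x \<le> (\<integral>\<^sup>+\<omega>. f (wealth_after x p *\<^sub>R (p * R' \<omega>)) \<partial>M)"
      by (rule P.bellman_le[OF p])
    also have "\<dots> = ennreal (wealth_after x p powr \<gamma>) * (\<integral>\<^sup>+\<omega>. f (p * R' \<omega>) \<partial>M)"
      by (rule P.period_from_cone[OF f(1) x p])
    also have "\<dots> \<le> ennreal (wealth_after x p powr \<gamma>) * (ennreal (1 + \<epsilon>) * unit_moment f p)"
      by (intro mult_left_mono unit p) auto
    also have "\<dots> = ennreal (1 + \<epsilon>) * period_moment f x p"
      unfolding period_from_cone[OF f(1) x p] by (simp add: mult_ac)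
    finally show "bellman M c h R' f x \<le> ennreal (1 + \<epsilon>) * period_moment f x p" .
  qed (use \<epsilon> in simp)
qed

lemma perturbed_optimal_moment_le:
  assumes R': "one_period_market M c h \<gamma> R'"
    and err: "ennreal cost_ratio * moment_error M \<gamma> R R' \<le> ennreal \<epsilon> * best_moment" and \<epsilon>: "0 \<le> \<epsilon>"
    and x: "x \<in> position_cone"
  shows "optimal_moment M c h \<gamma> R' n x \<le> ennreal ((1 + \<epsilon>) ^ n) * \<U> n x"
  using x
proof (induction n arbitrary: x)
  case 0
  then show ?case by (simp add: optimal_moment_def)
next
  case (Suc n)
  interpret P: one_period_market M c h \<gamma> R' by fact
  have "P.\<U> (Suc n) x \<le> P.\<B> (\<lambda>x. ennreal ((1 + \<epsilon>) ^ n) * \<U> n x) x"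
    unfolding P.optimal_moment_Suc by (rule P.bellman_mono[OF Suc.IH Suc.prems])
  also have "\<dots> \<le> ennreal ((1 + \<epsilon>) ^ n) * P.\<B> (\<U> n) x"
    using \<epsilon> Suc.prems by (intro P.bellman_cmult_le optimal_moment_decreasing) auto
  also have "\<dots> \<le> ennreal ((1 + \<epsilon>) ^ n) * (ennreal (1 + \<epsilon>) * \<B> (\<U> n) x)"
    using cost_ratio_ge_1
    by (intro mult_left_mono perturbed_bellman_le[OF R' optimal_moment_decreasing optimal_moment_comparable _ err \<epsilon> Suc.prems]) auto
  also have "\<dots> = ennreal ((1 + \<epsilon>) ^ Suc n) * \<U> (Suc n) x"
    using \<epsilon> by (simp add: optimal_moment_Suc ennreal_mult mult_ac)
  finally show ?case .
qed

end

lemma tendsto_log_distance: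
  assumes pos: "\<And>i. 0 < r $ i" and lim: "\<And>i. (\<lambda>m. q m $ i) \<longlonglongrightarrow> r $ i"
  shows "(\<lambda>m. log_distance r (q m)) \<longlonglongrightarrow> 0"
proof -
  have "(\<lambda>m. log_distance r (q m)) \<longlonglongrightarrow> (\<Sum>i\<in>UNIV. \<bar>ln (r $ i) - ln (r $ i)\<bar>)"
    unfolding log_distance_def
    by (intro tendsto_intros lim) (metis pos less_irrefl)
  then show ?thesis by simp
qed

text \<open>Together with dominated convergence this keeps the moments of the best returns, by which errors are
  divided, away from \<open>0\<close>.\<close>

lemma best_return_perturbed:
  assumes "\<And>i. 0 < r $ i" "\<And>i. 0 < r' $ i"
  shows "best_return r' \<le> exp (log_distance r r') * best_return r"
proof -
  have "best_return r' \<in> range (($) r')" unfolding best_return_def by (rule Max_in) auto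
  then obtain i where i: "best_return r' = r' $ i" by auto
  have "exp (- log_distance r r') * r' $ i \<le> r $ i"
    using log_distance_scale_le[of r' r i] assms by (simp add: log_distance_commute)
  also have "\<dots> \<le> best_return r" by (rule best_return_ge)
  finally show ?thesis unfolding i by (simp add: exp_minus field_simps)
qed

context one_period_market
begin

lemma best_moment_finite: "best_moment < \<infinity>"
proof -
  have "best_moment \<le> worst_moment"
    unfolding best_moment_def worst_moment_def
    using worst_return_pos[of "R _"] R_pos \<gamma>_neg worst_le_best
    by (intro nn_integral_mono ennreal_leI powr_mono2') auto
  then show ?thesis using worst_moment_finite by order
qed

text \<open>Pointwise convergence of the returns and a common integrable bound suffice, and the error rate
  is uniform in the number of periods.\<close>

lemma eventually_optimal_moment_close:
  fixes Rm :: "nat \<Rightarrow> 'w \<Rightarrow> real^'d" and D :: "'w \<Rightarrow> ennreal"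
  assumes market: "\<forall>\<^sub>F m in sequentially. one_period_market M c h \<gamma> (Rm m)"
    and lim: "\<And>\<omega> i. \<omega> \<in> space M \<Longrightarrow> (\<lambda>m. Rm m \<omega> $ i) \<longlonglongrightarrow> R \<omega> $ i"
    and D [measurable]: "D \<in> borel_measurable M" "(\<integral>\<^sup>+\<omega>. D \<omega> \<partial>M) < \<infinity>"
    and dominated: "\<forall>\<^sub>F m in sequentially. \<forall>\<omega>\<in>space M. ennreal (worst_return (Rm m \<omega>) powr \<gamma>) \<le> D \<omega>"
    and \<epsilon>: "0 < \<epsilon>"
  shows "\<forall>\<^sub>F m in sequentially. \<forall>n. \<forall>x\<in>position_cone.
    optimal_moment M c h \<gamma> (Rm m) n x \<le> ennreal ((1 + \<epsilon>) ^ n) * \<U> n x \<and>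
    \<U> n x \<le> ennreal ((1 + \<epsilon>) ^ n) * optimal_moment M c h \<gamma> (Rm m) n x"
proof -
  obtain m0 where "\<forall>m\<ge>m0. one_period_market M c h \<gamma> (Rm m) \<and>
      (\<forall>\<omega>\<in>space M. ennreal (worst_return (Rm m \<omega>) powr \<gamma>) \<le> D \<omega>)"
    using eventually_conj[OF market dominated] by (auto simp: eventually_sequentially)
  then have tail: "one_period_market M c h \<gamma> (Rm (m + m0))"
      "\<And>\<omega>. \<omega> \<in> space M \<Longrightarrow> ennreal (worst_return (Rm (m + m0) \<omega>) powr \<gamma>) \<le> D \<omega>" for m
    by auto
  \<comment> \<open>dominated convergence needs the hypotheses for every index\<close>
  define Q where "Q m = Rm (m + m0)" for m
  have Q: "one_period_market M c h \<gamma> (Q m)" for m using tail by (simp add: Q_def)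
  note Q_meas [measurable] = one_period_market.R_measurable[OF Q]
  note Q_pos = one_period_market.R_pos[OF Q]
  define loss where "loss m \<omega> = 1 - exp (\<gamma> * log_distance (R \<omega>) (Q m \<omega>))" for m \<omega>
  have [measurable]: "loss m \<in> borel_measurable M" for m unfolding loss_def by measurable
  have loss_bounds: "0 \<le> loss m \<omega>" "loss m \<omega> \<le> 1" for m \<omega>
    using \<gamma>_neg log_distance_nonneg[of "R \<omega>" "Q m \<omega>"] by (simp_all add: loss_def mult_nonpos_nonneg)
  have dist_lim: "(\<lambda>m. log_distance (R \<omega>) (Q m \<omega>)) \<longlonglongrightarrow> 0" if "\<omega> \<in> space M" for \<omega>
    unfolding Q_def using that R_pos LIMSEQ_ignore_initial_segment[OF lim]
    by (intro tendsto_log_distance) auto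
  have loss_lim: "(\<lambda>m. loss m \<omega>) \<longlonglongrightarrow> 0" if "\<omega> \<in> space M" for \<omega>
    unfolding loss_def using tendsto_diff[OF tendsto_const tendsto_exp[OF tendsto_mult_left[OF dist_lim[OF that], of \<gamma>]], of 1]
    by simp
  define w where "w \<omega> = ennreal (worst_return (R \<omega>) powr \<gamma>)" for \<omega>
  have [measurable]: "w \<in> borel_measurable M" unfolding w_def by measurable
  have "(\<integral>\<^sup>+\<omega>. w \<omega> + D \<omega> \<partial>M) = worst_moment + (\<integral>\<^sup>+\<omega>. D \<omega> \<partial>M)"
    unfolding worst_moment_def by (subst nn_integral_add) (auto simp: w_def[abs_def])
  also have "\<dots> < \<infinity>" using worst_moment_finite D(2) by simp
  finally have wD: "(\<integral>\<^sup>+\<omega>. w \<omega> + D \<omega> \<partial>M) < \<infinity>" .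
  have error_lim: "(\<lambda>m. moment_error M \<gamma> R (Q m)) \<longlonglongrightarrow> 0"
  proof -
    have "(\<lambda>m. moment_error M \<gamma> R (Q m)) \<longlonglongrightarrow> (\<integral>\<^sup>+\<omega>. 0 \<partial>M)"
      unfolding moment_error_def
    proof (rule nn_integral_dominated_convergence[where w = "\<lambda>\<omega>. w \<omega> + D \<omega>"])
      have bound: "(ennreal (worst_return (R \<omega>) powr \<gamma>) + ennreal (worst_return (Q m \<omega>) powr \<gamma>)) *
          ennreal (1 - exp (\<gamma> * log_distance (R \<omega>) (Q m \<omega>))) \<le> (w \<omega> + D \<omega>) * ennreal (loss m \<omega>)"
        if "\<omega> \<in> space M" for m \<omega>
        using tail(2)[OF that] unfolding w_def loss_def Q_def by (intro mult_right_mono add_left_mono) auto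
      also have "(w \<omega> + D \<omega>) * ennreal (loss m \<omega>) \<le> (w \<omega> + D \<omega>) * 1" for m \<omega>
        using loss_bounds[of m \<omega>] by (intro mult_left_mono) (auto simp: ennreal_le_1)
      finally show "AE \<omega> in M. (ennreal (worst_return (R \<omega>) powr \<gamma>) + ennreal (worst_return (Q m \<omega>) powr \<gamma>)) *
          ennreal (1 - exp (\<gamma> * log_distance (R \<omega>) (Q m \<omega>))) \<le> w \<omega> + D \<omega>" for m
        by (intro AE_I2) auto
      have "AE \<omega> in M. w \<omega> + D \<omega> \<noteq> \<infinity>"
        using wD by (intro nn_integral_noteq_infinite) auto
      then show "AE \<omega> in M. (\<lambda>m. (ennreal (worst_return (R \<omega>) powr \<gamma>) + ennreal (worst_return (Q m \<omega>) powr \<gamma>)) *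
          ennreal (1 - exp (\<gamma> * log_distance (R \<omega>) (Q m \<omega>)))) \<longlonglongrightarrow> 0"
      proof (rule AE_mp, intro AE_I2 impI)
        fix \<omega> assume \<omega>: "\<omega> \<in> space M" and fin: "w \<omega> + D \<omega> \<noteq> \<infinity>"
        have "(\<lambda>m. (w \<omega> + D \<omega>) * ennreal (loss m \<omega>)) \<longlonglongrightarrow> (w \<omega> + D \<omega>) * ennreal 0"
          using fin by (intro tendsto_mult_ennreal tendsto_const tendsto_ennrealI loss_lim \<omega>) auto
        then have lim0: "(\<lambda>m. (w \<omega> + D \<omega>) * ennreal (loss m \<omega>)) \<longlonglongrightarrow> 0" by simp
        show "(\<lambda>m. (ennreal (worst_return (R \<omega>) powr \<gamma>) + ennreal (worst_return (Q m \<omega>) powr \<gamma>)) *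
          ennreal (1 - exp (\<gamma> * log_distance (R \<omega>) (Q m \<omega>)))) \<longlonglongrightarrow> 0"
          by (rule tendsto_sandwich[OF _ _ tendsto_const lim0]) (use bound[OF \<omega>] in auto)
      qed
    qed (use wD in auto)
    then show ?thesis by simp
  qed
  have best_lim: "(\<lambda>m. \<integral>\<^sup>+\<omega>. ennreal ((exp (log_distance (R \<omega>) (Q m \<omega>)) * best_return (R \<omega>)) powr \<gamma>) \<partial>M) \<longlonglongrightarrow> best_moment"
    unfolding best_moment_def
  proof (rule nn_integral_dominated_convergence[where w = "\<lambda>\<omega>. ennreal (best_return (R \<omega>) powr \<gamma>)"])
    show "AE \<omega> in M. ennreal ((exp (log_distance (R \<omega>) (Q m \<omega>)) * best_return (R \<omega>)) powr \<gamma>)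
        \<le> ennreal (best_return (R \<omega>) powr \<gamma>)" for m
    proof (intro AE_I2 ennreal_leI powr_mono2')
      fix \<omega> assume "\<omega> \<in> space M"
      then show "0 < best_return (R \<omega>)" using R_pos by (intro best_return_pos) auto
      then show "best_return (R \<omega>) \<le> exp (log_distance (R \<omega>) (Q m \<omega>)) * best_return (R \<omega>)"
        using log_distance_nonneg[of "R \<omega>" "Q m \<omega>"] by simp
    qed (use \<gamma>_neg in simp)
    show "AE \<omega> in M. (\<lambda>m. ennreal ((exp (log_distance (R \<omega>) (Q m \<omega>)) * best_return (R \<omega>)) powr \<gamma>))
        \<longlonglongrightarrow> ennreal (best_return (R \<omega>) powr \<gamma>)"
    proof (intro AE_I2 tendsto_ennrealI)
      fix \<omega> assume \<omega>: "\<omega> \<in> space M"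
      have "0 < best_return (R \<omega>)" using R_pos[OF \<omega>] by (intro best_return_pos) auto
      then have "(\<lambda>m. (exp (log_distance (R \<omega>) (Q m \<omega>)) * best_return (R \<omega>)) powr \<gamma>)
          \<longlonglongrightarrow> (exp 0 * best_return (R \<omega>)) powr \<gamma>"
        by (intro tendsto_intros dist_lim \<omega>) auto
      then show "(\<lambda>m. (exp (log_distance (R \<omega>) (Q m \<omega>)) * best_return (R \<omega>)) powr \<gamma>)
          \<longlonglongrightarrow> best_return (R \<omega>) powr \<gamma>" by simp
    qed
  qed (use best_moment_finite in \<open>auto simp: best_moment_def\<close>)
  have best_le: "(\<integral>\<^sup>+\<omega>. ennreal ((exp (log_distance (R \<omega>) (Q m \<omega>)) * best_return (R \<omega>)) powr \<gamma>) \<partial>M)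
      \<le> one_period_market.best_moment M \<gamma> (Q m)" for m
    unfolding one_period_market.best_moment_def[OF Q]
  proof (intro nn_integral_mono ennreal_leI powr_mono2')
    fix \<omega> assume \<omega>: "\<omega> \<in> space M"
    show "0 < best_return (Q m \<omega>)" using Q_pos[OF \<omega>] by (intro best_return_pos) auto
    show "best_return (Q m \<omega>) \<le> exp (log_distance (R \<omega>) (Q m \<omega>)) * best_return (R \<omega>)"
      using Q_pos[OF \<omega>] R_pos[OF \<omega>] by (intro best_return_perturbed) auto
  qed (use \<gamma>_neg in simp)
  obtain b where b: "best_moment = ennreal b" "0 < b"
    using best_moment_pos best_moment_finite by (cases best_moment) (auto simp: ennreal_less_zero_iff)
  have "\<forall>\<^sub>F m in sequentially. ennreal (b / 2) < (\<integral>\<^sup>+\<omega>. ennreal ((exp (log_distance (R \<omega>) (Q m \<omega>)) * best_return (R \<omega>)) powr \<gamma>) \<partial>M)"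
    using b by (intro order_tendstoD[OF best_lim]) (simp add: ennreal_less_iff)
  moreover have "(\<lambda>m. ennreal cost_ratio * moment_error M \<gamma> R (Q m)) \<longlonglongrightarrow> ennreal cost_ratio * 0"
    by (intro tendsto_mult_ennreal tendsto_const error_lim) auto
  then have "\<forall>\<^sub>F m in sequentially. ennreal cost_ratio * moment_error M \<gamma> R (Q m) < ennreal (\<epsilon> * (b / 2))"
    using b \<epsilon> by (intro order_tendstoD) auto
  ultimately have "\<forall>\<^sub>F m in sequentially. \<forall>n. \<forall>x\<in>position_cone.
    optimal_moment M c h \<gamma> (Q m) n x \<le> ennreal ((1 + \<epsilon>) ^ n) * \<U> n x \<and>
    \<U> n x \<le> ennreal ((1 + \<epsilon>) ^ n) * optimal_moment M c h \<gamma> (Q m) n x"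
  proof eventually_elim
    case (elim m)
    interpret P: one_period_market M c h \<gamma> "Q m" by (rule Q)
    have "ennreal cost_ratio * moment_error M \<gamma> R (Q m) \<le> ennreal \<epsilon> * ennreal (b / 2)"
      using elim(2) \<epsilon> by (simp add: ennreal_mult'[symmetric])
    moreover have "ennreal \<epsilon> * ennreal (b / 2) \<le> ennreal \<epsilon> * best_moment"
      using b by (intro mult_left_mono) (auto intro: ennreal_leI)
    moreover have "ennreal \<epsilon> * ennreal (b / 2) \<le> ennreal \<epsilon> * P.best_moment"
      using elim(1) best_le[of m] by (intro mult_left_mono) auto
    ultimately have err: "ennreal cost_ratio * moment_error M \<gamma> R (Q m) \<le> ennreal \<epsilon> * best_moment"
      "ennreal P.cost_ratio * moment_error M \<gamma> (Q m) R \<le> ennreal \<epsilon> * P.best_moment"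
      unfolding moment_error_commute[of M \<gamma> "Q m"] by order+
    show ?case
      using perturbed_optimal_moment_le[OF Q err(1)] \<epsilon>
        P.perturbed_optimal_moment_le[OF one_period_market_axioms err(2)] by auto
  qed
  then show ?thesis
    unfolding Q_def by (rule eventually_sequentially_seg[THEN iffD1])
qed

end

section \<open>The exponential decay rate of the optimal moments\<close>

definition decay_rate :: "(nat \<Rightarrow> ennreal) \<Rightarrow> ereal" where
  "decay_rate u = liminf (\<lambda>n. ereal (- ln (enn2real (u n)) / real n))"

context one_period_market
begin

text \<open>Holding any weights costs at most the factor \<open>cost_ratio * b\<close> per period, and the best returns give
  the corresponding lower bound.\<close>

lemma optimal_moment_geometric_bounds:
  assumes a: "0 < a" "ennreal a \<le> best_moment" and b: "0 \<le> b" "worst_moment \<le> ennreal b"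
    and x: "x \<in> position_cone"
  shows "ennreal (a ^ n * (x \<bullet> 1) powr \<gamma>) \<le> \<U> n x \<and>
    \<U> n x \<le> ennreal ((cost_ratio * b) ^ n * (x \<bullet> 1) powr \<gamma>)"
  using x
proof (induction n arbitrary: x)
  case 0
  then show ?case by (simp add: optimal_moment_0)
next
  case (Suc n)
  let ?L = "a ^ n" and ?H = "(cost_ratio * b) ^ n"
  have LH: "0 \<le> ?L" "0 \<le> ?H" using a b cost_ratio_ge_1 by auto
  have x0: "0 < x \<bullet> 1" using Suc.prems by (simp add: position_cone_def)
  note bounds = one_period_bounds[OF optimal_moment_decreasing[of n] _ Suc.IH[THEN conjunct1] Suc.IH[THEN conjunct2] LH]
  have W: "0 < wealth_after x p" "wealth_after x p \<le> x \<bullet> 1" "min_shrink * (x \<bullet> 1) \<le> wealth_after x p"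
    if "p \<in> weight_simplex" for p
    using rebalanced_wealth_pos rebalanced_wealth_le rebalanced_wealth_ge Suc.prems that by auto
  have "ennreal (a ^ Suc n * (x \<bullet> 1) powr \<gamma>) \<le> \<B> (\<U> n) x"
    unfolding bellman_def
  proof (rule INF_greatest)
    fix p :: "real^'d" assume p: "p \<in> weight_simplex"
    have "(x \<bullet> 1) powr \<gamma> \<le> wealth_after x p powr \<gamma>"
      using W[OF p] \<gamma>_neg by (intro powr_mono2') auto
    moreover have "ennreal ?L * ennreal a \<le> unit_moment (\<U> n) p"
      using bounds(1)[OF p] mult_left_mono[OF a(2), of "ennreal ?L"] by simp
    ultimately have "ennreal ((x \<bullet> 1) powr \<gamma>) * (ennreal ?L * ennreal a)
        \<le> ennreal (wealth_after x p powr \<gamma>) * unit_moment (\<U> n) p"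
      by (intro mult_mono ennreal_leI) auto
    moreover have "ennreal ((x \<bullet> 1) powr \<gamma>) * (ennreal ?L * ennreal a) = ennreal (a ^ Suc n * (x \<bullet> 1) powr \<gamma>)"
      using a by (simp add: mult_ac flip: ennreal_mult')
    ultimately show "ennreal (a ^ Suc n * (x \<bullet> 1) powr \<gamma>) \<le>
        period_moment (\<U> n) x p"
      unfolding period_from_cone[OF optimal_moment_decreasing Suc.prems p] by simp
  qed
  moreover have "\<B> (\<U> n) x \<le> ennreal ((cost_ratio * b) ^ Suc n * (x \<bullet> 1) powr \<gamma>)"
  proof -
    obtain p :: "real^'d" where p: "p \<in> weight_simplex" using simplex_nonempty by blast
    have "wealth_after x p powr \<gamma> \<le> (min_shrink * (x \<bullet> 1)) powr \<gamma>"
      using W[OF p] x0 min_shrink_pos \<gamma>_neg by (intro powr_mono2') auto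
    then have "wealth_after x p powr \<gamma> \<le> cost_ratio * (x \<bullet> 1) powr \<gamma>"
      by (simp add: powr_mult cost_ratio_def)
    moreover have "unit_moment (\<U> n) p \<le> ennreal ?H * ennreal b"
      using bounds(2)[OF p] mult_left_mono[OF b(2), of "ennreal ?H"] by simp
    ultimately have "ennreal (wealth_after x p powr \<gamma>) * unit_moment (\<U> n) p
        \<le> ennreal (cost_ratio * (x \<bullet> 1) powr \<gamma>) * (ennreal ?H * ennreal b)"
      by (intro mult_mono ennreal_leI) auto
    also have "\<dots> = ennreal ((cost_ratio * b) ^ Suc n * (x \<bullet> 1) powr \<gamma>)"
      using b LH cost_ratio_ge_1 by (simp add: mult_ac flip: ennreal_mult)
    finally show ?thesis
      using bellman_le[OF p, of "\<U> n" x] unfolding period_from_cone[OF optimal_moment_decreasing Suc.prems p] by order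
  qed
  ultimately show ?case by (simp only: optimal_moment_Suc)
qed

lemma decay_rate_finite:
  assumes \<pi>: "\<pi> \<in> weight_simplex"
  shows "\<bar>decay_rate (\<lambda>n. \<U> n \<pi>)\<bar> \<noteq> \<infinity>"
proof -
  obtain a where a: "best_moment = ennreal a" "0 < a"
    using best_moment_pos best_moment_finite by (cases best_moment) (auto simp: ennreal_less_zero_iff)
  obtain b' where b': "worst_moment = ennreal b'" "0 \<le> b'"
    using worst_moment_finite by (cases worst_moment) auto
  define b where "b = max 1 b'"
  have b: "1 \<le> b" "worst_moment \<le> ennreal b" by (simp_all add: b_def b')
  have \<pi>': "\<pi> \<in> position_cone" "\<pi> \<bullet> 1 = 1" using \<pi> simplex_subset_cone by (auto simp: weight_simplex_def)
  have "- ln (cost_ratio * b) \<le> - ln (enn2real (\<U> n \<pi>)) / real n \<and> - ln (enn2real (\<U> n \<pi>)) / real n \<le> - ln a"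
    if n: "0 < n" for n
  proof -
    obtain u where u: "\<U> n \<pi> = ennreal u" "0 < u"
      using optimal_moment_finite_pos[OF \<pi>'(1), of n] by (cases "\<U> n \<pi>") (auto simp: ennreal_less_zero_iff)
    have Kb: "0 < cost_ratio * b" using cost_ratio_ge_1 b by (intro mult_pos_pos) auto
    have "a ^ n \<le> u" "u \<le> (cost_ratio * b) ^ n"
      using optimal_moment_geometric_bounds[of a b \<pi> n] a b \<pi>' u Kb by (auto simp: ennreal_le_iff)
    then have "ln (a ^ n) \<le> ln u" "ln u \<le> ln ((cost_ratio * b) ^ n)"
      using a u Kb by (auto intro!: ln_mono)
    then have "real n * ln a \<le> ln u" "ln u \<le> real n * ln (cost_ratio * b)"
      using a Kb by (simp_all only: ln_realpow)
    then show ?thesis using n u by (simp add: field_simps)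
  qed
  then have "ereal (- ln (cost_ratio * b)) \<le> decay_rate (\<lambda>n. \<U> n \<pi>)" "decay_rate (\<lambda>n. \<U> n \<pi>) \<le> ereal (- ln a)"
    unfolding decay_rate_def
    by (auto intro!: Liminf_bounded Liminf_le eventually_mono[OF eventually_gt_at_top[of "0::nat"]])
  then show ?thesis by auto
qed

end

lemma decay_rate_le_perturbed:
  assumes pos: "\<And>n. 0 < u n" "\<And>n. u n < \<infinity>" "\<And>n. 0 < u' n" "\<And>n. u' n < \<infinity>"
    and le: "\<And>n. u' n \<le> ennreal ((1 + \<epsilon>) ^ n) * u n" and \<epsilon>: "0 \<le> \<epsilon>"
  shows "decay_rate u \<le> decay_rate u' + ereal (ln (1 + \<epsilon>))"
proof -
  have step: "- ln (enn2real (u n)) / real n \<le> - ln (enn2real (u' n)) / real n + ln (1 + \<epsilon>)" if n: "0 < n" for n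
  proof -
    obtain v where v: "u n = ennreal v" "0 < v"
      using pos(1,2)[of n] by (cases "u n") (auto simp: ennreal_less_zero_iff)
    obtain v' where v': "u' n = ennreal v'" "0 < v'"
      using pos(3,4)[of n] by (cases "u' n") (auto simp: ennreal_less_zero_iff)
    have "v' \<le> (1 + \<epsilon>) ^ n * v"
      using le[of n] v v' \<epsilon> by (simp add: ennreal_mult'[symmetric])
    then have "ln v' \<le> ln ((1 + \<epsilon>) ^ n * v)" using v' by (intro ln_mono) auto
    also have "\<dots> = real n * ln (1 + \<epsilon>) + ln v" using v \<epsilon> by (simp add: ln_mult ln_realpow)
    finally show ?thesis using n v v' by (simp add: field_simps)
  qed
  have "decay_rate u \<le> liminf (\<lambda>n. ereal (- ln (enn2real (u' n)) / real n) + ereal (ln (1 + \<epsilon>)))"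
    unfolding decay_rate_def
    by (rule Liminf_mono, rule eventually_mono[OF eventually_gt_at_top[of 0]]) (use step in simp)
  also have "\<dots> = decay_rate u' + ereal (ln (1 + \<epsilon>))"
    unfolding decay_rate_def by (rule Liminf_add_ereal_right) auto
  finally show ?thesis .
qed

section \<open>Strategies over independent return periods\<close>

text \<open>Integration over independent \<open>\<sigma>\<close>-algebras: a quantity known from the first one can be frozen while
  the other is integrated out.\<close>

lemma (in prob_space) nn_integral_indep_set:
  assumes indep: "indep_set (sets A) (sets B)"
    and sp: "space A = space M" "space B = space M"
    and X: "X \<in> A \<rightarrow>\<^sub>M S" and Y: "Y \<in> B \<rightarrow>\<^sub>M T"
    and \<phi>: "\<phi> \<in> borel_measurable (S \<Otimes>\<^sub>M T)"
  shows "(\<integral>\<^sup>+\<omega>. \<phi> (X \<omega>, Y \<omega>) \<partial>M) = (\<integral>\<^sup>+\<omega>. \<integral>\<^sup>+y. \<phi> (X \<omega>, y) \<partial>distr M T Y \<partial>M)"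
proof -
  have sub: "subalgebra M A" "subalgebra M B"
    using indep_setD_ev1[OF indep] indep_setD_ev2[OF indep] sp by (simp_all add: subalgebra_def)
  have rv: "X \<in> M \<rightarrow>\<^sub>M S" "Y \<in> M \<rightarrow>\<^sub>M T"
    by (rule measurable_from_subalg[OF sub(1) X], rule measurable_from_subalg[OF sub(2) Y])
  interpret X: prob_space "distr M S X" by (rule prob_space_distr[OF rv(1)])
  interpret Y: prob_space "distr M T Y" by (rule prob_space_distr[OF rv(2)])
  have pair: "(\<lambda>\<omega>. (X \<omega>, Y \<omega>)) \<in> M \<rightarrow>\<^sub>M S \<Otimes>\<^sub>M T" by (rule measurable_Pair[OF rv])
  have joint: "distr M S X \<Otimes>\<^sub>M distr M T Y = distr M (S \<Otimes>\<^sub>M T) (\<lambda>\<omega>. (X \<omega>, Y \<omega>))"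
  proof (rule pair_measure_eqI)
    fix a b assume "a \<in> sets (distr M S X)" "b \<in> sets (distr M T Y)"
    then have ab: "a \<in> sets S" "b \<in> sets T" by simp_all
    have "X -` a \<inter> space M \<in> sets A" "Y -` b \<inter> space M \<in> sets B"
      using measurable_sets[OF X ab(1)] measurable_sets[OF Y ab(2)] by (simp_all add: sp)
    from indep_setD[OF indep this]
    have "prob ((\<lambda>\<omega>. (X \<omega>, Y \<omega>)) -` (a \<times> b) \<inter> space M) = prob (X -` a \<inter> space M) * prob (Y -` b \<inter> space M)"
      by (rule back_subst[of "\<lambda>C. prob C = _"]) auto
    then show "emeasure (distr M S X) a * emeasure (distr M T Y) b =
        emeasure (distr M (S \<Otimes>\<^sub>M T) (\<lambda>\<omega>. (X \<omega>, Y \<omega>))) (a \<times> b)"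
      using ab by (simp add: emeasure_distr[OF rv(1)] emeasure_distr[OF rv(2)] emeasure_distr[OF pair]
          emeasure_eq_measure ennreal_mult')
  qed (simp_all add: X.sigma_finite_measure_axioms Y.sigma_finite_measure_axioms cong: sets_pair_measure_cong)
  have "(\<integral>\<^sup>+\<omega>. \<phi> (X \<omega>, Y \<omega>) \<partial>M) = (\<integral>\<^sup>+z. \<phi> z \<partial>distr M (S \<Otimes>\<^sub>M T) (\<lambda>\<omega>. (X \<omega>, Y \<omega>)))"
    by (rule nn_integral_distr[symmetric, OF pair]) (simp add: \<phi>)
  also have "\<dots> = (\<integral>\<^sup>+x. \<integral>\<^sup>+y. \<phi> (x, y) \<partial>distr M T Y \<partial>distr M S X)"
    unfolding joint[symmetric]
    by (rule Y.nn_integral_fst[symmetric])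
       (subst measurable_cong_sets[OF sets_pair_measure_cong[OF sets_distr sets_distr] refl], rule \<phi>)
  also have "\<dots> = (\<integral>\<^sup>+\<omega>. \<integral>\<^sup>+y. \<phi> (X \<omega>, y) \<partial>distr M T Y \<partial>M)"
    by (rule nn_integral_distr[OF rv(1)], rule Y.borel_measurable_nn_integral_fst)
       (subst measurable_cong_sets[OF sets_pair_measure_cong[OF sets_distr sets_distr] refl], rule \<phi>)
  finally show ?thesis .
qed

lemma position_cone_borel: "position_cone \<in> sets (borel :: (real^'d) measure)"
proof -
  have "position_cone = {x::real^'d. (\<forall>i\<in>UNIV. 0 \<le> x $ i) \<and> 0 < x \<bullet> 1}"
    by (auto simp: position_cone_def)
  also have "\<dots> \<in> sets borel" by measurable
  finally show ?thesis .
qed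

locale return_periods = one_period_market M c h \<gamma> "Rk 0"
  for M :: "'w measure" and c h :: "real^'d" and \<gamma> :: real and Rk :: "nat \<Rightarrow> 'w \<Rightarrow> real^'d" +
  fixes G :: "nat \<Rightarrow> 'w measure"
  assumes subalgebra: "\<And>n. subalgebra M (G n)"
    and filtration: "\<And>n. sets (G n) \<subseteq> sets (G (Suc n))"
    and Rk_pos: "\<And>n \<omega> i. \<omega> \<in> space M \<Longrightarrow> 0 < Rk n \<omega> $ i"
    and Rk_adapted: "\<And>n. Rk n \<in> borel_measurable (G (Suc n))"
    and Rk_law: "\<And>n. distr M borel (Rk n) = distr M borel (Rk 0)"
    and Rk_indep: "\<And>n. indep_set (sets (G n)) (sets (vimage_algebra (space M) (Rk n) borel))"
begin

lemma space_G [simp]: "space (G n) = space M"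
  using subalgebra[of n] by (simp add: subalgebra_def)

lemma G_le_M: "X \<in> G n \<rightarrow>\<^sub>M N \<Longrightarrow> X \<in> M \<rightarrow>\<^sub>M N"
  using measurable_from_subalg[OF subalgebra] .

lemma G_Suc: "X \<in> G n \<rightarrow>\<^sub>M N \<Longrightarrow> X \<in> G (Suc n) \<rightarrow>\<^sub>M N"
  using filtration[of n] by (intro measurable_from_subalg[of "G (Suc n)" "G n"]) (simp_all add: subalgebra_def)

lemma Rk_measurable [measurable]: "Rk n \<in> borel_measurable M"
  using Rk_adapted by (rule G_le_M)

lemma nn_integral_next_period:
  assumes f: "cone_decreasing \<gamma> f" and Y: "Y \<in> borel_measurable (G n)"
    and cone: "\<And>\<omega>. \<omega> \<in> space M \<Longrightarrow> Y \<omega> \<in> position_cone"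
  shows "(\<integral>\<^sup>+\<omega>. f (Y \<omega> * Rk n \<omega>) \<partial>M) = (\<integral>\<^sup>+\<omega>. \<integral>\<^sup>+\<omega>'. f (Y \<omega> * Rk 0 \<omega>') \<partial>M \<partial>M)"
proof -
  define f0 where "f0 x = f x * indicator position_cone x" for x
  have "(\<lambda>x. x) \<in> restrict_space borel (position_cone :: (real^'d) set) \<rightarrow>\<^sub>M borel"
    by (rule measurable_restrict_space1) simp
  from borel_measurable_cone_decreasing[OF f this]
  have "f \<in> borel_measurable (restrict_space borel position_cone)"
    by (simp add: space_restrict_space)
  then have f0: "f0 \<in> borel_measurable borel"
    unfolding f0_def[abs_def]
    using borel_measurable_restrict_space_iff_ennreal[of position_cone borel f] position_cone_borel by simp
  have "(\<lambda>z. fst z * snd z) \<in> borel_measurable (borel \<Otimes>\<^sub>M (borel :: (real^'d) measure))"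
    by (rule borel_measurable_vec_mult[OF measurable_fst measurable_snd])
  from measurable_compose[OF this f0]
  have f0_mult: "(\<lambda>(y, r). f0 (y * r)) \<in> borel_measurable (borel \<Otimes>\<^sub>M borel)"
    by (simp add: case_prod_beta')
  have cone_Rk: "Y \<omega> * Rk k \<omega>' \<in> position_cone" if "\<omega> \<in> space M" "\<omega>' \<in> space M" for \<omega> \<omega>' k
    by (rule position_cone_mult[OF cone[OF that(1)] Rk_pos[OF that(2)]])
  have "(\<integral>\<^sup>+\<omega>. f (Y \<omega> * Rk n \<omega>) \<partial>M) = (\<integral>\<^sup>+\<omega>. (\<lambda>(y, r). f0 (y * r)) (Y \<omega>, Rk n \<omega>) \<partial>M)"
    by (rule nn_integral_cong) (simp add: f0_def cone_Rk)
  also have "\<dots> = (\<integral>\<^sup>+\<omega>. \<integral>\<^sup>+r. (\<lambda>(y, r). f0 (y * r)) (Y \<omega>, r) \<partial>distr M borel (Rk n) \<partial>M)"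
    by (rule nn_integral_indep_set[OF Rk_indep[of n] space_G space_vimage_algebra Y measurable_vimage_algebra1 f0_mult]) simp
  also have "\<dots> = (\<integral>\<^sup>+\<omega>. \<integral>\<^sup>+r. f0 (Y \<omega> * r) \<partial>distr M borel (Rk 0) \<partial>M)"
    unfolding Rk_law[of n] by simp
  also have "\<dots> = (\<integral>\<^sup>+\<omega>. \<integral>\<^sup>+\<omega>'. f (Y \<omega> * Rk 0 \<omega>') \<partial>M \<partial>M)"
  proof (rule nn_integral_cong)
    fix \<omega> assume \<omega>: "\<omega> \<in> space M"
    have "(\<integral>\<^sup>+r. f0 (Y \<omega> * r) \<partial>distr M borel (Rk 0)) = (\<integral>\<^sup>+\<omega>'. f0 (Y \<omega> * Rk 0 \<omega>') \<partial>M)"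
      by (rule nn_integral_distr[OF Rk_measurable])
         (use measurable_Pair2[OF f0_mult, of "Y \<omega>"] in simp)
    also have "\<dots> = (\<integral>\<^sup>+\<omega>'. f (Y \<omega> * Rk 0 \<omega>') \<partial>M)"
      using \<omega> by (intro nn_integral_cong) (simp only: f0_def cone_Rk indicator_simps mult_1_right)
    finally show "(\<integral>\<^sup>+r. f0 (Y \<omega> * r) \<partial>distr M borel (Rk 0)) = (\<integral>\<^sup>+\<omega>'. f (Y \<omega> * Rk 0 \<omega>') \<partial>M)" .
  qed
  finally show ?thesis .
qed

text \<open>The position before the \<open>n\<close>-th rebalancing when \<open>p n\<close> are the weights chosen there.\<close>

primrec position :: "real^'d \<Rightarrow> (nat \<Rightarrow> 'w \<Rightarrow> real^'d) \<Rightarrow> nat \<Rightarrow> 'w \<Rightarrow> real^'d" where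
  "position \<pi> p 0 \<omega> = \<pi>"
| "position \<pi> p (Suc n) \<omega> = wealth_after (position \<pi> p n \<omega>) (p n \<omega>) *\<^sub>R (p n \<omega> * Rk n \<omega>)"

context
  fixes \<pi> :: "real^'d" and p :: "nat \<Rightarrow> 'w \<Rightarrow> real^'d"
  assumes \<pi>: "\<pi> \<in> weight_simplex"
    and p_adapted: "\<And>n. p n \<in> borel_measurable (G n)"
    and p_simplex: "\<And>n \<omega>. \<omega> \<in> space M \<Longrightarrow> p n \<omega> \<in> weight_simplex"
begin

lemma position_cone: "\<omega> \<in> space M \<Longrightarrow> position \<pi> p n \<omega> \<in> position_cone"
proof (induction n)
  case 0
  then show ?case using \<pi> simplex_subset_cone by auto
next
  case (Suc n)
  have "p n \<omega> * Rk n \<omega> \<in> position_cone"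
    using p_simplex[OF Suc.prems] simplex_subset_cone Suc.prems by (intro position_cone_mult Rk_pos) auto
  then show ?case
    using Suc p_simplex by (simp add: position_cone_scale rebalanced_wealth_pos)
qed

lemma position_adapted: "position \<pi> p n \<in> borel_measurable (G n)"
proof (induction n)
  case 0
  then show ?case by simp
next
  case (Suc n)
  have "(\<lambda>\<omega>. wealth_after (position \<pi> p n \<omega>) (p n \<omega>)) \<in> borel_measurable (G n)"
    by (rule borel_measurable_rebalanced_wealth[OF Suc p_adapted]) (auto simp: position_cone p_simplex)
  note [measurable] = this[THEN G_Suc] p_adapted[THEN G_Suc] Rk_adapted[of n]
  show ?case by simp
qed

text \<open>The wealth after the rebalancing is known at its time, and the next return is a fresh copy.\<close>

lemma nn_integral_position_Suc:
  assumes f: "cone_decreasing \<gamma> f"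
  shows "(\<integral>\<^sup>+\<omega>. f (position \<pi> p (Suc n) \<omega>) \<partial>M) =
    (\<integral>\<^sup>+\<omega>. \<integral>\<^sup>+\<omega>'. f (wealth_after (position \<pi> p n \<omega>) (p n \<omega>) *\<^sub>R (p n \<omega> * Rk 0 \<omega>')) \<partial>M \<partial>M)"
proof -
  define Y where "Y \<omega> = wealth_after (position \<pi> p n \<omega>) (p n \<omega>) *\<^sub>R p n \<omega>" for \<omega>
  have mult: "a *\<^sub>R (x * y) = (a *\<^sub>R x) * y" for a and x y :: "real^'d"
    by (simp add: vec_eq_iff)
  have "(\<lambda>\<omega>. wealth_after (position \<pi> p n \<omega>) (p n \<omega>)) \<in> borel_measurable (G n)"
    by (rule borel_measurable_rebalanced_wealth[OF position_adapted p_adapted])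
       (auto simp: position_cone p_simplex)
  then have Y: "Y \<in> borel_measurable (G n)"
    unfolding Y_def[abs_def] by (rule borel_measurable_scaleR[OF _ p_adapted])
  have cone: "Y \<omega> \<in> position_cone" if "\<omega> \<in> space M" for \<omega>
  proof -
    have "p n \<omega> \<in> position_cone" using p_simplex[OF that] simplex_subset_cone by blast
    then show ?thesis
      unfolding Y_def by (rule position_cone_scale) (rule rebalanced_wealth_pos[OF position_cone[OF that] p_simplex[OF that]])
  qed
  show ?thesis
    using nn_integral_next_period[OF f Y cone] unfolding Y_def mult position.simps by simp
qed

text \<open>The optimal moment is a lower bound for every strategy: by the definition of the operator,
  replacing one period of optimal investment by one period of the strategy can only increase it.\<close>

lemma optimal_moment_le_position:
  "\<U> (n + k) \<pi> \<le> (\<integral>\<^sup>+\<omega>. \<U> k (position \<pi> p n \<omega>) \<partial>M)"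
proof (induction n arbitrary: k)
  case 0
  then show ?case by (simp add: emeasure_space_1)
next
  case (Suc n)
  have "\<U> (Suc n + k) \<pi> \<le> (\<integral>\<^sup>+\<omega>. \<U> (Suc k) (position \<pi> p n \<omega>) \<partial>M)"
    using Suc[of "Suc k"] by simp
  also have "\<dots> \<le> (\<integral>\<^sup>+\<omega>. \<integral>\<^sup>+\<omega>'. \<U> k (wealth_after (position \<pi> p n \<omega>) (p n \<omega>) *\<^sub>R (p n \<omega> * Rk 0 \<omega>')) \<partial>M \<partial>M)"
    unfolding optimal_moment_Suc by (intro nn_integral_mono bellman_le p_simplex)
  also have "\<dots> = (\<integral>\<^sup>+\<omega>. \<U> k (position \<pi> p (Suc n) \<omega>) \<partial>M)"
    by (rule nn_integral_position_Suc[OF optimal_moment_decreasing, symmetric])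
  finally show ?case .
qed

corollary optimal_moment_le_strategy:
  "\<U> n \<pi> \<le> (\<integral>\<^sup>+\<omega>. ennreal ((position \<pi> p n \<omega> \<bullet> 1) powr \<gamma>) \<partial>M)"
  using optimal_moment_le_position[of n 0] by (simp add: optimal_moment_0)

lemma strategy_growth_le:
  assumes f: "cone_decreasing \<gamma> f"
    and step: "\<And>n \<omega>. \<omega> \<in> space M \<Longrightarrow>
      (\<integral>\<^sup>+\<omega>'. f (wealth_after (position \<pi> p n \<omega>) (p n \<omega>) *\<^sub>R (p n \<omega> * Rk 0 \<omega>')) \<partial>M)
        \<le> ennreal (exp \<rho>) * f (position \<pi> p n \<omega>)"
  shows "(\<integral>\<^sup>+\<omega>. f (position \<pi> p n \<omega>) \<partial>M) \<le> ennreal (exp (\<rho> * n)) * f \<pi>"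
proof (induction n)
  case 0
  then show ?case by (simp add: emeasure_space_1)
next
  case (Suc n)
  have "(\<integral>\<^sup>+\<omega>. f (position \<pi> p (Suc n) \<omega>) \<partial>M) \<le> (\<integral>\<^sup>+\<omega>. ennreal (exp \<rho>) * f (position \<pi> p n \<omega>) \<partial>M)"
    unfolding nn_integral_position_Suc[OF f] by (intro nn_integral_mono step)
  also have "\<dots> = ennreal (exp \<rho>) * (\<integral>\<^sup>+\<omega>. f (position \<pi> p n \<omega>) \<partial>M)"
    using position_adapted G_le_M position_cone
    by (intro nn_integral_cmult borel_measurable_cone_decreasing[OF f]) auto
  also have "\<dots> \<le> ennreal (exp \<rho>) * (ennreal (exp (\<rho> * n)) * f \<pi>)"
    by (intro mult_left_mono Suc) auto
  also have "\<dots> = ennreal (exp (\<rho> * Suc n)) * f \<pi>"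
    by (simp add: distrib_left add.commute exp_add ennreal_mult' mult.assoc)
  finally show ?case .
qed

end

end

section \<open>Returns between intervention times\<close>

text \<open>A right-continuous process at a random time is the limit of its values at approximations of this
  time from the right that take countably many values.\<close>

lemma borel_measurable_at_random_time:
  fixes Y :: "real \<Rightarrow> 'a \<Rightarrow> 'b::metric_space"
  assumes Y: "\<And>t. 0 \<le> t \<Longrightarrow> Y t \<in> borel_measurable N"
    and right: "\<And>t \<omega>. \<omega> \<in> space N \<Longrightarrow> 0 \<le> t \<Longrightarrow> ((\<lambda>u. Y u \<omega>) \<longlongrightarrow> Y t \<omega>) (at_right t)"
    and T [measurable]: "T \<in> borel_measurable N" and T_nonneg: "\<And>\<omega>. \<omega> \<in> space N \<Longrightarrow> 0 \<le> T \<omega>"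
  shows "(\<lambda>\<omega>. Y (T \<omega>) \<omega>) \<in> borel_measurable N"
proof -
  define j where "j k \<omega> = nat \<lfloor>real (Suc k) * T \<omega>\<rfloor>" for k \<omega>
  define t where "t k i = (real i + 1) / real (Suc k)" for k i
  have [measurable]: "j k \<in> N \<rightarrow>\<^sub>M count_space UNIV" for k unfolding j_def[abs_def] by measurable
  have t_bounds: "T \<omega> < t k (j k \<omega>)" "t k (j k \<omega>) \<le> T \<omega> + 1 / real (Suc k)" if "\<omega> \<in> space N" for k \<omega>
  proof -
    have "real (j k \<omega>) = of_int \<lfloor>real (Suc k) * T \<omega>\<rfloor>"
      unfolding j_def using T_nonneg[OF that] by simp
    then have "real (j k \<omega>) \<le> real (Suc k) * T \<omega>" "real (Suc k) * T \<omega> < real (j k \<omega>) + 1"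
      by linarith+
    then show "T \<omega> < t k (j k \<omega>)" "t k (j k \<omega>) \<le> T \<omega> + 1 / real (Suc k)"
      unfolding t_def by (simp_all add: field_simps del: of_nat_Suc)
  qed
  show ?thesis
  proof (rule borel_measurable_LIMSEQ_metric)
    show "(\<lambda>\<omega>. Y (t k (j k \<omega>)) \<omega>) \<in> borel_measurable N" for k
    proof (rule measurable_compose_countable[where g = "j k"])
      show "Y (t k i) \<in> borel_measurable N" for i by (rule Y) (simp add: t_def)
    qed measurable
    fix \<omega> assume \<omega>: "\<omega> \<in> space N"
    have "filterlim (\<lambda>k. t k (j k \<omega>)) (at_right (T \<omega>)) sequentially"
      unfolding filterlim_at
    proof
      show "\<forall>\<^sub>F k in sequentially. t k (j k \<omega>) \<in> {T \<omega><..} \<and> t k (j k \<omega>) \<noteq> T \<omega>"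
        using t_bounds(1)[OF \<omega>] by (intro always_eventually allI) (metis greaterThan_iff less_irrefl)
      have upper: "(\<lambda>k. T \<omega> + 1 / real (Suc k)) \<longlonglongrightarrow> T \<omega>"
        using tendsto_add[OF tendsto_const LIMSEQ_Suc[OF lim_1_over_n]] by fastforce
      show "(\<lambda>k. t k (j k \<omega>)) \<longlonglongrightarrow> T \<omega>"
        by (rule tendsto_sandwich[OF always_eventually always_eventually tendsto_const upper])
           (use t_bounds[OF \<omega>] in \<open>blast intro: less_imp_le\<close>)+
    qed
    from filterlim_compose[OF right[OF \<omega> T_nonneg[OF \<omega>]] this]
    show "(\<lambda>k. Y (t k (j k \<omega>)) \<omega>) \<longlonglongrightarrow> Y (T \<omega>) \<omega>" .
  qed
qed

lemma intervention_time_0 [simp]: "intervention_time \<zeta> 0 \<omega> = 0"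
  and intervention_time_Suc: "intervention_time \<zeta> (Suc n) \<omega> = intervention_time \<zeta> n \<omega> + \<zeta> (Suc n) \<omega>"
  by (simp_all add: intervention_time_def)

text \<open>The waiting times are \<open>D (\<eta> i)\<close>: the identity and the dyadic rounding are the cases of
  interest.\<close>

locale market = proportional_costs c h + prob_space M
  for M :: "'w measure" and c h :: "real^'d" +
  fixes S :: "real \<Rightarrow> 'w \<Rightarrow> real^'d" and \<eta> :: "nat \<Rightarrow> 'w \<Rightarrow> real" and D :: "real \<Rightarrow> real"
  assumes prices: "price_process M S"
    and \<eta>_iid: "waiting_times M \<eta>"
    and \<eta>_indep: "indep_of_prices M \<eta> S"
    and increments: "increments_cond M S"
    and D_measurable [measurable]: "D \<in> borel_measurable borel"
    and D_pos: "\<And>x. 0 < x \<Longrightarrow> 0 < D x"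
begin

definition wait :: "nat \<Rightarrow> 'w \<Rightarrow> real" where "wait i \<omega> = D (\<eta> i \<omega>)"

abbreviation \<tau> :: "nat \<Rightarrow> 'w \<Rightarrow> real" where "\<tau> \<equiv> intervention_time wait"

lemma S_measurable [measurable]: "0 \<le> t \<Longrightarrow> S t \<in> borel_measurable M"
  and S_pos: "0 \<le> t \<Longrightarrow> \<omega> \<in> space M \<Longrightarrow> 0 < S t \<omega> $ i"
  using prices by (auto simp: price_process_def)

lemma \<eta>_measurable [measurable]: "1 \<le> i \<Longrightarrow> \<eta> i \<in> borel_measurable M"
  and \<eta>_pos: "1 \<le> i \<Longrightarrow> \<omega> \<in> space M \<Longrightarrow> 0 < \<eta> i \<omega>"
  and \<eta>_law: "1 \<le> i \<Longrightarrow> distr M borel (\<eta> i) = distr M borel (\<eta> 1)"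
  using \<eta>_iid unfolding waiting_times_def indep_vars_def by (meson atLeast_iff)+

lemma wait_pos: "1 \<le> i \<Longrightarrow> \<omega> \<in> space M \<Longrightarrow> 0 < wait i \<omega>"
  by (simp add: wait_def D_pos \<eta>_pos)

lemma wait_measurable [measurable]: "1 \<le> i \<Longrightarrow> wait i \<in> borel_measurable M"
  unfolding wait_def[abs_def] by measurable

lemma wait_law:
  assumes "1 \<le> i" shows "distr M borel (wait i) = distr M borel (wait 1)"
proof -
  have "distr M borel (wait k) = distr (distr M borel (\<eta> k)) borel D" if "1 \<le> k" for k
    using distr_distr[OF D_measurable \<eta>_measurable[OF that]] by (simp add: wait_def[abs_def] o_def)
  then have "distr M borel (wait i) = distr (distr M borel (\<eta> i)) borel D"
      "distr M borel (wait 1) = distr (distr M borel (\<eta> 1)) borel D"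
    using assms by blast+
  then show ?thesis by (simp only: \<eta>_law[OF assms])
qed

lemma \<tau>_nonneg: "\<omega> \<in> space M \<Longrightarrow> 0 \<le> \<tau> n \<omega>"
  unfolding intervention_time_def by (rule sum_nonneg) (use wait_pos[THEN less_imp_le] in auto)

lemma \<tau>_less_Suc: "\<omega> \<in> space M \<Longrightarrow> \<tau> n \<omega> < \<tau> (Suc n) \<omega>"
  using wait_pos[of "Suc n" \<omega>] by (simp add: intervention_time_Suc)

lemma price_right_limit:
  assumes \<omega>: "\<omega> \<in> space M" and t: "0 \<le> t"
  shows "((\<lambda>u. S u \<omega>) \<longlongrightarrow> S t \<omega>) (at_right t)"
proof (rule vec_tendstoI)
  fix i
  have "continuous (at_right t) (\<lambda>u. log_price S u \<omega>)"
    using increments \<omega> t by (auto simp: increments_cond_def)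
  then have "((\<lambda>u. exp (log_price S u \<omega> $ i)) \<longlongrightarrow> exp (log_price S t \<omega> $ i)) (at_right t)"
    unfolding continuous_within by (intro tendsto_exp tendsto_vec_nth)
  moreover have "exp (log_price S u \<omega> $ i) = S u \<omega> $ i" if "0 \<le> u" for u
    using S_pos[OF that \<omega>] by (simp add: log_price_def)
  moreover have "\<forall>\<^sub>F u in at_right t. 0 \<le> u"
    using t by (auto simp: eventually_at_right_less eventually_at_filter intro!: always_eventually)
  ultimately show "((\<lambda>u. S u \<omega> $ i) \<longlongrightarrow> S t \<omega> $ i) (at_right t)"
    using t by (auto elim!: Lim_transform_eventually eventually_mono)
qed

definition period_return :: "nat \<Rightarrow> 'w \<Rightarrow> real^'d" where
  "period_return n \<omega> = returns S (\<tau> n \<omega>) (\<tau> (Suc n) \<omega>) \<omega>"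

lemma returns_pos: "0 \<le> s \<Longrightarrow> 0 \<le> t \<Longrightarrow> \<omega> \<in> space M \<Longrightarrow> 0 < returns S s t \<omega> $ i"
  by (simp add: returns_def S_pos)

lemma period_return_pos: "\<omega> \<in> space M \<Longrightarrow> 0 < period_return n \<omega> $ i"
  by (simp add: period_return_def returns_pos \<tau>_nonneg)

lemma returns_right_limit:
  assumes \<omega>: "\<omega> \<in> space M" and s: "0 \<le> s" and t: "0 \<le> t"
  shows "((\<lambda>u. returns S s (s + u) \<omega>) \<longlongrightarrow> returns S s (s + t) \<omega>) (at_right t)"
  unfolding returns_def
proof (intro vec_tendstoI, unfold vec_lambda_beta, rule tendsto_divide[OF _ tendsto_const])
  fix i
  have "filterlim (\<lambda>u. s + u) (at_right (s + t)) (at_right t)"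
    unfolding filterlim_at by (auto simp: eventually_at_filter intro!: tendsto_intros)
  from filterlim_compose[OF price_right_limit[OF \<omega>, of "s + t"] this]
  show "((\<lambda>u. S (s + u) \<omega> $ i) \<longlongrightarrow> S (s + t) \<omega> $ i) (at_right t)"
    using s t by (intro tendsto_vec_nth) auto
  show "S s \<omega> $ i \<noteq> 0" using S_pos[OF s \<omega>, of i] by simp
qed

subsection \<open>The information at the intervention times\<close>

context
  fixes G :: "nat \<Rightarrow> 'w measure"
  assumes info: "information M S wait G"
begin

lemma space_info: "space (G n) = space M"
  using info by (simp add: information_def subalgebra_def)

text \<open>Along integer times the price stopped at \<open>\<tau> n\<close> is eventually constant.\<close>

lemma price_at_\<tau>_adapted: "(\<lambda>\<omega>. S (\<tau> n \<omega>) \<omega>) \<in> borel_measurable (G n)"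
proof (rule borel_measurable_LIMSEQ_metric)
  show "(\<lambda>\<omega>. S (min (real k) (\<tau> n \<omega>)) \<omega>) \<in> borel_measurable (G n)" for k
    using info by (simp add: information_def)
  fix \<omega> assume "\<omega> \<in> space (G n)"
  have "\<forall>\<^sub>F k in sequentially. \<tau> n \<omega> \<le> real k"
    using filterlim_real_sequentially unfolding filterlim_at_top by blast
  then have "\<forall>\<^sub>F k in sequentially. S (min (real k) (\<tau> n \<omega>)) \<omega> = S (\<tau> n \<omega>) \<omega>"
    by eventually_elim (simp add: min_absorb2)
  then show "(\<lambda>k. S (min (real k) (\<tau> n \<omega>)) \<omega>) \<longlonglongrightarrow> S (\<tau> n \<omega>) \<omega>"
    by (rule tendsto_eventually)
qed

lemma period_return_adapted: "period_return n \<in> borel_measurable (G (Suc n))"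
proof -
  have "sets (G n) \<subseteq> sets (G (Suc n))" using info by (simp add: information_def)
  then have "subalgebra (G (Suc n)) (G n)" by (simp add: subalgebra_def space_info)
  from measurable_from_subalg[OF this price_at_\<tau>_adapted]
  have "(\<lambda>\<omega>. S (\<tau> n \<omega>) \<omega>) \<in> borel_measurable (G (Suc n))" .
  with price_at_\<tau>_adapted[of "Suc n"]
  have "(\<lambda>\<omega>. S (\<tau> n \<omega>) \<omega> $ i) \<in> borel_measurable (G (Suc n))"
    "(\<lambda>\<omega>. S (\<tau> (Suc n) \<omega>) \<omega> $ i) \<in> borel_measurable (G (Suc n))" for i
    by (simp_all add: borel_measurable_vec_iff)
  then show ?thesis
    unfolding period_return_def[abs_def] returns_def borel_measurable_vec_iff vec_lambda_beta
    by (intro allI borel_measurable_divide)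
qed

text \<open>The return over the next period is the path of future returns, evaluated at the next waiting time.
  Both belong to the \<open>\<sigma>\<close>-algebra that is independent of the present information.\<close>

lemma period_return_indep:
  "indep_set (sets (G n)) (sets (vimage_algebra (space M) (period_return n) borel))"
proof -
  define path where "path \<omega> = (\<lambda>k\<in>{n<..}. wait k \<omega>, \<lambda>t\<in>{0..}. returns S (\<tau> n \<omega>) (\<tau> n \<omega> + t) \<omega>)" for \<omega>
  define N where "N = ((\<Pi>\<^sub>M k\<in>{n<..}. borel) \<Otimes>\<^sub>M (\<Pi>\<^sub>M t\<in>{0..}. borel) :: ((nat \<Rightarrow> real) \<times> (real \<Rightarrow> real^'d)) measure)"
  define F where "F = vimage_algebra (space M) path N"
  have indep: "indep_set (sets (G n)) (sets F)"
    using info by (simp add: information_def F_def N_def path_def[abs_def])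
  have space_F: "space F = space M" by (simp add: F_def)
  have path: "path \<in> F \<rightarrow>\<^sub>M N"
    unfolding F_def by (rule measurable_vimage_algebra1) (auto simp: path_def N_def space_pair_measure space_PiM)
  have fst_path: "(\<lambda>\<omega>. fst (path \<omega>)) \<in> F \<rightarrow>\<^sub>M (\<Pi>\<^sub>M k\<in>{n<..}. borel)"
    using measurable_compose[OF path[unfolded N_def] measurable_fst] .
  have snd_path: "(\<lambda>\<omega>. snd (path \<omega>)) \<in> F \<rightarrow>\<^sub>M (\<Pi>\<^sub>M t\<in>{0..}. borel)"
    using measurable_compose[OF path[unfolded N_def] measurable_snd] .
  have "(\<lambda>\<omega>. fst (path \<omega>) (Suc n)) \<in> borel_measurable F"
    by (rule measurable_compose[OF fst_path measurable_component_singleton]) simp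
  then have wait: "wait (Suc n) \<in> borel_measurable F" by (simp add: path_def)
  have ret: "(\<lambda>\<omega>. returns S (\<tau> n \<omega>) (\<tau> n \<omega> + t) \<omega>) \<in> borel_measurable F" if "0 \<le> t" for t
  proof -
    have "(\<lambda>\<omega>. snd (path \<omega>) t) \<in> borel_measurable F"
      by (rule measurable_compose[OF snd_path measurable_component_singleton]) (use that in simp)
    then show ?thesis using that by (simp add: path_def)
  qed
  have "(\<lambda>\<omega>. returns S (\<tau> n \<omega>) (\<tau> n \<omega> + wait (Suc n) \<omega>) \<omega>) \<in> borel_measurable F"
  proof (rule borel_measurable_at_random_time[where Y = "\<lambda>t \<omega>. returns S (\<tau> n \<omega>) (\<tau> n \<omega> + t) \<omega>", OF ret _ wait])
    show "((\<lambda>u. returns S (\<tau> n \<omega>) (\<tau> n \<omega> + u) \<omega>) \<longlongrightarrow> returns S (\<tau> n \<omega>) (\<tau> n \<omega> + t) \<omega>) (at_right t)"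
      if "\<omega> \<in> space F" "0 \<le> t" for t \<omega>
      using that by (intro returns_right_limit \<tau>_nonneg) (auto simp: space_F)
    show "0 \<le> wait (Suc n) \<omega>" if "\<omega> \<in> space F" for \<omega>
      using wait_pos[of "Suc n" \<omega>] that by (simp add: space_F)
  qed
  then have "period_return n \<in> borel_measurable F"
    by (simp add: period_return_def[abs_def] intervention_time_Suc)
  then have sub: "sets (vimage_algebra (space M) (period_return n) borel) \<subseteq> sets F"
    by (rule sets_image_in_sets[OF space_F])
  show ?thesis
    unfolding indep_set_def
  proof (rule indep_sets_mono_sets[OF indep[unfolded indep_set_def]])
    show "(case i of True \<Rightarrow> sets (G n) | False \<Rightarrow> sets (vimage_algebra (space M) (period_return n) borel))
      \<subseteq> (case i of True \<Rightarrow> sets (G n) | False \<Rightarrow> sets F)" for i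
      using sub by (cases i) simp_all
  qed
qed

end

lemma log_price_measurable: "0 \<le> t \<Longrightarrow> log_price S t \<in> borel_measurable M"
  unfolding log_price_def[abs_def] borel_measurable_vec_iff vec_lambda_beta
  using S_measurable[of t] by (intro allI borel_measurable_ln) (simp add: borel_measurable_vec_iff)

text \<open>Returns are exponentials of the increments of the logarithmic prices.\<close>

lemma returns_stationary:
  assumes g: "g \<in> borel_measurable borel" and s: "0 \<le> s" and t: "0 \<le> t"
  shows "(\<integral>\<^sup>+\<omega>. g (returns S s (s + t) \<omega>) \<partial>M) = (\<integral>\<^sup>+\<omega>. g (returns S 0 t \<omega>) \<partial>M)"
proof -
  define e where "e x = (\<chi> i. exp (x $ i))" for x :: "real^'d"
  have "e \<in> borel_measurable borel"
    unfolding e_def[abs_def] borel_measurable_vec_iff vec_lambda_beta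
    by (intro allI measurable_compose[OF borel_measurable_nth borel_measurable_exp])
  from measurable_compose[OF this g] have ge: "(\<lambda>x. g (e x)) \<in> borel_measurable borel" .
  have eq: "(\<integral>\<^sup>+\<omega>. g (returns S u v \<omega>) \<partial>M)
      = (\<integral>\<^sup>+x. g (e x) \<partial>distr M borel (\<lambda>\<omega>. log_price S v \<omega> - log_price S u \<omega>))" if "0 \<le> u" "0 \<le> v" for u v
  proof -
    have "returns S u v \<omega> = e (log_price S v \<omega> - log_price S u \<omega>)" if "\<omega> \<in> space M" for \<omega>
      using S_pos[OF \<open>0 \<le> u\<close> that] S_pos[OF \<open>0 \<le> v\<close> that]
      by (simp add: e_def returns_def log_price_def vec_eq_iff exp_diff)
    then have "(\<integral>\<^sup>+\<omega>. g (returns S u v \<omega>) \<partial>M) = (\<integral>\<^sup>+\<omega>. g (e (log_price S v \<omega> - log_price S u \<omega>)) \<partial>M)"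
      by (simp cong: nn_integral_cong)
    also have "\<dots> = (\<integral>\<^sup>+x. g (e x) \<partial>distr M borel (\<lambda>\<omega>. log_price S v \<omega> - log_price S u \<omega>))"
      by (rule nn_integral_distr[symmetric])
         (rule borel_measurable_diff[OF log_price_measurable[OF that(2)] log_price_measurable[OF that(1)]],
          simp add: ge)
    finally show ?thesis .
  qed
  have "distr M borel (\<lambda>\<omega>. log_price S (s + t) \<omega> - log_price S s \<omega>) = distr M borel (\<lambda>\<omega>. log_price S t \<omega> - log_price S 0 \<omega>)"
    using increments s t unfolding increments_cond_def stationary_increments_def by blast
  then show ?thesis using eq[of s "s + t"] eq[of 0 t] s t by simp
qed

text \<open>Conditionally on the waiting times, which are independent of the prices, the law of a return
  depends on the length of the period only.\<close>

lemma nn_integral_period_return: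
  assumes g: "g \<in> borel_measurable borel"
  shows "(\<integral>\<^sup>+\<omega>. g (period_return n \<omega>) \<partial>M) = (\<integral>\<^sup>+\<omega>. g (period_return 0 \<omega>) \<partial>M)"
proof -
  define WF where "WF = vimage_algebra (space M) (\<lambda>\<omega>. \<lambda>i\<in>{1..}. \<eta> i \<omega>) (\<Pi>\<^sub>M i\<in>{1..}. (borel :: real measure))"
  define PF where "PF = vimage_algebra (space M) (\<lambda>\<omega>. \<lambda>t\<in>{0..}. S t \<omega>) (\<Pi>\<^sub>M t\<in>{0..}. (borel :: (real^'d) measure))"
  have indep: "indep_set (sets WF) (sets PF)"
    using \<eta>_indep by (simp only: indep_of_prices_def WF_def PF_def)
  have space_F: "space WF = space M" "space PF = space M" by (simp_all add: WF_def PF_def)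
  have wf: "(\<lambda>\<omega>. \<lambda>i\<in>{1..}. \<eta> i \<omega>) \<in> WF \<rightarrow>\<^sub>M (\<Pi>\<^sub>M i\<in>{1..}. (borel :: real measure))"
    unfolding WF_def by (rule measurable_vimage_algebra1) (simp add: space_PiM)
  have pf: "(\<lambda>\<omega>. \<lambda>t\<in>{0..}. S t \<omega>) \<in> PF \<rightarrow>\<^sub>M (\<Pi>\<^sub>M t\<in>{0..}. (borel :: (real^'d) measure))"
    unfolding PF_def by (rule measurable_vimage_algebra1) (simp add: space_PiM)
  have wait_WF: "wait i \<in> borel_measurable WF" if "1 \<le> i" for i
  proof -
    have "(\<lambda>\<omega>. (\<lambda>i\<in>{1..}. \<eta> i \<omega>) i) \<in> borel_measurable WF"
      by (rule measurable_compose[OF wf measurable_component_singleton]) (use that in simp)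
    then have "\<eta> i \<in> borel_measurable WF" using that by simp
    from measurable_compose[OF this D_measurable] show ?thesis by (simp add: wait_def[abs_def])
  qed
  have \<tau>_WF: "\<tau> k \<in> borel_measurable WF" for k
    unfolding intervention_time_def[abs_def] by (rule borel_measurable_sum) (rule wait_WF, simp)
  have S_PF: "S t \<in> borel_measurable PF" if "0 \<le> t" for t
  proof -
    have "(\<lambda>\<omega>. (\<lambda>t\<in>{0..}. S t \<omega>) t) \<in> borel_measurable PF"
      by (rule measurable_compose[OF pf measurable_component_singleton]) (use that in simp)
    then show ?thesis using that by simp
  qed
  have eval: "(\<lambda>z. S (max 0 (fst z)) (snd z)) \<in> borel_measurable (borel \<Otimes>\<^sub>M PF)"
  proof (rule borel_measurable_at_random_time[where Y = "\<lambda>t z. S t (snd z)"])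
    show "(\<lambda>z. S t (snd z)) \<in> borel_measurable (borel \<Otimes>\<^sub>M PF)" if "0 \<le> t" for t
      by (rule measurable_compose[OF measurable_snd S_PF[OF that]])
    show "((\<lambda>u. S u (snd z)) \<longlongrightarrow> S t (snd z)) (at_right t)" if "z \<in> space (borel \<Otimes>\<^sub>M PF)" "0 \<le> t" for t z
      using that by (intro price_right_limit) (auto simp: space_pair_measure space_F)
  qed (auto intro: borel_measurable_max)
  \<comment> \<open>truncation at \<open>0\<close> makes the return measurable on the whole product space\<close>
  define Q where "Q z = returns S (max 0 (fst (fst z))) (max 0 (fst (fst z)) + max 0 (snd (fst z))) (snd z)"
    for z :: "(real \<times> real) \<times> 'w"
  let ?B = "borel :: real measure"
  have proj: "(\<lambda>z. fst (fst z) :: real) \<in> borel_measurable ((?B \<Otimes>\<^sub>M ?B) \<Otimes>\<^sub>M PF)"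
      "(\<lambda>z. snd (fst z) :: real) \<in> borel_measurable ((?B \<Otimes>\<^sub>M ?B) \<Otimes>\<^sub>M PF)"
    by (rule measurable_compose[OF measurable_fst measurable_fst] measurable_compose[OF measurable_fst measurable_snd])+
  have "(\<lambda>z. (fst (fst z), snd z)) \<in> (?B \<Otimes>\<^sub>M ?B) \<Otimes>\<^sub>M PF \<rightarrow>\<^sub>M ?B \<Otimes>\<^sub>M PF"
    by (rule measurable_Pair[OF proj(1) measurable_snd])
  from measurable_compose[OF this eval]
  have Q1: "(\<lambda>z. S (max 0 (fst (fst z))) (snd z)) \<in> borel_measurable ((?B \<Otimes>\<^sub>M ?B) \<Otimes>\<^sub>M PF)" by simp
  have "(\<lambda>z. (max 0 (fst (fst z)) + max 0 (snd (fst z)) :: real, snd z)) \<in> (?B \<Otimes>\<^sub>M ?B) \<Otimes>\<^sub>M PF \<rightarrow>\<^sub>M ?B \<Otimes>\<^sub>M PF"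
    by (intro measurable_Pair borel_measurable_add borel_measurable_max borel_measurable_const proj measurable_snd)
  from measurable_compose[OF this eval]
  have Q2: "(\<lambda>z. S (max 0 (fst (fst z)) + max 0 (snd (fst z))) (snd z)) \<in> borel_measurable ((?B \<Otimes>\<^sub>M ?B) \<Otimes>\<^sub>M PF)"
    by simp
  have "Q \<in> borel_measurable ((?B \<Otimes>\<^sub>M ?B) \<Otimes>\<^sub>M PF)"
    unfolding Q_def[abs_def] returns_def borel_measurable_vec_iff vec_lambda_beta
    using Q1 Q2 by (intro allI borel_measurable_divide) (simp_all add: borel_measurable_vec_iff)
  from measurable_compose[OF this g]
  have gQ: "(\<lambda>z. g (Q z)) \<in> borel_measurable ((?B \<Otimes>\<^sub>M ?B) \<Otimes>\<^sub>M PF)" .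
  have id_PF: "(\<lambda>\<omega>. \<omega>) \<in> M \<rightarrow>\<^sub>M PF"
    by (rule measurable_from_subalg[of M PF])
       (use indep_setD_ev2[OF indep] space_F in \<open>simp_all add: subalgebra_def\<close>)
  define \<Psi> where "\<Psi> x = (\<integral>\<^sup>+\<omega>. g (Q (x, \<omega>)) \<partial>distr M PF (\<lambda>\<omega>. \<omega>))" for x
  interpret PF: prob_space "distr M PF (\<lambda>\<omega>. \<omega>)" by (rule prob_space_distr[OF id_PF])
  have \<Psi>_meas: "\<Psi> \<in> borel_measurable (borel \<Otimes>\<^sub>M borel)"
    unfolding \<Psi>_def[abs_def]
    by (rule PF.borel_measurable_nn_integral_fst)
       (subst measurable_cong_sets[OF sets_pair_measure_cong[OF refl sets_distr] refl], rule gQ)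
  have \<Psi>_eq: "\<Psi> (s, t) = \<Psi> (0, t)" if "0 \<le> s" "0 \<le> t" for s t
  proof -
    have "\<Psi> (u, t) = (\<integral>\<^sup>+\<omega>. g (returns S u (u + t) \<omega>) \<partial>M)" if u: "0 \<le> u" for u
    proof -
      have "\<Psi> (u, t) = (\<integral>\<^sup>+\<omega>. g (Q ((u, t), \<omega>)) \<partial>M)"
        unfolding \<Psi>_def by (rule nn_integral_distr[OF id_PF]) (use measurable_Pair2[OF gQ, of "(u, t)"] in \<open>simp add: space_pair_measure\<close>)
      then show ?thesis using u \<open>0 \<le> t\<close> by (simp add: Q_def)
    qed
    then show ?thesis using returns_stationary[OF g that] \<open>0 \<le> s\<close> by simp
  qed
  have main: "(\<integral>\<^sup>+\<omega>. g (period_return k \<omega>) \<partial>M) = (\<integral>\<^sup>+x. \<Psi> (0, x) \<partial>distr M borel (wait 1))" for k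
  proof -
    have "(\<lambda>\<omega>. (\<tau> k \<omega>, wait (Suc k) \<omega>)) \<in> WF \<rightarrow>\<^sub>M borel \<Otimes>\<^sub>M borel"
      by (rule measurable_Pair[OF \<tau>_WF wait_WF]) simp
    from nn_integral_indep_set[OF indep space_F this measurable_ident[unfolded id_def] gQ]
    have "(\<integral>\<^sup>+\<omega>. g (Q ((\<tau> k \<omega>, wait (Suc k) \<omega>), \<omega>)) \<partial>M) = (\<integral>\<^sup>+\<omega>. \<Psi> (\<tau> k \<omega>, wait (Suc k) \<omega>) \<partial>M)"
      by (simp add: \<Psi>_def)
    moreover have "Q ((\<tau> k \<omega>, wait (Suc k) \<omega>), \<omega>) = period_return k \<omega>" if "\<omega> \<in> space M" for \<omega>
      using \<tau>_nonneg[OF that] wait_pos[OF _ that, of "Suc k"]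
      by (simp add: Q_def period_return_def intervention_time_Suc)
    moreover have "\<Psi> (\<tau> k \<omega>, wait (Suc k) \<omega>) = \<Psi> (0, wait (Suc k) \<omega>)" if "\<omega> \<in> space M" for \<omega>
      using \<tau>_nonneg[OF that] wait_pos[OF _ that, of "Suc k"] by (intro \<Psi>_eq) auto
    ultimately have "(\<integral>\<^sup>+\<omega>. g (period_return k \<omega>) \<partial>M) = (\<integral>\<^sup>+\<omega>. \<Psi> (0, wait (Suc k) \<omega>) \<partial>M)"
      by (simp cong: nn_integral_cong)
    also have "\<dots> = (\<integral>\<^sup>+x. \<Psi> (0, x) \<partial>distr M borel (wait (Suc k)))"
      by (rule nn_integral_distr[symmetric, OF wait_measurable])
         (use measurable_Pair2[OF \<Psi>_meas, of 0] in simp_all)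
    also have "distr M borel (wait (Suc k)) = distr M borel (wait 1)" by (rule wait_law) simp
    finally show ?thesis .
  qed
  show ?thesis using main[of n] main[of 0] by simp
qed

lemma period_return_measurable:
  assumes "information M S wait G" shows "period_return n \<in> borel_measurable M"
proof -
  have "subalgebra M (G (Suc n))" using assms by (simp add: information_def)
  then show ?thesis using period_return_adapted[OF assms] by (rule measurable_from_subalg)
qed

lemma period_return_law:
  assumes "information M S wait G"
  shows "distr M borel (period_return n) = distr M borel (period_return 0)"
proof (rule measure_eqI)
  fix A assume "A \<in> sets (distr M borel (period_return n))"
  then have A: "A \<in> sets borel" by simp
  have "emeasure (distr M borel (period_return k)) A = (\<integral>\<^sup>+\<omega>. indicator A (period_return k \<omega>) \<partial>M)" for k
  proof -
    have "emeasure (distr M borel (period_return k)) A = (\<integral>\<^sup>+x. indicator A x \<partial>distr M borel (period_return k))"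
      using A by (subst nn_integral_indicator) simp_all
    also have "\<dots> = (\<integral>\<^sup>+\<omega>. indicator A (period_return k \<omega>) \<partial>M)"
      using A by (intro nn_integral_distr period_return_measurable[OF assms]) simp
    finally show ?thesis .
  qed
  then show "emeasure (distr M borel (period_return n)) A = emeasure (distr M borel (period_return 0)) A"
    using nn_integral_period_return[of "indicator A" n] A by simp
qed simp

lemma return_periods_market:
  assumes info: "information M S wait G" and \<gamma>: "\<gamma> < 0"
    and int: "(\<integral>\<^sup>+\<omega>. ennreal (worst_return (period_return 0 \<omega>) powr \<gamma>) \<partial>M) < \<infinity>"
  shows "return_periods M c h \<gamma> period_return G"
proof (intro return_periods.intro one_period_market.intro one_period_market_axioms.intro
    return_periods_axioms.intro)
  show "proportional_costs c h" "prob_space M" by unfold_locales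
  show "subalgebra M (G n)" "sets (G n) \<subseteq> sets (G (Suc n))" for n
    using info by (simp_all add: information_def)
qed (use \<gamma> int period_return_pos period_return_measurable[OF info] period_return_adapted[OF info]
    period_return_law[OF info] period_return_indep[OF info] in blast)+

end

section \<open>The value of the problem with fixed waiting times\<close>

lemma drift_eq: "drift x y = (1 / (x \<bullet> y)) *\<^sub>R (x * y)"
  by (simp add: drift_def inverse_eq_divide)

lemma inner_eq_mult_one: "x \<bullet> y = (x * y) \<bullet> (1 :: real^'d)"
  by (simp add: inner_vec_def)

lemma drift_simplex:
  assumes "x \<in> weight_simplex" "\<And>i. 0 < y $ i"
  shows "drift x y \<in> weight_simplex" "0 < x \<bullet> y"
proof -
  have "x * y \<in> position_cone"
    using position_cone_mult assms simplex_subset_cone by blast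
  then have "\<And>i. 0 \<le> x $ i * y $ i" and pos: "0 < x \<bullet> y"
    by (auto simp: position_cone_def inner_eq_mult_one[of x y])
  then show "drift x y \<in> weight_simplex"
    by (auto simp: drift_eq weight_simplex_def inner_eq_mult_one[of x y])
  show "0 < x \<bullet> y" by fact
qed

lemma borel_measurable_drift:
  assumes "X \<in> borel_measurable N" "Y \<in> borel_measurable N"
  shows "(\<lambda>\<omega>. drift (X \<omega>) (Y \<omega>)) \<in> borel_measurable N"
  unfolding drift_def
  by (intro borel_measurable_scaleR borel_measurable_inverse borel_measurable_inner borel_measurable_vec_mult assms)

locale investment = market M c h S \<eta> D
  for M :: "'w measure" and c h :: "real^'d" and S \<eta> D +
  fixes \<gamma> :: real and G :: "nat \<Rightarrow> 'w measure" and \<pi> :: "real^'d"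
  assumes info: "information M S wait G"
    and risk_averse: "\<gamma> < 0"
    and first_period_integrable:
      "(\<integral>\<^sup>+\<omega>. ennreal (worst_return (period_return 0 \<omega>) powr \<gamma>) \<partial>M) < \<infinity>"
    and wait_integrable: "integrable M (wait 1)"
    and initial: "\<pi> \<in> weight_simplex"
begin

sublocale return_periods M c h \<gamma> period_return G
  by (rule return_periods_market[OF info risk_averse first_period_integrable])

abbreviation \<A> :: "(real \<Rightarrow> 'w \<Rightarrow> real^'d) set" where
  "\<A> \<equiv> admissible M S wait G \<pi>"

abbreviation growth :: "(real \<Rightarrow> 'w \<Rightarrow> real^'d) \<Rightarrow> ereal" where
  "growth P \<equiv> growth_functional M \<gamma> c h S wait P \<pi>"

abbreviation pre :: "(real \<Rightarrow> 'w \<Rightarrow> real^'d) \<Rightarrow> nat \<Rightarrow> 'w \<Rightarrow> real^'d" where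
  "pre P \<equiv> pre_weights S wait P \<pi>"

abbreviation log_wealth :: "(real \<Rightarrow> 'w \<Rightarrow> real^'d) \<Rightarrow> nat \<Rightarrow> 'w \<Rightarrow> real" where
  "log_wealth P n \<omega> \<equiv> \<Sum>i<n. log_growth c h S wait P \<pi> i \<omega>"

definition mean_wait :: real where "mean_wait = integral\<^sup>L M (wait 1)"

lemma mean_wait_pos: "0 < mean_wait"
proof -
  have nn: "AE \<omega> in M. 0 \<le> wait 1 \<omega>" using wait_pos[of 1] by (intro AE_I2) (simp add: less_imp_le)
  have "mean_wait \<noteq> 0"
  proof
    assume "mean_wait = 0"
    then have "AE \<omega> in M. wait 1 \<omega> = 0"
      using integral_nonneg_eq_0_iff_AE[OF wait_integrable nn] by (simp add: mean_wait_def)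
    moreover have "AE \<omega> in M. wait 1 \<omega> \<noteq> 0" using wait_pos[of 1] by (intro AE_I2) force
    ultimately have "AE \<omega> in M. False" by eventually_elim simp
    then show False by (simp add: AE_False)
  qed
  moreover have "0 \<le> mean_wait" unfolding mean_wait_def by (rule integral_nonneg_AE[OF nn])
  ultimately show ?thesis by simp
qed

lemma mean_intervention_time: "integral\<^sup>L M (\<tau> n) = real n * mean_wait"
proof -
  have "integrable M (wait i) \<and> integral\<^sup>L M (wait i) = mean_wait" if "1 \<le> i" for i
  proof -
    have m: "wait i \<in> borel_measurable M" "wait 1 \<in> borel_measurable M" using that by measurable
    have "integrable (distr M borel (wait 1)) (\<lambda>x. x)"
      using wait_integrable m by (subst integrable_distr_eq) auto
    then have "integrable M (wait i)"
      unfolding wait_law[OF that, symmetric] using m by (subst (asm) integrable_distr_eq) auto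
    moreover have "integral\<^sup>L M (wait i) = integral\<^sup>L (distr M borel (wait i)) (\<lambda>x. x)"
      using m by (subst integral_distr) auto
    moreover have "mean_wait = integral\<^sup>L (distr M borel (wait 1)) (\<lambda>x. x)"
      unfolding mean_wait_def using m by (subst integral_distr) auto
    ultimately show ?thesis using wait_law[OF that] by simp
  qed
  then show ?thesis
    unfolding intervention_time_def[abs_def] by (subst Bochner_Integration.integral_sum) auto
qed

text \<open>The wealth of a strategy is the exponential of its accumulated logarithmic growth, so that its
  positions are those of the recursion for the chosen weights.\<close>

lemma strategy_position:
  assumes P: "P \<in> \<A>" and \<omega>: "\<omega> \<in> space M"
  shows "pre P n \<omega> \<in> weight_simplex \<and>
    position \<pi> (\<lambda>n \<omega>. P (\<tau> n \<omega>) \<omega>) n \<omega> =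
      exp (log_wealth P n \<omega>) *\<^sub>R pre P n \<omega>"
proof (induction n)
  case 0
  then show ?case using initial by simp
next
  case (Suc n)
  define p where "p = P (\<tau> n \<omega>) \<omega>"
  define r where "r = period_return n \<omega>"
  define x where "x = pre P n \<omega>"
  define a where "a = exp (log_wealth P n \<omega>)"
  have p: "p \<in> weight_simplex"
    using P \<omega> \<tau>_nonneg[OF \<omega>, of n] by (auto simp: admissible_def p_def)
  have x: "x \<in> weight_simplex" "x \<in> position_cone" using Suc simplex_subset_cone by (auto simp: x_def)
  have r: "\<And>i. 0 < r $ i" using period_return_pos[OF \<omega>] by (simp add: r_def)
  note dr = drift_simplex[OF p r]
  have pre_Suc: "pre P (Suc n) \<omega> = drift p r"
    by (simp add: p_def r_def period_return_def)
  have "exp (log_growth c h S wait P \<pi> n \<omega>) = wealth_after x p * (p \<bullet> r)"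
    using dr(2) rebalanced_wealth_pos[OF x(2) p]
    by (simp add: log_growth_def exp_add shrink_eq_rebalanced_wealth x(1) flip: p_def r_def x_def period_return_def)
  then have a: "exp (log_wealth P (Suc n) \<omega>) = a * (wealth_after x p * (p \<bullet> r))"
    by (simp add: a_def exp_add)
  have "position \<pi> (\<lambda>n \<omega>. P (\<tau> n \<omega>) \<omega>) (Suc n) \<omega> = wealth_after (a *\<^sub>R x) p *\<^sub>R (p * r)"
    using Suc by (simp add: p_def r_def x_def a_def)
  also have "wealth_after (a *\<^sub>R x) p = a * wealth_after x p"
    by (rule rebalanced_wealth_scale[OF x(2) p]) (simp add: a_def)
  also have "(a * wealth_after x p) *\<^sub>R (p * r) = (a * (wealth_after x p * (p \<bullet> r))) *\<^sub>R drift p r"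
    using dr(2) by (simp add: drift_eq)
  finally show ?case unfolding pre_Suc a using dr(1) by (intro conjI)
qed

definition moment_of :: "(real \<Rightarrow> 'w \<Rightarrow> real^'d) \<Rightarrow> nat \<Rightarrow> ennreal" where
  "moment_of P n = (\<integral>\<^sup>+\<omega>. ennreal (exp (\<gamma> * (log_wealth P n \<omega>))) \<partial>M)"

lemma moment_of_eq_position:
  assumes P: "P \<in> \<A>"
  shows "moment_of P n = (\<integral>\<^sup>+\<omega>. ennreal ((position \<pi> (\<lambda>n \<omega>. P (\<tau> n \<omega>) \<omega>) n \<omega> \<bullet> 1) powr \<gamma>) \<partial>M)"
  unfolding moment_of_def
proof (rule nn_integral_cong)
  fix \<omega> assume \<omega>: "\<omega> \<in> space M"
  from strategy_position[OF P \<omega>, of n]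
  have "position \<pi> (\<lambda>n \<omega>. P (\<tau> n \<omega>) \<omega>) n \<omega> \<bullet> 1 = exp (log_wealth P n \<omega>)"
    by (simp add: weight_simplex_def)
  then show "ennreal (exp (\<gamma> * (log_wealth P n \<omega>))) =
      ennreal ((position \<pi> (\<lambda>n \<omega>. P (\<tau> n \<omega>) \<omega>) n \<omega> \<bullet> 1) powr \<gamma>)"
    by (simp add: exp_powr_real mult.commute)
qed

lemma admissible_weights:
  assumes P: "P \<in> \<A>"
  shows "(\<lambda>\<omega>. P (\<tau> n \<omega>) \<omega>) \<in> borel_measurable (G n)"
    and "\<omega> \<in> space M \<Longrightarrow> P (\<tau> n \<omega>) \<omega> \<in> weight_simplex"
  using P \<tau>_nonneg by (auto simp: admissible_def)

lemma optimal_moment_le_moment_of: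
  assumes P: "P \<in> \<A>" shows "\<U> n \<pi> \<le> moment_of P n"
  unfolding moment_of_eq_position[OF P]
  by (rule optimal_moment_le_strategy[OF initial]) (use admissible_weights[OF P] in blast)+

lemma growth_functional_eq:
  "growth P =
    liminf (\<lambda>n. ereal (1 / (real n * mean_wait)) *
      (if moment_of P n = \<infinity> then -\<infinity> else ereal (1 / \<gamma> * ln (enn2real (moment_of P n)))))"
  unfolding growth_functional_def entropic_utility_def Let_def mean_intervention_time moment_of_def
  by (rule refl)

definition scale :: real where "scale = 1 / (- \<gamma> * mean_wait)"

lemma scale_pos: "0 < scale"
  using mult_neg_pos[OF risk_averse mean_wait_pos] by (simp add: scale_def)

text \<open>Dividing by \<open>\<gamma> < 0\<close> turns lower bounds of moments into upper bounds of utilities.\<close>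

lemma growth_le_decay_rate:
  assumes P: "P \<in> \<A>"
  shows "growth P \<le> ereal scale * decay_rate (\<lambda>n. \<U> n \<pi>)"
proof -
  have "growth P \<le>
      liminf (\<lambda>n. ereal scale * ereal (- ln (enn2real (\<U> n \<pi>)) / real n))"
    unfolding growth_functional_eq
  proof (rule Liminf_mono, rule eventually_mono[OF eventually_gt_at_top[of 0]])
    fix n :: nat assume n: "0 < n"
    show "ereal (1 / (real n * mean_wait)) *
        (if moment_of P n = \<infinity> then -\<infinity> else ereal (1 / \<gamma> * ln (enn2real (moment_of P n))))
      \<le> ereal scale * ereal (- ln (enn2real (\<U> n \<pi>)) / real n)"
    proof (cases "moment_of P n = \<infinity>")
      case True
      then show ?thesis using n mean_wait_pos by simp
    next
      case False
      have "\<pi> \<in> position_cone" using initial simplex_subset_cone by blast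
      then have "0 < enn2real (\<U> n \<pi>)"
        using optimal_moment_finite_pos[of \<pi> n] by (simp add: enn2real_positive_iff less_top)
      moreover have "enn2real (\<U> n \<pi>) \<le> enn2real (moment_of P n)"
        using optimal_moment_le_moment_of[OF P] False by (intro enn2real_mono) (simp_all add: less_top)
      ultimately have "ln (enn2real (\<U> n \<pi>)) \<le> ln (enn2real (moment_of P n))" by simp
      then have "1 / \<gamma> * ln (enn2real (moment_of P n)) \<le> 1 / \<gamma> * ln (enn2real (\<U> n \<pi>))"
        using risk_averse by (intro mult_left_mono_neg) auto
      then have "1 / (real n * mean_wait) * (1 / \<gamma> * ln (enn2real (moment_of P n)))
          \<le> 1 / (real n * mean_wait) * (1 / \<gamma> * ln (enn2real (\<U> n \<pi>)))"
        by (rule mult_left_mono) (use n mean_wait_pos in simp)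
      also have "\<dots> = scale * (- ln (enn2real (\<U> n \<pi>)) / real n)"
        using n mean_wait_pos risk_averse by (simp add: scale_def field_simps)
      finally show ?thesis using False by simp
    qed
  qed
  also have "\<dots> = ereal scale * decay_rate (\<lambda>n. \<U> n \<pi>)"
    unfolding decay_rate_def using scale_pos by (intro Liminf_ereal_mult_left) auto
  finally show ?thesis .
qed

subsection \<open>Strategies that apply a fixed function to the current weights\<close>

context
  fixes \<phi> :: "real^'d \<Rightarrow> real^'d"
  assumes \<phi>_measurable: "\<phi> \<in> borel \<rightarrow>\<^sub>M borel" and \<phi>_simplex: "\<And>x. \<phi> x \<in> weight_simplex"
begin

primrec policy_weights :: "nat \<Rightarrow> 'w \<Rightarrow> real^'d" where
  "policy_weights 0 \<omega> = \<pi>"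
| "policy_weights (Suc n) \<omega> = drift (\<phi> (policy_weights n \<omega>)) (period_return n \<omega>)"

text \<open>The weights after the limit of the intervention times, should it be finite, are arbitrary.\<close>

definition policy_strategy :: "real \<Rightarrow> 'w \<Rightarrow> real^'d" where
  "policy_strategy t \<omega> =
     (if 0 \<le> t \<and> (\<exists>n. \<tau> n \<omega> \<le> t \<and> t < \<tau> (Suc n) \<omega>) then
        (let n = (THE n. \<tau> n \<omega> \<le> t \<and> t < \<tau> (Suc n) \<omega>)
         in drift (\<phi> (policy_weights n \<omega>)) (returns S (\<tau> n \<omega>) t \<omega>))
      else \<pi>)"

lemma policy_strategy_eq:
  assumes \<omega>: "\<omega> \<in> space M" and t: "\<tau> n \<omega> \<le> t" "t < \<tau> (Suc n) \<omega>"
  shows "policy_strategy t \<omega> = drift (\<phi> (policy_weights n \<omega>)) (returns S (\<tau> n \<omega>) t \<omega>)"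
proof -
  have mono: "\<tau> k \<omega> \<le> \<tau> l \<omega>" if "k \<le> l" for k l
    by (rule lift_Suc_mono_le[where f = "\<lambda>n. \<tau> n \<omega>", OF less_imp_le[OF \<tau>_less_Suc[OF \<omega>]] that])
  have "(THE n. \<tau> n \<omega> \<le> t \<and> t < \<tau> (Suc n) \<omega>) = n"
  proof (rule the_equality)
    fix m assume "\<tau> m \<omega> \<le> t \<and> t < \<tau> (Suc m) \<omega>"
    then have "\<not> Suc m \<le> n" "\<not> Suc n \<le> m" using t mono[of "Suc m" n] mono[of "Suc n" m] by linarith+
    then show "m = n" by simp
  qed (use t in simp)
  moreover have "0 \<le> t" using t \<tau>_nonneg[OF \<omega>, of n] by linarith
  ultimately show ?thesis unfolding policy_strategy_def using t by auto
qed

lemma policy_strategy_at_\<tau>: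
  assumes \<omega>: "\<omega> \<in> space M" shows "policy_strategy (\<tau> n \<omega>) \<omega> = \<phi> (policy_weights n \<omega>)"
proof -
  have "returns S (\<tau> n \<omega>) (\<tau> n \<omega>) \<omega> = 1"
    using S_pos[OF \<tau>_nonneg[OF \<omega>] \<omega>, of n] by (simp add: returns_def vec_eq_iff less_imp_neq[symmetric])
  moreover have "drift p 1 = p" if "p \<in> weight_simplex" for p :: "real^'d"
    using that by (simp add: drift_eq weight_simplex_def)
  ultimately show ?thesis
    using policy_strategy_eq[OF \<omega>, of n "\<tau> n \<omega>"] \<tau>_less_Suc[OF \<omega>, of n] \<phi>_simplex by simp
qed

lemma policy_strategy_admissible: "policy_strategy \<in> \<A>"
proof -
  have pw: "policy_weights n \<in> borel_measurable (G n)" for n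
  proof (induction n)
    case (Suc n)
    have "(\<lambda>\<omega>. \<phi> (policy_weights n \<omega>)) \<in> borel_measurable (G n)"
      by (rule measurable_compose[OF Suc \<phi>_measurable])
    from borel_measurable_drift[OF G_Suc[OF this] Rk_adapted[of n]]
    show ?case by simp
  qed simp
  have "(\<lambda>\<omega>. policy_strategy (\<tau> n \<omega>) \<omega>) \<in> borel_measurable (G n)" for n
  proof -
    have "(\<lambda>\<omega>. \<phi> (policy_weights n \<omega>)) \<in> borel_measurable (G n)"
      by (rule measurable_compose[OF pw \<phi>_measurable])
    then show ?thesis by (rule measurable_cong[THEN iffD1, rotated]) (simp add: policy_strategy_at_\<tau>)
  qed
  moreover have "policy_strategy t \<omega> = \<pi>" if "t < 0" for t \<omega>
    using that by (simp add: policy_strategy_def)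
  moreover have "policy_strategy t \<omega> \<in> weight_simplex" if \<omega>: "\<omega> \<in> space M" and "0 \<le> t" for t \<omega>
  proof (cases "\<exists>n. \<tau> n \<omega> \<le> t \<and> t < \<tau> (Suc n) \<omega>")
    case True
    then obtain n where n: "\<tau> n \<omega> \<le> t" "t < \<tau> (Suc n) \<omega>" by blast
    show ?thesis
      unfolding policy_strategy_eq[OF \<omega> n]
      by (rule drift_simplex(1)[OF \<phi>_simplex returns_pos[OF \<tau>_nonneg[OF \<omega>] \<open>0 \<le> t\<close> \<omega>]])
  next
    case False
    then have "policy_strategy t \<omega> = \<pi>" unfolding policy_strategy_def by (subst if_not_P) blast+
    then show ?thesis using initial by simp
  qed
  moreover have "policy_strategy t \<omega> = drift (policy_strategy (\<tau> n \<omega>) \<omega>) (returns S (\<tau> n \<omega>) t \<omega>)"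
    if "\<omega> \<in> space M" "t \<in> {\<tau> n \<omega>..<\<tau> (Suc n) \<omega>}" for n t \<omega>
    using that by (simp add: policy_strategy_eq policy_strategy_at_\<tau>)
  ultimately show ?thesis by (simp add: admissible_def)
qed

lemma pre_weights_policy:
  "\<omega> \<in> space M \<Longrightarrow> pre policy_strategy n \<omega> = policy_weights n \<omega>"
  by (induction n) (simp_all add: policy_strategy_at_\<tau> period_return_def)

text \<open>The supersolution \<open>f\<close> is comparable with the power of the wealth and grows at most by \<open>exp \<rho>\<close> per
  period along the strategy.\<close>

lemma moment_of_policy_le:
  assumes f: "cone_decreasing \<gamma> f" and a: "0 < a"
    and lower: "\<And>x. x \<in> position_cone \<Longrightarrow> ennreal (a * (x \<bullet> 1) powr \<gamma>) \<le> f x"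
    and upper: "\<And>x. x \<in> position_cone \<Longrightarrow> f x \<le> ennreal ((x \<bullet> 1) powr \<gamma>)"
    and step: "\<And>x t. x \<in> weight_simplex \<Longrightarrow> 0 < t \<Longrightarrow>
       (\<integral>\<^sup>+\<omega>. f (wealth_after (t *\<^sub>R x) (\<phi> x) *\<^sub>R (\<phi> x * period_return 0 \<omega>)) \<partial>M) \<le> ennreal (exp \<rho>) * f (t *\<^sub>R x)"
  shows "ennreal a * moment_of policy_strategy n \<le> ennreal (exp (\<rho> * n))"
proof -
  note P = policy_strategy_admissible
  let ?p = "\<lambda>n \<omega>. policy_strategy (\<tau> n \<omega>) \<omega>"
  have meas: "(\<lambda>\<omega>. ennreal ((position \<pi> ?p n \<omega> \<bullet> 1) powr \<gamma>)) \<in> borel_measurable M"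
  proof (rule borel_measurable_cone_decreasing)
    show "cone_decreasing \<gamma> (\<lambda>x::real^'d. ennreal ((x \<bullet> 1) powr \<gamma>))"
      using risk_averse by (intro cone_decreasing_powr) simp
    show "position \<pi> ?p n \<in> borel_measurable M"
      by (rule G_le_M, rule position_adapted[OF initial]) (use admissible_weights[OF P] in blast)+
    show "position \<pi> ?p n \<omega> \<in> position_cone" if "\<omega> \<in> space M" for \<omega>
      by (rule position_cone[OF initial _ _ that]) (use admissible_weights[OF P] in blast)+
  qed
  have "ennreal a * moment_of policy_strategy n = (\<integral>\<^sup>+\<omega>. ennreal a * ennreal ((position \<pi> ?p n \<omega> \<bullet> 1) powr \<gamma>) \<partial>M)"
    unfolding moment_of_eq_position[OF P] by (rule nn_integral_cmult[OF meas, symmetric])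
  also have "\<dots> \<le> (\<integral>\<^sup>+\<omega>. f (position \<pi> ?p n \<omega>) \<partial>M)"
  proof (rule nn_integral_mono)
    fix \<omega> assume "\<omega> \<in> space M"
    then have "position \<pi> ?p n \<omega> \<in> position_cone"
      by (rule position_cone[OF initial, rotated -1]) (use admissible_weights[OF P] in blast)+
    from lower[OF this] show "ennreal a * ennreal ((position \<pi> ?p n \<omega> \<bullet> 1) powr \<gamma>) \<le> f (position \<pi> ?p n \<omega>)"
      using a by (simp add: ennreal_mult')
  qed
  also have "\<dots> \<le> ennreal (exp (\<rho> * n)) * f \<pi>"
  proof (rule strategy_growth_le[OF initial _ _ f])
    fix n \<omega> assume \<omega>: "\<omega> \<in> space M"
    have "position \<pi> ?p n \<omega> =
        exp (log_wealth policy_strategy n \<omega>) *\<^sub>R policy_weights n \<omega>"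
      "policy_weights n \<omega> \<in> weight_simplex"
      using strategy_position[OF P \<omega>, of n] by (simp_all add: pre_weights_policy[OF \<omega>])
    then show "(\<integral>\<^sup>+\<omega>'. f (wealth_after (position \<pi> ?p n \<omega>) (?p n \<omega>) *\<^sub>R (?p n \<omega> * period_return 0 \<omega>')) \<partial>M)
        \<le> ennreal (exp \<rho>) * f (position \<pi> ?p n \<omega>)"
      using step[of "policy_weights n \<omega>"] by (simp add: policy_strategy_at_\<tau>[OF \<omega>])
  qed (use admissible_weights[OF P] in blast)+
  also have "f \<pi> \<le> 1"
    using upper[of \<pi>] initial simplex_subset_cone by (auto simp: weight_simplex_def)
  finally show ?thesis by (simp add: mult_left_mono order_trans)
qed

end

text \<open>One good horizon \<open>N\<close> suffices: by comparability, a small optimal moment from \<open>\<pi>\<close> is small from every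
  position, so that the stationary policies apply.\<close>

lemma near_optimal_strategy:
  assumes v: "ereal v < decay_rate (\<lambda>n. \<U> n \<pi>)"
  shows "\<exists>P\<in>\<A>. ereal (scale * v) \<le> growth P"
proof -
  obtain v1 where v1: "ereal v < ereal v1" "ereal v1 < decay_rate (\<lambda>n. \<U> n \<pi>)"
    using ereal_dense2[OF v] by blast
  \<comment> \<open>the gap between \<open>v'\<close> and \<open>v1\<close> absorbs the factor \<open>cost_ratio\<close> for large \<open>N\<close>, the gap between \<open>v\<close>
    and \<open>v'\<close> the loss of the nearly optimal weights\<close>
  define v' where "v' = (v + v1) / 2"
  have v': "v < v'" "v' < v1" using v1(1) by (simp_all add: v'_def)
  have "\<forall>\<^sub>F n in sequentially. ereal v1 < ereal (- ln (enn2real (\<U> n \<pi>)) / real n)"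
    using v1(2) unfolding decay_rate_def by (rule less_LiminfD)
  moreover have "\<forall>\<^sub>F n in sequentially. ln cost_ratio / (v1 - v') \<le> real n"
    using filterlim_real_sequentially unfolding filterlim_at_top by blast
  ultimately have "\<forall>\<^sub>F n in sequentially. 1 \<le> n \<and> ereal v1 < ereal (- ln (enn2real (\<U> n \<pi>)) / real n) \<and>
      ln cost_ratio / (v1 - v') \<le> real n"
    using eventually_ge_at_top[of 1] by eventually_elim simp
  then obtain N where N: "1 \<le> N" "v1 < - ln (enn2real (\<U> N \<pi>)) / real N" "ln cost_ratio / (v1 - v') \<le> real N"
    by (auto dest: eventually_happens)
  have \<pi>_cone: "\<pi> \<in> position_cone" using initial simplex_subset_cone by blast
  obtain u where u: "\<U> N \<pi> = ennreal u" "0 < u"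
    using optimal_moment_finite_pos[OF \<pi>_cone, of N] by (cases "\<U> N \<pi>") (auto simp: ennreal_less_zero_iff)
  have "cost_ratio * u \<le> exp (- v' * N)"
  proof -
    have "ln cost_ratio \<le> real N * (v1 - v')" "v1 * real N \<le> - ln u"
      using N v' u by (simp_all add: field_simps)
    then have "ln cost_ratio + ln u \<le> - v' * N" by (simp add: algebra_simps)
    then have "exp (ln cost_ratio + ln u) \<le> exp (- v' * N)" by simp
    then show ?thesis using cost_ratio_ge_1 u by (simp add: exp_add)
  qed
  then have decay: "\<U> N x \<le> ennreal (exp (- v' * N) * (x \<bullet> 1) powr \<gamma>)" if "x \<in> position_cone" for x
  proof -
    have "\<U> N x \<le> ennreal (cost_ratio * (x \<bullet> 1) powr \<gamma>) * \<U> N \<pi>"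
      by (rule optimal_moment_le_power[OF initial that])
    also have "\<dots> = ennreal (cost_ratio * u * (x \<bullet> 1) powr \<gamma>)"
      using u by (simp add: mult_ac flip: ennreal_mult')
    also have "\<dots> \<le> ennreal (exp (- v' * N) * (x \<bullet> 1) powr \<gamma>)"
      using \<open>cost_ratio * u \<le> exp (- v' * N)\<close> by (intro ennreal_leI mult_right_mono) auto
    finally show ?thesis .
  qed
  obtain f a \<phi> where pol: "cone_decreasing \<gamma> f" "0 < a"
    "\<And>x. x \<in> position_cone \<Longrightarrow> ennreal (a * (x \<bullet> 1) powr \<gamma>) \<le> f x"
    "\<And>x. x \<in> position_cone \<Longrightarrow> f x \<le> ennreal ((x \<bullet> 1) powr \<gamma>)"
    "\<phi> \<in> borel \<rightarrow>\<^sub>M borel" "\<And>x. \<phi> x \<in> weight_simplex"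
    "\<And>x t. x \<in> weight_simplex \<Longrightarrow> 0 < t \<Longrightarrow>
       (\<integral>\<^sup>+\<omega>. f (wealth_after (t *\<^sub>R x) (\<phi> x) *\<^sub>R (\<phi> x * period_return 0 \<omega>)) \<partial>M) \<le> ennreal (exp (- v)) * f (t *\<^sub>R x)"
    using stationary_policy[OF N(1), of "- v'" "- v"] v' decay by auto
  define P where "P = policy_strategy \<phi>"
  have adm: "P \<in> \<A>"
    unfolding P_def by (rule policy_strategy_admissible[OF pol(5,6)])
  have moment: "ennreal a * moment_of P n \<le> ennreal (exp (- v * n))" for n
    unfolding P_def by (rule moment_of_policy_le[OF pol(5,6,1-4,7)])
  have bound: "ereal (scale * (v + ln a / real n)) \<le> ereal (1 / (real n * mean_wait)) *
      (if moment_of P n = \<infinity> then -\<infinity> else ereal (1 / \<gamma> * ln (enn2real (moment_of P n))))" if n: "0 < n" for n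
  proof -
    have "moment_of P n \<noteq> \<infinity>"
    proof
      assume "moment_of P n = \<infinity>"
      then show False using moment[of n] pol(2) by (simp add: ennreal_mult_top top_unique)
    qed
    moreover have "0 < moment_of P n"
      using optimal_moment_finite_pos(1)[OF \<pi>_cone, of n] optimal_moment_le_moment_of[OF adm, of n] by order
    ultimately obtain e where e: "moment_of P n = ennreal e" "0 < e"
      by (cases "moment_of P n") (auto simp: ennreal_less_zero_iff)
    have "a * e \<le> exp (- v * n)"
      using moment[of n] e pol(2) by (simp add: ennreal_mult'[symmetric])
    then have "ln (a * e) \<le> - v * n" using pol(2) e by (metis ln_exp ln_mono mult_pos_pos)
    then have "ln e \<le> - v * n - ln a" using pol(2) e by (simp add: ln_mult)
    then have "- (v * n + ln a) * (1 / \<gamma>) \<le> ln e * (1 / \<gamma>)"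
      by (intro mult_right_mono_neg) (use risk_averse in auto)
    then have "- (v * n + ln a) * (1 / \<gamma>) \<le> 1 / \<gamma> * ln e" by (simp only: mult.commute)
    then have "(1 / (real n * mean_wait)) * (- (v * n + ln a) * (1 / \<gamma>)) \<le> (1 / (real n * mean_wait)) * (1 / \<gamma> * ln e)"
      by (rule mult_left_mono) (use n mean_wait_pos in simp)
    moreover have "(1 / (real n * mean_wait)) * (- (v * n + ln a) * (1 / \<gamma>)) = scale * (v + ln a / real n)"
      using n mean_wait_pos risk_averse by (simp add: scale_def field_simps)
    ultimately show ?thesis using e by simp
  qed
  have "(\<lambda>n. scale * (v + ln a / real n)) \<longlonglongrightarrow> scale * (v + 0)"
    by (intro tendsto_intros lim_const_over_n)
  then have "(\<lambda>n. ereal (scale * (v + ln a / real n))) \<longlonglongrightarrow> ereal (scale * v)" by simp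
  then have "ereal (scale * v) = liminf (\<lambda>n. ereal (scale * (v + ln a / real n)))"
    by (intro lim_imp_Liminf[symmetric]) auto
  also have "\<dots> \<le> growth P"
    unfolding growth_functional_eq
    by (rule Liminf_mono, rule eventually_mono[OF eventually_gt_at_top[of 0]], rule bound)
  finally show ?thesis using adm by blast
qed

text \<open>The bounds for all strategies and for the stationary ones meet because both involve the lower limit
  of \<open>- ln u\<^sub>n / n\<close>.\<close>

theorem optimal_growth:
  "(SUP P\<in>\<A>. growth P)
    = ereal scale * decay_rate (\<lambda>n. \<U> n \<pi>)" (is "?V = _ * ?r")
proof (rule antisym)
  show "?V \<le> ereal scale * ?r" by (rule SUP_least) (rule growth_le_decay_rate)
  have "?r \<le> ereal (1 / scale) * ?V"
  proof (rule dense_le)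
    fix y assume "y < ?r"
    show "y \<le> ereal (1 / scale) * ?V"
    proof (cases y)
      case (real v)
      with \<open>y < ?r\<close> obtain P where P: "P \<in> \<A>"
          "ereal (scale * v) \<le> growth P"
        using near_optimal_strategy by blast
      have "growth P \<le> ?V" using P(1) by (rule SUP_upper)
      with P(2) have "ereal (scale * v) \<le> ?V" by (rule order_trans)
      then have "ereal (1 / scale) * ereal (scale * v) \<le> ereal (1 / scale) * ?V"
        using scale_pos by (intro ereal_mult_left_mono) auto
      then show ?thesis using scale_pos real by simp
    qed (use \<open>y < ?r\<close> in auto)
  qed
  then have "ereal scale * ?r \<le> ereal scale * (ereal (1 / scale) * ?V)"
    using scale_pos by (intro ereal_mult_left_mono) auto
  also have "\<dots> = ?V" using scale_pos by (simp flip: mult.assoc)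
  finally show "ereal scale * ?r \<le> ?V" .
qed

end

section \<open>Dyadic waiting times\<close>

definition dyadic_ceiling :: "nat \<Rightarrow> real \<Rightarrow> real" where
  "dyadic_ceiling m x = (\<Sum>j. (real j + 1) / 2 ^ m * indicator {real j / 2 ^ m <.. (real j + 1) / 2 ^ m} x)"

lemma dyadic_eq: "dyadic m \<eta> i \<omega> = dyadic_ceiling m (\<eta> i \<omega>)"
  by (simp add: dyadic_def dyadic_ceiling_def)

lemma dyadic_ceiling_bounds:
  assumes x: "0 < x"
  shows "x \<le> dyadic_ceiling m x" "dyadic_ceiling m x \<le> x + 1 / 2 ^ m"
proof -
  \<comment> \<open>the index of the only nonzero term; the cells are open on the left, hence the ceiling\<close>
  define j where "j = nat (\<lceil>2 ^ m * x\<rceil> - 1)"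
  have "0 < 2 ^ m * x" using x by simp
  then have "1 \<le> \<lceil>2 ^ m * x\<rceil>" by linarith
  then have j: "real j = of_int \<lceil>2 ^ m * x\<rceil> - 1" by (simp add: j_def)
  have bounds: "real j < 2 ^ m * x" "2 ^ m * x \<le> real j + 1" unfolding j by linarith+
  have ind: "indicator {real k / 2 ^ m <.. (real k + 1) / 2 ^ m} x = (if k = j then 1 else 0 :: real)" for k
  proof -
    have "real k / 2 ^ m < x \<and> x \<le> (real k + 1) / 2 ^ m \<longleftrightarrow> real k < 2 ^ m * x \<and> 2 ^ m * x \<le> real k + 1"
      by (simp add: field_simps)
    also have "\<dots> \<longleftrightarrow> k = j" using bounds by (auto simp: eq_iff)
    finally show ?thesis by (simp add: indicator_def)
  qed
  have "dyadic_ceiling m x = (\<Sum>k. if k = j then (real k + 1) / 2 ^ m else 0)"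
    unfolding dyadic_ceiling_def ind by (intro arg_cong[where f = suminf]) auto
  also have "\<dots> = (real j + 1) / 2 ^ m"
    using sums_single[of j "\<lambda>k. (real k + 1) / 2 ^ m"] by (rule sums_unique[symmetric])
  finally have eq: "dyadic_ceiling m x = (real j + 1) / 2 ^ m" .
  show "x \<le> dyadic_ceiling m x" "dyadic_ceiling m x \<le> x + 1 / 2 ^ m"
    unfolding eq using bounds by (simp_all add: field_simps)
qed

lemma borel_measurable_dyadic_ceiling [measurable]: "dyadic_ceiling m \<in> borel_measurable borel"
  unfolding dyadic_ceiling_def[abs_def] by measurable

lemma ereal_exp_mono: "x \<le> y \<Longrightarrow> ereal_exp x \<le> ereal_exp y"
  by (cases x; cases y) (auto simp: ereal_exp_def intro: ennreal_leI)

text \<open>The integrand of the local uniform integrability condition dominates the negative powers of the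
  worst returns, simultaneously at all times shortly after the first waiting time \<open>e\<close>.\<close>

lemma worst_return_powr_le:
  assumes pos: "\<And>i. 0 < returns S 0 (e + u) \<omega> $ i" and u: "0 \<le> u" "u \<le> \<delta>" and \<gamma>: "\<gamma> < 0"
  shows "ennreal (worst_return (returns S 0 (e + u) \<omega>) powr \<gamma>)
    \<le> ereal_exp (ereal \<gamma> * (MIN i. INF t\<in>{0..\<delta>}. ereal (log_return S (e + t) \<omega> $ i)))"
proof -
  let ?r = "returns S 0 (e + u) \<omega>"
  let ?m = "MIN i. INF t\<in>{0..\<delta>}. ereal (log_return S (e + t) \<omega> $ i)"
  have "worst_return ?r \<in> range (($) ?r)" unfolding worst_return_def by (rule Min_in) auto
  then obtain i where i: "worst_return ?r = ?r $ i" by auto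
  have "?m \<le> (INF t\<in>{0..\<delta>}. ereal (log_return S (e + t) \<omega> $ i))" by (rule Min_le) auto
  also have "\<dots> \<le> ereal (log_return S (e + u) \<omega> $ i)" using u by (intro INF_lower) auto
  finally have "?m \<le> ereal (ln (?r $ i))" by (simp add: log_return_def)
  then have "ereal \<gamma> * ereal (ln (?r $ i)) \<le> ereal \<gamma> * ?m"
    using \<gamma> by (cases ?m) (auto intro: mult_left_mono_neg)
  then have "ereal_exp (ereal (\<gamma> * ln (?r $ i))) \<le> ereal_exp (ereal \<gamma> * ?m)"
    by (intro ereal_exp_mono) simp
  moreover have "worst_return ?r powr \<gamma> = exp (\<gamma> * ln (?r $ i))"
    unfolding i using pos[of i] by (simp add: powr_def)
  ultimately show ?thesis by (simp add: ereal_exp_def)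
qed

context market
begin

lemma returns_limit_from_right:
  assumes \<omega>: "\<omega> \<in> space M" and t: "0 \<le> t"
    and x: "x \<longlonglongrightarrow> t" "\<And>m. t \<le> x m"
  shows "(\<lambda>m. returns S 0 (x m) \<omega>) \<longlonglongrightarrow> returns S 0 t \<omega>"
proof (rule metric_LIMSEQ_I)
  fix e :: real assume e: "0 < e"
  have "((\<lambda>u. returns S 0 u \<omega>) \<longlongrightarrow> returns S 0 t \<omega>) (at_right t)"
    using returns_right_limit[OF \<omega> order_refl t] by simp
  from tendstoD[OF this e]
  obtain d where d: "0 < d" "\<And>u. t < u \<Longrightarrow> dist u t < d \<Longrightarrow> dist (returns S 0 u \<omega>) (returns S 0 t \<omega>) < e"
    unfolding eventually_at by fastforce
  obtain N where N: "\<And>m. N \<le> m \<Longrightarrow> dist (x m) t < d" using metric_LIMSEQ_D[OF x(1) d(1)] by blast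
  have "dist (returns S 0 (x m) \<omega>) (returns S 0 t \<omega>) < e" if "N \<le> m" for m
  proof (cases "x m = t")
    case True
    then show ?thesis using e by simp
  next
    case False
    then show ?thesis using d(2) N[OF that] x(2)[of m] by simp
  qed
  then show "\<exists>N. \<forall>m\<ge>N. dist (returns S 0 (x m) \<omega>) (returns S 0 t \<omega>) < e" by blast
qed

lemma period_return_0: "period_return 0 \<omega> = returns S 0 (wait 1 \<omega>) \<omega>"
  by (simp add: period_return_def intervention_time_Suc)

end

lemma tendsto_ereal_of_bounds:
  fixes r :: "nat \<Rightarrow> ereal"
  assumes "\<And>e. 0 < e \<Longrightarrow> \<forall>\<^sub>F m in sequentially. ereal b \<le> r m + ereal e \<and> r m \<le> ereal b + ereal e"
  shows "r \<longlonglongrightarrow> ereal b"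
proof (rule order_tendstoI)
  fix a assume "a < ereal b"
  then obtain b' where b': "a < ereal b'" "b' < b" using ereal_dense2[of a "ereal b"] by auto
  show "\<forall>\<^sub>F m in sequentially. a < r m"
    using assms[OF diff_gt_0_iff_gt[THEN iffD2, OF b'(2)]]
  proof eventually_elim
    case (elim m)
    then have "ereal b' \<le> r m" by (cases "r m") auto
    with b'(1) show ?case by order
  qed
next
  fix a assume "ereal b < a"
  then obtain b' where b': "ereal b' < a" "b < b'" using ereal_dense2[of "ereal b" a] by auto
  show "\<forall>\<^sub>F m in sequentially. r m < a"
    using assms[OF diff_gt_0_iff_gt[THEN iffD2, OF b'(2)]]
  proof eventually_elim
    case (elim m)
    then have "r m \<le> ereal b'" by simp
    with b'(1) show ?case by order
  qed
qed

section \<open>Convergence of the dyadic values\<close>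

theorem theorem5p1:
  fixes M :: "'w measure"
    and S :: "real \<Rightarrow> 'w \<Rightarrow> real^'d"
    and \<eta> :: "nat \<Rightarrow> 'w \<Rightarrow> real"
    and c h \<pi> :: "real^'d"
    and \<gamma> :: real
    and G :: "nat \<Rightarrow> 'w measure"
    and Gd :: "nat \<Rightarrow> nat \<Rightarrow> 'w measure"
  assumes "prob_space M"
    and "\<And>i. c $ i \<in> {0..<1}" and "\<And>i. h $ i \<in> {0..<1}"
    and "price_process M S"
    and "waiting_times M \<eta>"
    and "indep_of_prices M \<eta> S"
    and "\<gamma> < 0"
    and "increments_cond M S"
    and "waiting_times_cond M \<eta>"
    and "local_uniform_integrability M S \<eta>"
    and "information M S \<eta> G"
    and "\<And>m. information M S (dyadic m \<eta>) (Gd m)"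
    and "\<pi> \<in> weight_simplex"
  shows "(\<lambda>m. SUP P\<in>admissible M S (dyadic m \<eta>) (Gd m) \<pi>.
            growth_functional M \<gamma> c h S (dyadic m \<eta>) P \<pi>)
         \<longlonglongrightarrow> (SUP P\<in>admissible M S \<eta> G \<pi>. growth_functional M \<gamma> c h S \<eta> P \<pi>)"
proof -
  interpret costs: proportional_costs c h by unfold_locales (use assms(2,3) in blast)+
  interpret prob_space M by fact
  have market: "market M c h S \<eta> D" if "D \<in> borel_measurable borel" "\<And>x. 0 < x \<Longrightarrow> 0 < D x" for D
    using that assms(4,5,6,8) costs.proportional_costs_axioms prob_space_axioms
    by (intro market.intro market_axioms.intro)
  interpret C: market M c h S \<eta> "\<lambda>x. x" by (rule market) auto
  interpret Q: market M c h S \<eta> "dyadic_ceiling m" for m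
    by (rule market) (use dyadic_ceiling_bounds(1) in \<open>auto intro: less_le_trans\<close>)
  have C_wait: "C.wait = \<eta>" by (intro ext) (simp add: C.wait_def)
  have Q_wait: "Q.wait m = dyadic m \<eta>" for m by (intro ext) (simp add: Q.wait_def dyadic_eq)
  note \<gamma> = \<open>\<gamma> < 0\<close>
  have \<eta>1: "0 < \<eta> 1 \<omega>" if "\<omega> \<in> space M" for \<omega> using C.\<eta>_pos[of 1] that by simp

  obtain \<delta> where \<delta>: "0 < \<delta>" and integrable_bound: "(\<integral>\<^sup>+\<omega>. ereal_exp (ereal \<gamma> *
        (MIN i. INF t\<in>{0..\<delta>}. ereal (log_return S (\<eta> 1 \<omega> + t) \<omega> $ i))) \<partial>M) < \<infinity>"
    using assms(10) \<gamma> unfolding local_uniform_integrability_def by blast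
  define E where "E \<omega> = ereal_exp (ereal \<gamma> *
        (MIN i. INF t\<in>{0..\<delta>}. ereal (log_return S (\<eta> 1 \<omega> + t) \<omega> $ i)))" for \<omega>
  have E_bound: "ennreal (worst_return (returns S 0 (\<eta> 1 \<omega> + u) \<omega>) powr \<gamma>) \<le> E \<omega>"
    if "\<omega> \<in> space M" "0 \<le> u" "u \<le> \<delta>" for u \<omega>
    unfolding E_def using that \<eta>1[OF that(1)]
    by (intro worst_return_powr_le[OF _ _ _ \<gamma>] C.returns_pos) auto
  \<comment> \<open>from here on the dyadic waiting times stay in the window of the integrability condition\<close>
  obtain m0 where m0: "1 / 2 ^ m0 < \<delta>" using real_arch_pow_inv[of \<delta> "1 / 2"] \<delta> by (auto simp: power_one_over)
  have fine: "1 / 2 ^ m \<le> \<delta>" if "m0 \<le> m" for m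
  proof -
    have "(1 :: real) / 2 ^ m \<le> 1 / 2 ^ m0" using that by (intro divide_left_mono power_increasing) auto
    with m0 show ?thesis by linarith
  qed
  have Q_bound: "ennreal (worst_return (Q.period_return m 0 \<omega>) powr \<gamma>) \<le> E \<omega>"
    if "\<omega> \<in> space M" "m0 \<le> m" for m \<omega>
  proof -
    let ?u = "dyadic_ceiling m (\<eta> 1 \<omega>) - \<eta> 1 \<omega>"
    have "0 \<le> ?u" "?u \<le> \<delta>"
      using dyadic_ceiling_bounds[OF \<eta>1[OF that(1)], of m] fine[OF that(2)] by linarith+
    from E_bound[OF that(1) this] show ?thesis by (simp add: Q.period_return_0 Q.wait_def)
  qed
  have C_bound: "ennreal (worst_return (C.period_return 0 \<omega>) powr \<gamma>) \<le> E \<omega>" if "\<omega> \<in> space M" for \<omega>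
    using E_bound[OF that order_refl] \<delta> by (simp add: C.period_return_0 C.wait_def)

  have \<eta>_int: "integrable M (\<eta> 1)" using assms(9) by (simp add: waiting_times_cond_def)
  have Q_wait_bounds: "\<eta> 1 \<omega> \<le> Q.wait m 1 \<omega>" "Q.wait m 1 \<omega> \<le> \<eta> 1 \<omega> + 1 / 2 ^ m"
    if "\<omega> \<in> space M" for m \<omega>
    using dyadic_ceiling_bounds[OF \<eta>1[OF that]] by (simp_all add: Q.wait_def)
  have Q_int: "integrable M (Q.wait m 1)" for m
  proof (rule Bochner_Integration.integrable_bound)
    show "integrable M (\<lambda>\<omega>. \<eta> 1 \<omega> + 1 / 2 ^ m)" using \<eta>_int by simp
    show "AE \<omega> in M. norm (Q.wait m 1 \<omega>) \<le> norm (\<eta> 1 \<omega> + 1 / 2 ^ m)"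
      using Q_wait_bounds \<eta>1 by (intro AE_I2) (smt (verit) real_norm_def)
  qed (rule Q.wait_measurable, simp)
  have "(\<integral>\<^sup>+\<omega>. ennreal (worst_return (C.period_return 0 \<omega>) powr \<gamma>) \<partial>M) \<le> (\<integral>\<^sup>+\<omega>. E \<omega> \<partial>M)"
    by (rule nn_integral_mono) (rule C_bound)
  with integrable_bound have C_fin: "(\<integral>\<^sup>+\<omega>. ennreal (worst_return (C.period_return 0 \<omega>) powr \<gamma>) \<partial>M) < \<infinity>"
    unfolding E_def by (rule le_less_trans[rotated])
  interpret C: investment M c h S \<eta> "\<lambda>x. x" \<gamma> G \<pi>
    by (intro investment.intro investment_axioms.intro C.market_axioms C_fin)
       (use assms(11,13) \<gamma> \<eta>_int in \<open>simp_all add: C_wait\<close>)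
  have Q_investment: "investment M c h S \<eta> (dyadic_ceiling m) \<gamma> (Gd m) \<pi>" if "m0 \<le> m" for m
  proof (intro investment.intro investment_axioms.intro Q.market_axioms)
    have "(\<integral>\<^sup>+\<omega>. ennreal (worst_return (Q.period_return m 0 \<omega>) powr \<gamma>) \<partial>M) \<le> (\<integral>\<^sup>+\<omega>. E \<omega> \<partial>M)"
      using that by (intro nn_integral_mono Q_bound)
    with integrable_bound show "(\<integral>\<^sup>+\<omega>. ennreal (worst_return (Q.period_return m 0 \<omega>) powr \<gamma>) \<partial>M) < \<infinity>"
      unfolding E_def by (rule le_less_trans[rotated])
  qed (use assms(12,13) \<gamma> Q_int in \<open>simp_all add: Q_wait\<close>)

  define mean where "mean m = integral\<^sup>L M (Q.wait m 1)" for m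
  define rate where "rate m = decay_rate (\<lambda>n. optimal_moment M c h \<gamma> (Q.period_return m 0) n \<pi>)" for m
  have Q_value: "(SUP P\<in>admissible M S (dyadic m \<eta>) (Gd m) \<pi>. growth_functional M \<gamma> c h S (dyadic m \<eta>) P \<pi>)
      = ereal (1 / (- \<gamma> * mean m)) * rate m" if "m0 \<le> m" for m
  proof -
    interpret I: investment M c h S \<eta> "dyadic_ceiling m" \<gamma> "Gd m" \<pi> by (rule Q_investment[OF that])
    show ?thesis
      using I.optimal_growth unfolding I.scale_def I.mean_wait_def Q_wait mean_def rate_def .
  qed

  have mean_lim: "mean \<longlonglongrightarrow> C.mean_wait"
  proof (rule tendsto_sandwich[OF always_eventually always_eventually tendsto_const])
    show "\<forall>m. C.mean_wait \<le> mean m"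
      unfolding mean_def C.mean_wait_def C_wait
      using \<eta>_int Q_int Q_wait_bounds by (intro allI integral_mono) auto
    show "\<forall>m. mean m \<le> C.mean_wait + (1 / 2) ^ m"
    proof
      fix m
      have "mean m \<le> (\<integral>\<omega>. \<eta> 1 \<omega> + 1 / 2 ^ m \<partial>M)"
        unfolding mean_def using \<eta>_int Q_int Q_wait_bounds by (intro integral_mono) auto
      also have "\<dots> = C.mean_wait + (1 / 2) ^ m"
        using \<eta>_int by (simp add: C.mean_wait_def C_wait prob_space power_one_over)
      finally show "mean m \<le> C.mean_wait + (1 / 2) ^ m" .
    qed
    have "(\<lambda>m. C.mean_wait + (1 / 2) ^ m) \<longlonglongrightarrow> C.mean_wait + 0"
      by (intro tendsto_add tendsto_const LIMSEQ_power_zero) simp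
    then show "(\<lambda>m. C.mean_wait + (1 / 2) ^ m) \<longlonglongrightarrow> C.mean_wait" by simp
  qed

  have return_lim: "(\<lambda>m. Q.period_return m 0 \<omega> $ i) \<longlonglongrightarrow> C.period_return 0 \<omega> $ i"
    if \<omega>: "\<omega> \<in> space M" for \<omega> i
  proof (rule tendsto_vec_nth)
    have upper: "(\<lambda>m. \<eta> 1 \<omega> + (1 / 2) ^ m) \<longlonglongrightarrow> \<eta> 1 \<omega> + 0"
      by (intro tendsto_add tendsto_const LIMSEQ_power_zero) simp
    have "(\<lambda>m. Q.wait m 1 \<omega>) \<longlonglongrightarrow> \<eta> 1 \<omega>"
      by (rule tendsto_sandwich[OF always_eventually always_eventually tendsto_const upper[unfolded add_0_right]])
         (use Q_wait_bounds[OF \<omega>] in \<open>simp_all add: power_one_over\<close>)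
    then show "(\<lambda>m. Q.period_return m 0 \<omega>) \<longlonglongrightarrow> C.period_return 0 \<omega>"
      unfolding Q.period_return_0 C.period_return_0 C_wait
      using Q_wait_bounds[OF \<omega>] \<eta>1[OF \<omega>] by (intro C.returns_limit_from_right[OF \<omega>]) auto
  qed
  have Q_measurable: "Q.period_return m 0 \<in> borel_measurable M" for m
    by (rule Q.period_return_measurable[where G = "Gd m", unfolded Q_wait, OF assms(12)])
  \<comment> \<open>a measurable majorant below \<open>E\<close>, which involves infima over uncountably many times\<close>
  define B where "B \<omega> = (SUP m\<in>{m0..}. ennreal (worst_return (Q.period_return m 0 \<omega>) powr \<gamma>))" for \<omega>
  have B_meas: "B \<in> borel_measurable M"
    unfolding B_def[abs_def]
  proof (rule borel_measurable_SUP)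
    fix m
    show "(\<lambda>\<omega>. ennreal (worst_return (Q.period_return m 0 \<omega>) powr \<gamma>)) \<in> borel_measurable M"
      by (rule measurable_compose[OF Q_measurable borel_measurable_worst_return_powr])
  qed simp
  have "(\<integral>\<^sup>+\<omega>. B \<omega> \<partial>M) \<le> (\<integral>\<^sup>+\<omega>. E \<omega> \<partial>M)"
    unfolding B_def by (intro nn_integral_mono SUP_least Q_bound) auto
  with integrable_bound have B_fin: "(\<integral>\<^sup>+\<omega>. B \<omega> \<partial>M) < \<infinity>"
    unfolding E_def by (rule le_less_trans[rotated])
  have Q_market: "one_period_market M c h \<gamma> (Q.period_return m 0)" if "m0 \<le> m" for m
  proof -
    interpret I: investment M c h S \<eta> "dyadic_ceiling m" \<gamma> "Gd m" \<pi> by (rule Q_investment[OF that])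
    show ?thesis by (rule I.one_period_market_axioms)
  qed
  have moments_close: "\<forall>\<^sub>F m in sequentially. \<forall>n. \<forall>x\<in>position_cone.
      optimal_moment M c h \<gamma> (Q.period_return m 0) n x \<le> ennreal ((1 + \<epsilon>) ^ n) * C.\<U> n x \<and>
      C.\<U> n x \<le> ennreal ((1 + \<epsilon>) ^ n) * optimal_moment M c h \<gamma> (Q.period_return m 0) n x" if "0 < \<epsilon>" for \<epsilon>
  proof (rule C.eventually_optimal_moment_close[OF _ return_lim B_meas B_fin _ that])
    show "\<forall>\<^sub>F m in sequentially. one_period_market M c h \<gamma> (Q.period_return m 0)"
      by (rule eventually_mono[OF eventually_ge_at_top[of m0]]) (rule Q_market)
    show "\<forall>\<^sub>F m in sequentially. \<forall>\<omega>\<in>space M. ennreal (worst_return (Q.period_return m 0 \<omega>) powr \<gamma>) \<le> B \<omega>"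
      by (rule eventually_mono[OF eventually_ge_at_top[of m0]]) (auto simp: B_def intro: SUP_upper)
  qed

  have \<pi>: "\<pi> \<in> position_cone" using assms(13) simplex_subset_cone by blast
  obtain b where b: "decay_rate (\<lambda>n. C.\<U> n \<pi>) = ereal b"
    using C.decay_rate_finite[OF assms(13)] by (cases "decay_rate (\<lambda>n. C.\<U> n \<pi>)") auto
  have rate_lim: "rate \<longlonglongrightarrow> ereal b"
  proof (rule tendsto_ereal_of_bounds)
    fix e :: real assume e: "0 < e"
    \<comment> \<open>relative errors \<open>1 + \<epsilon>\<close> per period shift the decay rate by at most \<open>ln (1 + \<epsilon>) = e\<close>\<close>
    define \<epsilon> where "\<epsilon> = exp e - 1"
    have \<epsilon>: "0 < \<epsilon>" "ln (1 + \<epsilon>) = e" using e by (simp_all add: \<epsilon>_def)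
    show "\<forall>\<^sub>F m in sequentially. ereal b \<le> rate m + ereal e \<and> rate m \<le> ereal b + ereal e"
      using moments_close[OF \<epsilon>(1)] eventually_ge_at_top[of m0]
    proof eventually_elim
      case (elim m)
      interpret I: one_period_market M c h \<gamma> "Q.period_return m 0" by (rule Q_market[OF elim(2)])
      have "ereal b \<le> rate m + ereal (ln (1 + \<epsilon>))"
        unfolding b[symmetric] rate_def
        by (rule decay_rate_le_perturbed)
           (use elim(1) \<pi> \<epsilon> C.optimal_moment_finite_pos I.optimal_moment_finite_pos in auto)
      moreover have "rate m \<le> ereal b + ereal (ln (1 + \<epsilon>))"
        unfolding b[symmetric] rate_def
        by (rule decay_rate_le_perturbed)
           (use elim(1) \<pi> \<epsilon> C.optimal_moment_finite_pos I.optimal_moment_finite_pos in auto)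
      ultimately show ?case by (simp add: \<epsilon>(2))
    qed
  qed
  have "(\<lambda>m. 1 / (- \<gamma> * mean m)) \<longlonglongrightarrow> C.scale"
    unfolding C.scale_def using C.mean_wait_pos \<gamma> by (intro tendsto_intros mean_lim) auto
  then have "(\<lambda>m. ereal (1 / (- \<gamma> * mean m)) * rate m) \<longlonglongrightarrow> ereal C.scale * ereal b"
    by (intro tendsto_mult_ereal tendsto_ereal rate_lim) auto
  also have "ereal C.scale * ereal b = (SUP P\<in>admissible M S \<eta> G \<pi>. growth_functional M \<gamma> c h S \<eta> P \<pi>)"
    using C.optimal_growth unfolding C_wait b by simp
  finally show ?thesis
    by (rule Lim_transform_eventually)
       (rule eventually_mono[OF eventually_ge_at_top[of m0]], rule Q_value[symmetric])
qed

end
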